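(* Let $\Gamma$ be a finite group and let $\mathcal C$ be a finite set of finite $\Gamma$-groups. Let $|\mathcal C|$ be the least common multiple of the orders of the elements of $\mathcal C$ and assume $\gcd(|\Gamma|,|\mathcal C|)=1$. Let $\mu$ be a measure on the set of isomorphism classes of finite level-$\mathcal C$ $\Gamma$-groups, and let $(\mu_t)_{t\in\mathbb N}$ be a sequence of measures on the same set. Assume that for each finite level-$\mathcal C$ $\Gamma$-group $H$ we have \[ \lim_{t\to\infty}\int \operatorname{Sur}_\Gamma(X,H)\,d\mu_t(X)=\int\operatorname{Sur}_\Gamma(X,H)\,d\mu(X), \] and that \[ \int\operatorname{Sur}_\Gamma(X,H)\,d\mu(X)=O\left(|H|^{O(1)}\right), \] i.e. there are constants $A,B$ independent of $H$ such that $\int\operatorname{Sur}_\Gamma(X,H)\,d\mu(X)\le A|H|^B$ for every finite level-$\mathcal C$ $\Gamma$-group $H$. Then for every finite level-$\mathcal C$ $\Gamma$-group $H$ we have \[ \lim_{t\to\infty}\mu_t(H)=\mu(H). \]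
   Context: A $\Gamma$-group is a profinite group with a continuous action of $\Gamma$; isomorphisms are $\Gamma$-equivariant. A finite $\Gamma$-group is level-$\mathcal C$ if it is (isomorphic to) a $\Gamma$-invariant quotient of a $\Gamma$-invariant subgroup of a finite product of $\Gamma$-groups in $\mathcal C$ (repetitions allowed). $\operatorname{Sur}_\Gamma(X,H)$ denotes the number of $\Gamma$-equivariant surjective homomorphisms $X\to H$. The set of isomorphism classes is given the discrete topology, and measures are nonnegative; $\mu(H)$ is the measure of the isomorphism class of $H$. *)

theory Defs
  imports "HOL-Algebra.Algebra" "HOL-Analysis.Analysis"
begin

text \<open>
  \<open>\<Gamma>\<close> is a finite group in the sense of HOL-Algebra.  All \<open>\<Gamma>\<close>-groups that occur are finite, hence
  carry the discrete topology, and continuity of the action is automatic.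
\<close>

record ('a, 'g) gamma_group = "'a monoid" +
  act :: "'g \<Rightarrow> 'a \<Rightarrow> 'a"

text \<open>
  The library's automorphism group consists of extensional functions, so \<open>act G \<gamma>\<close> takes the value
  \<open>undefined\<close> outside \<open>carrier G\<close>; this is why the constructions below use \<open>restrict\<close>.
\<close>

definition is_gamma_group :: "('g, 'm) monoid_scheme \<Rightarrow> ('a, 'g) gamma_group \<Rightarrow> bool" where
  "is_gamma_group \<Gamma> G \<longleftrightarrow> group G \<and> group_hom \<Gamma> (AutoGroup G) (act G)"

definition finite_gamma_group :: "('g, 'm) monoid_scheme \<Rightarrow> ('a, 'g) gamma_group \<Rightarrow> bool" where
  "finite_gamma_group \<Gamma> G \<longleftrightarrow> is_gamma_group \<Gamma> G \<and> finite (carrier G)"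

definition equivariant ::
  "('g, 'm) monoid_scheme \<Rightarrow> ('a, 'g) gamma_group \<Rightarrow> ('b, 'g) gamma_group \<Rightarrow> ('a \<Rightarrow> 'b) \<Rightarrow> bool" where
  "equivariant \<Gamma> G H f \<longleftrightarrow>
     (\<forall>\<gamma>\<in>carrier \<Gamma>. \<forall>x\<in>carrier G. f (act G \<gamma> x) = act H \<gamma> (f x))"

definition gamma_isomorphic ::
  "('g, 'm) monoid_scheme \<Rightarrow> ('a, 'g) gamma_group \<Rightarrow> ('b, 'g) gamma_group \<Rightarrow> bool" where
  "gamma_isomorphic \<Gamma> G H \<longleftrightarrow> (\<exists>f\<in>iso G H. equivariant \<Gamma> G H f)"

text \<open>
  Surjective equivariant homomorphisms, as extensional functions so that each is counted once.
\<close>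

definition gamma_epi ::
  "('g, 'm) monoid_scheme \<Rightarrow> ('a, 'g) gamma_group \<Rightarrow> ('b, 'g) gamma_group \<Rightarrow> ('a \<Rightarrow> 'b) set" where
  "gamma_epi \<Gamma> G H = {f \<in> epi G H \<inter> extensional (carrier G). equivariant \<Gamma> G H f}"

definition gamma_invariant ::
  "('g, 'm) monoid_scheme \<Rightarrow> ('a, 'g) gamma_group \<Rightarrow> 'a set \<Rightarrow> bool" where
  "gamma_invariant \<Gamma> G K \<longleftrightarrow> (\<forall>\<gamma>\<in>carrier \<Gamma>. act G \<gamma> ` K \<subseteq> K)"

definition gamma_product :: "'i set \<Rightarrow> ('i \<Rightarrow> ('a, 'g) gamma_group) \<Rightarrow> ('i \<Rightarrow> 'a, 'g) gamma_group" where
  "gamma_product I F = monoid.extend (product_group I F)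
     (gamma_group.fields (\<lambda>\<gamma>. \<lambda>x\<in>carrier (product_group I F). \<lambda>i\<in>I. act (F i) \<gamma> (x i)))"

definition gamma_subgroup :: "('a, 'g) gamma_group \<Rightarrow> 'a set \<Rightarrow> ('a, 'g) gamma_group" where
  "gamma_subgroup G K = G\<lparr>carrier := K, act := (\<lambda>\<gamma>. restrict (act G \<gamma>) K)\<rparr>"

definition gamma_quotient :: "('a, 'g) gamma_group \<Rightarrow> 'a set \<Rightarrow> ('a set, 'g) gamma_group" where
  "gamma_quotient G N = monoid.extend (G Mod N)
     (gamma_group.fields (\<lambda>\<gamma>. \<lambda>A\<in>carrier (G Mod N). act G \<gamma> ` A))"

text \<open>
  The factors \<open>F 0, \<dots>, F (n - 1)\<close> need not be distinct, and \<open>n = 0\<close> gives the trivial \<open>\<Gamma>\<close>-group.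
\<close>

definition level ::
  "('g, 'm) monoid_scheme \<Rightarrow> ('a, 'g) gamma_group set \<Rightarrow> ('b, 'g) gamma_group \<Rightarrow> bool" where
  "level \<Gamma> \<C> H \<longleftrightarrow>
     (\<exists>(n::nat) F K N.
        (\<forall>i<n. F i \<in> \<C>) \<and>
        subgroup K (gamma_product {..<n} F) \<and>
        gamma_invariant \<Gamma> (gamma_product {..<n} F) K \<and>
        N \<lhd> gamma_subgroup (gamma_product {..<n} F) K \<and>
        gamma_invariant \<Gamma> (gamma_subgroup (gamma_product {..<n} F) K) N \<and>
        gamma_isomorphic \<Gamma> H (gamma_quotient (gamma_subgroup (gamma_product {..<n} F) K) N))"

text \<open>
  Up to isomorphism every finite \<open>\<Gamma>\<close>-group has a set of natural numbers as its carrier, so that the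
  isomorphism classes of finite level-\<open>\<C>\<close> \<open>\<Gamma>\<close>-groups form a set of the following type.
\<close>

definition level_groups ::
  "('g, 'm) monoid_scheme \<Rightarrow> ('a, 'g) gamma_group set \<Rightarrow> (nat, 'g) gamma_group set" where
  "level_groups \<Gamma> \<C> = {H. finite_gamma_group \<Gamma> H \<and> level \<Gamma> \<C> H}"

definition iso_rel ::
  "('g, 'm) monoid_scheme \<Rightarrow> ('a, 'g) gamma_group set \<Rightarrow> (nat, 'g) gamma_group rel" where
  "iso_rel \<Gamma> \<C> = {(G, H) \<in> level_groups \<Gamma> \<C> \<times> level_groups \<Gamma> \<C>. gamma_isomorphic \<Gamma> G H}"

definition level_classes ::
  "('g, 'm) monoid_scheme \<Rightarrow> ('a, 'g) gamma_group set \<Rightarrow> (nat, 'g) gamma_group set set" where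
  "level_classes \<Gamma> \<C> = level_groups \<Gamma> \<C> // iso_rel \<Gamma> \<C>"

definition iso_class ::
  "('g, 'm) monoid_scheme \<Rightarrow> ('a, 'g) gamma_group set \<Rightarrow> (nat, 'g) gamma_group
    \<Rightarrow> (nat, 'g) gamma_group set" where
  "iso_class \<Gamma> \<C> H = iso_rel \<Gamma> \<C> `` {H}"

text \<open>
  \<open>Sur_\<Gamma>(S, H)\<close> for an isomorphism class \<open>S\<close>: the count for any representative of \<open>S\<close>; see
  \<open>Sur_iso_class\<close> below.
\<close>

definition Sur ::
  "('g, 'm) monoid_scheme \<Rightarrow> ('a, 'g) gamma_group set \<Rightarrow> ('b, 'g) gamma_group \<Rightarrow> nat" where
  "Sur \<Gamma> S H = card (gamma_epi \<Gamma> (SOME G. G \<in> S) H)"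

lemma act_closed:
  assumes "is_gamma_group \<Gamma> G" "\<gamma> \<in> carrier \<Gamma>" "x \<in> carrier G"
  shows "act G \<gamma> x \<in> carrier G"
proof -
  have "act G \<gamma> \<in> Bij (carrier G)"
    using assms group_hom.hom_closed[of \<Gamma> "AutoGroup G" "act G" \<gamma>]
    by (auto simp: is_gamma_group_def AutoGroup_def auto_def)
  then show ?thesis using assms(3) by (auto dest: Bij_imp_funcset)
qed

lemma is_gamma_groupI:
  assumes "group \<Gamma>" "group G"
    and ext: "\<And>g. g \<in> carrier \<Gamma> \<Longrightarrow> act G g \<in> extensional (carrier G)"
    and cl: "\<And>g x. g \<in> carrier \<Gamma> \<Longrightarrow> x \<in> carrier G \<Longrightarrow> act G g x \<in> carrier G"
    and hom: "\<And>g x y. g \<in> carrier \<Gamma> \<Longrightarrow> x \<in> carrier G \<Longrightarrow> y \<in> carrier G \<Longrightarrow>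
        act G g (x \<otimes>\<^bsub>G\<^esub> y) = act G g x \<otimes>\<^bsub>G\<^esub> act G g y"
    and one: "\<And>x. x \<in> carrier G \<Longrightarrow> act G \<one>\<^bsub>\<Gamma>\<^esub> x = x"
    and mult: "\<And>g h x. g \<in> carrier \<Gamma> \<Longrightarrow> h \<in> carrier \<Gamma> \<Longrightarrow> x \<in> carrier G \<Longrightarrow>
        act G (g \<otimes>\<^bsub>\<Gamma>\<^esub> h) x = act G g (act G h x)"
  shows "is_gamma_group \<Gamma> G"
proof -
  interpret \<Gamma>: group \<Gamma> by fact
  have bij: "act G g \<in> Bij (carrier G)" if "g \<in> carrier \<Gamma>" for g
  proof -
    have "bij_betw (act G g) (carrier G) (carrier G)"
      by (rule bij_betw_byWitness[where f' = "act G (inv\<^bsub>\<Gamma>\<^esub> g)"])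
        (use that cl one mult[of "inv\<^bsub>\<Gamma>\<^esub> g" g] mult[of g "inv\<^bsub>\<Gamma>\<^esub> g"] in \<open>auto\<close>)
    then show ?thesis using ext[OF that] by (simp add: Bij_def)
  qed
  have "act G g \<in> auto G" if "g \<in> carrier \<Gamma>" for g
    using bij[OF that] that cl hom by (auto simp: auto_def hom_def)
  moreover have "act G (g \<otimes>\<^bsub>\<Gamma>\<^esub> h) = compose (carrier G) (act G g) (act G h)"
    if "g \<in> carrier \<Gamma>" "h \<in> carrier \<Gamma>" for g h
    using that ext[of "g \<otimes>\<^bsub>\<Gamma>\<^esub> h"] mult
    by (intro extensionalityI[where A = "carrier G"]) (auto simp: compose_def)
  ultimately have "act G \<in> hom \<Gamma> (AutoGroup G)"
    using bij by (auto simp: hom_def AutoGroup_def BijGroup_def)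
  then show ?thesis
    using assms(1,2) group.AutoGroup[OF assms(2)]
    by (simp add: is_gamma_group_def group_hom_def group_hom_axioms_def)
qed

lemma
  assumes "is_gamma_group \<Gamma> G"
  shows is_gamma_group_group: "group \<Gamma>" "group G"
    and act_ext: "g \<in> carrier \<Gamma> \<Longrightarrow> act G g \<in> extensional (carrier G)"
    and act_hom: "g \<in> carrier \<Gamma> \<Longrightarrow> x \<in> carrier G \<Longrightarrow> y \<in> carrier G \<Longrightarrow>
        act G g (x \<otimes>\<^bsub>G\<^esub> y) = act G g x \<otimes>\<^bsub>G\<^esub> act G g y"
    and act_one: "x \<in> carrier G \<Longrightarrow> act G \<one>\<^bsub>\<Gamma>\<^esub> x = x"
    and act_mult: "g \<in> carrier \<Gamma> \<Longrightarrow> h \<in> carrier \<Gamma> \<Longrightarrow> x \<in> carrier G \<Longrightarrow>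
        act G (g \<otimes>\<^bsub>\<Gamma>\<^esub> h) x = act G g (act G h x)"
proof -
  interpret gh: group_hom \<Gamma> "AutoGroup G" "act G"
    using assms by (simp add: is_gamma_group_def)
  show "group \<Gamma>" "group G" using assms gh.G.is_group by (simp_all add: is_gamma_group_def)
  have au: "act G g \<in> auto G" if "g \<in> carrier \<Gamma>" for g
    using gh.hom_closed[OF that] by (simp add: AutoGroup_def)
  then show "g \<in> carrier \<Gamma> \<Longrightarrow> act G g \<in> extensional (carrier G)"
    by (auto simp: auto_def Bij_def)
  show "g \<in> carrier \<Gamma> \<Longrightarrow> x \<in> carrier G \<Longrightarrow> y \<in> carrier G \<Longrightarrow>
        act G g (x \<otimes>\<^bsub>G\<^esub> y) = act G g x \<otimes>\<^bsub>G\<^esub> act G g y"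
    using au by (auto simp: auto_def hom_def)
  show "x \<in> carrier G \<Longrightarrow> act G \<one>\<^bsub>\<Gamma>\<^esub> x = x"
    using gh.hom_one by (simp add: AutoGroup_def BijGroup_def)
  show "g \<in> carrier \<Gamma> \<Longrightarrow> h \<in> carrier \<Gamma> \<Longrightarrow> x \<in> carrier G \<Longrightarrow>
        act G (g \<otimes>\<^bsub>\<Gamma>\<^esub> h) x = act G g (act G h x)"
    using au[of g] au[of h] gh.hom_mult[of g h]
    by (simp add: AutoGroup_def BijGroup_def auto_def compose_def)
qed

lemma gamma_product_simps [simp]:
  "carrier (gamma_product I F) = (\<Pi>\<^sub>E i\<in>I. carrier (F i))"
  "x \<otimes>\<^bsub>gamma_product I F\<^esub> y = (\<lambda>i\<in>I. x i \<otimes>\<^bsub>F i\<^esub> y i)"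
  "\<one>\<^bsub>gamma_product I F\<^esub> = (\<lambda>i\<in>I. \<one>\<^bsub>F i\<^esub>)"
  "act (gamma_product I F) = (\<lambda>\<gamma>. \<lambda>x\<in>(\<Pi>\<^sub>E i\<in>I. carrier (F i)). \<lambda>i\<in>I. act (F i) \<gamma> (x i))"
  by (simp_all add: gamma_product_def monoid.defs gamma_group.defs)

lemma gamma_subgroup_simps [simp]:
  "carrier (gamma_subgroup G K) = K"
  "x \<otimes>\<^bsub>gamma_subgroup G K\<^esub> y = x \<otimes>\<^bsub>G\<^esub> y"
  "\<one>\<^bsub>gamma_subgroup G K\<^esub> = \<one>\<^bsub>G\<^esub>"
  "act (gamma_subgroup G K) = (\<lambda>\<gamma>. restrict (act G \<gamma>) K)"
  by (simp_all add: gamma_subgroup_def)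

lemma gamma_quotient_simps [simp]:
  "carrier (gamma_quotient G N) = carrier (G Mod N)"
  "A \<otimes>\<^bsub>gamma_quotient G N\<^esub> B = A \<otimes>\<^bsub>G Mod N\<^esub> B"
  "\<one>\<^bsub>gamma_quotient G N\<^esub> = \<one>\<^bsub>G Mod N\<^esub>"
  "act (gamma_quotient G N) = (\<lambda>\<gamma>. \<lambda>A\<in>carrier (G Mod N). act G \<gamma> ` A)"
  by (simp_all add: gamma_quotient_def monoid.defs gamma_group.defs)

lemma group_cong_ops:
  assumes "group G" "carrier G' = carrier G"
    "\<And>x y. x \<in> carrier G \<Longrightarrow> y \<in> carrier G \<Longrightarrow> x \<otimes>\<^bsub>G'\<^esub> y = x \<otimes>\<^bsub>G\<^esub> y" "\<one>\<^bsub>G'\<^esub> = \<one>\<^bsub>G\<^esub>"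
  shows "group G'"
proof -
  interpret group G by fact
  show ?thesis
    by (rule groupI) (use assms in \<open>auto simp: m_assoc intro: l_inv_ex\<close>)
qed

lemma is_gamma_group_product:
  assumes "group \<Gamma>" "\<And>i. i \<in> I \<Longrightarrow> is_gamma_group \<Gamma> (F i)"
  shows "is_gamma_group \<Gamma> (gamma_product I F)"
proof (rule is_gamma_groupI)
  have gr: "group (F i)" if "i \<in> I" for i using assms that by (blast dest: is_gamma_group_group)
  show "group (gamma_product I F)"
    by (rule group_cong_ops[OF product_group[OF gr]]) auto
  have m: "x i \<otimes>\<^bsub>F i\<^esub> y i \<in> carrier (F i)"
    if "x \<in> (\<Pi>\<^sub>E i\<in>I. carrier (F i))" "y \<in> (\<Pi>\<^sub>E i\<in>I. carrier (F i))" "i \<in> I" for x y i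
    using that gr[of i] by (meson PiE_mem group.is_monoid monoid.m_closed)
  interpret \<Gamma>: group \<Gamma> by fact
  show "act (gamma_product I F) g (x \<otimes>\<^bsub>gamma_product I F\<^esub> y) =
        act (gamma_product I F) g x \<otimes>\<^bsub>gamma_product I F\<^esub> act (gamma_product I F) g y"
    if "g \<in> carrier \<Gamma>" "x \<in> carrier (gamma_product I F)" "y \<in> carrier (gamma_product I F)" for g x y
    using that m by (auto simp: act_hom[OF assms(2)] PiE_iff intro!: restrict_ext)
  show "act (gamma_product I F) g x \<in> carrier (gamma_product I F)"
    if "g \<in> carrier \<Gamma>" "x \<in> carrier (gamma_product I F)" for g x
    using that by (auto simp: act_closed[OF assms(2)] PiE_iff)
  show "act (gamma_product I F) \<one>\<^bsub>\<Gamma>\<^esub> x = x" if "x \<in> carrier (gamma_product I F)" for x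
    using that by (auto simp: act_one[OF assms(2)] PiE_iff extensional_def)
  show "act (gamma_product I F) (g \<otimes>\<^bsub>\<Gamma>\<^esub> h) x = act (gamma_product I F) g (act (gamma_product I F) h x)"
    if "g \<in> carrier \<Gamma>" "h \<in> carrier \<Gamma>" "x \<in> carrier (gamma_product I F)" for g h x
    using that by (auto simp: act_mult[OF assms(2)] act_closed[OF assms(2)] PiE_iff intro!: restrict_ext)
qed (use assms in auto)

lemma is_gamma_group_subgroup:
  assumes "is_gamma_group \<Gamma> G" "subgroup K G" "gamma_invariant \<Gamma> G K"
  shows "is_gamma_group \<Gamma> (gamma_subgroup G K)"
proof -
  note gs = is_gamma_group_group[OF assms(1)]
  interpret \<Gamma>: group \<Gamma> by (fact gs)
  have KG: "x \<in> carrier G" if "x \<in> K" for x using that assms(2) by (meson subgroup.mem_carrier)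
  have inv: "act G g x \<in> K" if "g \<in> carrier \<Gamma>" "x \<in> K" for g x
    using assms(3) that by (auto simp: gamma_invariant_def)
  show ?thesis
  proof (rule is_gamma_groupI)
    show "group (gamma_subgroup G K)"
      by (rule group_cong_ops[OF subgroup.subgroup_is_group[OF assms(2) gs(2)]]) auto
  qed (use gs inv KG assms(2) in \<open>auto simp: act_hom[OF assms(1)] act_one[OF assms(1)]
          act_mult[OF assms(1)] subgroup.m_closed\<close>)
qed

lemma is_gamma_group_quotient:
  assumes "is_gamma_group \<Gamma> G" "N \<lhd> G" "gamma_invariant \<Gamma> G N"
  shows "is_gamma_group \<Gamma> (gamma_quotient G N)"
proof -
  note gs = is_gamma_group_group[OF assms(1)]
  interpret \<Gamma>: group \<Gamma> by (fact gs)
  interpret N: normal N G by fact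
  have inv: "act G g x \<in> N" if "g \<in> carrier \<Gamma>" "x \<in> N" for g x
    using assms(3) that by (auto simp: gamma_invariant_def)
  have im: "act G g ` N = N" if g: "g \<in> carrier \<Gamma>" for g
  proof
    show "N \<subseteq> act G g ` N"
    proof
      fix x assume x: "x \<in> N"
      have "act G g (act G (inv\<^bsub>\<Gamma>\<^esub> g) x) = x"
        using g x by (simp flip: act_mult[OF assms(1)] add: act_one[OF assms(1)])
      then show "x \<in> act G g ` N" using inv[of "inv\<^bsub>\<Gamma>\<^esub> g" x] g x by (metis \<Gamma>.inv_closed imageI)
    qed
  qed (use inv g in auto)
  have coset: "act G g ` (N #>\<^bsub>G\<^esub> a) = N #>\<^bsub>G\<^esub> act G g a" if "g \<in> carrier \<Gamma>" "a \<in> carrier G" for g a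
  proof -
    have "act G g ` (N #>\<^bsub>G\<^esub> a) = (\<lambda>n. act G g n \<otimes>\<^bsub>G\<^esub> act G g a) ` N"
      using that by (force simp: r_coset_def act_hom[OF assms(1)])
    also have "\<dots> = (\<lambda>n. n \<otimes>\<^bsub>G\<^esub> act G g a) ` (act G g ` N)" by (simp add: image_image)
    also have "\<dots> = N #>\<^bsub>G\<^esub> act G g a" by (auto simp: im[OF that(1)] r_coset_def)
    finally show ?thesis .
  qed
  show ?thesis
  proof (rule is_gamma_groupI)
    show "group (gamma_quotient G N)"
      by (rule group_cong_ops[OF N.factorgroup_is_group]) auto
    let ?Q = "gamma_quotient G N"
    have rep: "\<exists>a\<in>carrier G. A = N #>\<^bsub>G\<^esub> a" if "A \<in> carrier ?Q" for A
      using that by (auto simp: carrier_FactGroup)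
    have mem: "N #>\<^bsub>G\<^esub> a \<in> carrier (G Mod N)" if "a \<in> carrier G" for a
      using that by (auto simp: carrier_FactGroup)
    have ac: "act ?Q g (N #>\<^bsub>G\<^esub> a) = N #>\<^bsub>G\<^esub> act G g a" if "g \<in> carrier \<Gamma>" "a \<in> carrier G" for g a
      using that by (simp add: mem coset)
    note [simp del] = gamma_quotient_simps(4)
    show "act ?Q g A \<in> carrier ?Q" if "g \<in> carrier \<Gamma>" "A \<in> carrier ?Q" for g A
      using rep[OF that(2)] that by (auto simp: ac mem act_closed[OF assms(1)])
    show "act ?Q g (A \<otimes>\<^bsub>?Q\<^esub> B) = act ?Q g A \<otimes>\<^bsub>?Q\<^esub> act ?Q g B"
      if "g \<in> carrier \<Gamma>" "A \<in> carrier ?Q" "B \<in> carrier ?Q" for g A B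
      using rep[OF that(2)] rep[OF that(3)] that(1)
      by (auto simp: N.rcos_sum ac act_hom[OF assms(1)] act_closed[OF assms(1)])
    show "act ?Q \<one>\<^bsub>\<Gamma>\<^esub> A = A" if "A \<in> carrier ?Q" for A
      using rep[OF that] by (auto simp: ac act_one[OF assms(1)])
    show "act ?Q (g \<otimes>\<^bsub>\<Gamma>\<^esub> h) A = act ?Q g (act ?Q h A)"
      if "g \<in> carrier \<Gamma>" "h \<in> carrier \<Gamma>" "A \<in> carrier ?Q" for g h A
      using rep[OF that(3)] that(1,2)
      by (auto simp: ac act_mult[OF assms(1)] act_closed[OF assms(1)])
  qed (use gs in \<open>auto simp: extensional_def\<close>)
qed

lemma gamma_isomorphic_refl: "is_gamma_group \<Gamma> G \<Longrightarrow> gamma_isomorphic \<Gamma> G G"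
  unfolding gamma_isomorphic_def equivariant_def
  by (rule bexI[of _ id]) (simp_all add: iso_def hom_def)

lemma gamma_isomorphic_trans:
  assumes "gamma_isomorphic \<Gamma> G H" "gamma_isomorphic \<Gamma> H K"
  shows "gamma_isomorphic \<Gamma> G K"
proof -
  obtain f h where f: "f \<in> iso G H" "equivariant \<Gamma> G H f" and h: "h \<in> iso H K" "equivariant \<Gamma> H K h"
    using assms by (auto simp: gamma_isomorphic_def)
  have "h \<circ> f \<in> iso G K" using f h by (simp add: iso_set_trans)
  moreover have "equivariant \<Gamma> G K (h \<circ> f)"
    using f h by (auto simp: equivariant_def iso_def hom_def Pi_iff)
  ultimately show ?thesis by (auto simp: gamma_isomorphic_def)
qed

lemma gamma_isomorphic_sym:
  assumes "is_gamma_group \<Gamma> G" "gamma_isomorphic \<Gamma> G H"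
  shows "gamma_isomorphic \<Gamma> H G"
proof -
  obtain f where f: "f \<in> iso G H" "equivariant \<Gamma> G H f"
    using assms by (auto simp: gamma_isomorphic_def)
  have bij: "bij_betw f (carrier G) (carrier H)" using f by (simp add: iso_def)
  have "inv_into (carrier G) f \<in> iso H G"
    using is_gamma_group_group(2)[OF assms(1)] f by (simp add: group.iso_set_sym)
  moreover have "equivariant \<Gamma> H G (inv_into (carrier G) f)"
    unfolding equivariant_def
  proof (intro ballI)
    fix g y assume g: "g \<in> carrier \<Gamma>" and y: "y \<in> carrier H"
    define x where "x = inv_into (carrier G) f y"
    have x: "x \<in> carrier G" "f x = y"
      using bij y by (auto simp: x_def bij_betw_def inv_into_into f_inv_into_f)
    have "inv_into (carrier G) f (act H g y) = inv_into (carrier G) f (f (act G g x))"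
      using f(2) g x by (simp add: equivariant_def)
    also have "\<dots> = act G g x"
      using bij act_closed[OF assms(1) g x(1)] by (simp add: bij_betw_def)
    finally show "inv_into (carrier G) f (act H g y) = act G g (inv_into (carrier G) f y)"
      by (simp add: x_def)
  qed
  ultimately show ?thesis by (auto simp: gamma_isomorphic_def)
qed

lemma equiv_iso_rel: "equiv (level_groups \<Gamma> \<C>) (iso_rel \<Gamma> \<C>)"
proof (rule equivI)
  have *: "is_gamma_group \<Gamma> G" if "G \<in> level_groups \<Gamma> \<C>" for G
    using that by (simp add: level_groups_def finite_gamma_group_def)
  show "iso_rel \<Gamma> \<C> \<subseteq> level_groups \<Gamma> \<C> \<times> level_groups \<Gamma> \<C>"
    by (auto simp: iso_rel_def)
  show "refl_on (level_groups \<Gamma> \<C>) (iso_rel \<Gamma> \<C>)"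
    using * by (auto simp: refl_on_def iso_rel_def intro: gamma_isomorphic_refl)
  show "sym (iso_rel \<Gamma> \<C>)"
    using * by (auto simp: sym_def iso_rel_def intro: gamma_isomorphic_sym)
  show "trans (iso_rel \<Gamma> \<C>)"
    by (auto simp: trans_def iso_rel_def intro: gamma_isomorphic_trans)
qed

lemma gamma_epi_comp:
  assumes "is_gamma_group \<Gamma> G'" "f \<in> iso G' G" "equivariant \<Gamma> G' G f" "h \<in> gamma_epi \<Gamma> G H"
  shows "compose (carrier G') h f \<in> gamma_epi \<Gamma> G' H"
proof -
  have "bij_betw f (carrier G') (carrier G)" using assms by (simp add: iso_def)
  then have im: "f ` carrier G' = carrier G" by (simp add: bij_betw_def)
  have "compose (carrier G') h f \<in> hom G' H"
    using assms is_gamma_group_group(2)[OF assms(1)]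
    by (auto simp: gamma_epi_def epi_def iso_def intro: group.hom_compose)
  moreover have "compose (carrier G') h f ` carrier G' = carrier H"
  proof -
    have "compose (carrier G') h f ` carrier G' = h ` (f ` carrier G')"
      by (auto simp: compose_def image_image)
    then show ?thesis using assms(4) im by (simp add: gamma_epi_def epi_def)
  qed
  moreover have "equivariant \<Gamma> G' H (compose (carrier G') h f)"
    unfolding equivariant_def
  proof (intro ballI)
    fix g x assume gx: "g \<in> carrier \<Gamma>" "x \<in> carrier G'"
    then have "f x \<in> carrier G" "act G' g x \<in> carrier G'"
      using im act_closed[OF assms(1)] by auto
    then show "compose (carrier G') h f (act G' g x) = act H g (compose (carrier G') h f x)"
      using gx assms(3,4) by (simp add: equivariant_def gamma_epi_def compose_eq)
  qed
  ultimately show ?thesis by (simp add: gamma_epi_def epi_def)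
qed

lemma card_gamma_epi_cong:
  fixes G G' :: "('a, 'g) gamma_group" and H :: "('b, 'g) gamma_group"
  assumes "is_gamma_group \<Gamma> G" "is_gamma_group \<Gamma> G'" "gamma_isomorphic \<Gamma> G G'"
  shows "card (gamma_epi \<Gamma> G H) = card (gamma_epi \<Gamma> G' H)"
proof -
  obtain f where f: "f \<in> iso G G'" "equivariant \<Gamma> G G' f"
    using assms by (auto simp: gamma_isomorphic_def)
  obtain f' where f': "f' \<in> iso G' G" "equivariant \<Gamma> G' G f'"
    using gamma_isomorphic_sym[OF assms(1,3)] by (auto simp: gamma_isomorphic_def)
  have inj: "inj_on (\<lambda>h. compose (carrier G1) h k) (gamma_epi \<Gamma> G2 H)"
    if "k \<in> iso G1 G2" for k and G1 G2 :: "('a, 'g) gamma_group"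
  proof -
    have im: "k ` carrier G1 = carrier G2" using that by (auto simp: iso_def bij_betw_def)
    have "h1 = h2" if "h1 \<in> extensional (carrier G2)" "h2 \<in> extensional (carrier G2)"
      "compose (carrier G1) h1 k = compose (carrier G1) h2 k" for h1 h2 :: "'a \<Rightarrow> 'b"
    proof (rule extensionalityI[OF that(1,2)])
      fix y assume "y \<in> carrier G2"
      then obtain x where "x \<in> carrier G1" "y = k x"
        using im by auto
      then show "h1 y = h2 y" using fun_cong[OF that(3), of x] by (simp add: compose_def)
    qed
    then show ?thesis by (auto simp: inj_on_def gamma_epi_def)
  qed
  have sub: "(\<lambda>h. compose (carrier G) h f) ` gamma_epi \<Gamma> G' H \<subseteq> gamma_epi \<Gamma> G H"
    "(\<lambda>h. compose (carrier G') h f') ` gamma_epi \<Gamma> G H \<subseteq> gamma_epi \<Gamma> G' H"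
    using gamma_epi_comp[OF assms(1) f] gamma_epi_comp[OF assms(2) f'] by auto
  show ?thesis
  proof (cases "finite (gamma_epi \<Gamma> G H)")
    case True
    then have "finite (gamma_epi \<Gamma> G' H)" using inj_on_finite[OF inj[OF f(1)] sub(1)] by simp
    then show ?thesis
      using True card_bij_eq[OF inj[OF f'(1)] sub(2) inj[OF f(1)] sub(1)] by simp
  next
    case False
    then have "infinite (gamma_epi \<Gamma> G' H)" using inj_on_finite[OF inj[OF f'(1)] sub(2)] by blast
    then show ?thesis using False by simp
  qed
qed

lemma Sur_iso_class:
  assumes "G \<in> level_groups \<Gamma> \<C>"
  shows "Sur \<Gamma> (iso_class \<Gamma> \<C> G) H = card (gamma_epi \<Gamma> G H)"
proof -
  define G' where "G' = (SOME G'. G' \<in> iso_class \<Gamma> \<C> G)"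
  have "G \<in> iso_class \<Gamma> \<C> G"
    using equiv_class_self[OF equiv_iso_rel assms] by (simp add: iso_class_def)
  then have "G' \<in> iso_class \<Gamma> \<C> G" unfolding G'_def by (rule someI)
  then have "gamma_isomorphic \<Gamma> G G'" "G' \<in> level_groups \<Gamma> \<C>"
    by (auto simp: iso_class_def iso_rel_def)
  then show ?thesis
    using card_gamma_epi_cong[of \<Gamma> G G' H] assms
    by (simp add: Sur_def level_groups_def finite_gamma_group_def flip: G'_def)
qed

end

theory Submission
  imports Defs
begin

text \<open>
  For a surjection \<open>\<pi> : X \<rightarrow> H\<close> with kernel \<open>K\<close>, Moebius inversion over the invariant normal subgroups
  \<open>N \<subseteq> K\<close> of \<open>X\<close> expresses the indicator of \<open>K = 1\<close> as \<open>\<Sum>N. \<mu>(N, K)\<close>, and summing over \<open>\<pi>\<close> turns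
  this into a combination of the numbers \<open>Sur(X, X/N)\<close>. Truncating at \<open>|X/N| \<le> Q\<close> leaves finitely many
  moments. If \<open>K \<noteq> 1\<close>, cancellation along one maximal \<open>a \<subset> K\<close> bounds the truncation error by the
  sum of \<open>|\<mu>(N, K)|\<close> over \<open>Q/s < |X/N| \<le> Q\<close>, where \<open>s\<close> bounds the orders of the minimal normal subgroups
  with quotient \<open>H\<close> in level-\<open>\<C>\<close> groups. The error is again a finite combination of moments.

  Since \<open>|\<mu>(N, K)|\<close> is at most \<open>1/m!\<close> times the number of independent lists of \<open>m\<close> maximal subgroups
  with intersection \<open>N\<close>, summed over \<open>m\<close>, and each such list is a surjection from \<open>X\<close> onto one of at most
  \<open>c^m\<close> fibre products over \<open>H\<close> of order at most \<open>d^m\<close>, the polynomial growth of the moments bounds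
  the expected error by a tail of an exponential series. Only the moments of \<open>\<mu>\<close> itself need to be bounded.
\<close>

section \<open>Truncated Moebius sums over families of sets\<close>

text \<open>For one group \<open>X\<close> the full Moebius sum is finite, but its length grows with
  \<open>X\<close>, and the hypotheses give no bound on the moments of the \<open>\<mu>t\<close>
  that is uniform in the target. The limit in t therefore cannot be taken term by term in the full
  expansion. Whatever is integrated against the \<open>\<mu>t\<close> has to be a combination of
  finitely many targets fixed in advance, and this applies to the majorant of the error as much as
  to the truncated sum.

  Confining the error to a window below Q depends on one fact: intersecting N with a maximal
  \<open>a\<close> multiplies the index by at most s, with s depending on H and \<open>\<C>\<close>
  but not on X. This is where the level condition enters the estimate. A minimal normal subgroup
  with quotient H is either abelian, and then generated by at most |H||\<Gamma>| elements of bounded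
  exponent, or nonabelian, and then no larger than a single factor of the product that covers X. The
  cutoff is Q = |H| s^M, because an intersection of m maximal subgroups has index at most |H| s^m;
  so only lists of length at least M reach the window.\<close>

text \<open>By the crosscut theorem, when \<open>\<M>\<close> consists of the coatoms of a lattice of subsets of \<open>K\<close>, this
  is the value at \<open>(N, K)\<close> of its Moebius function.\<close>

definition mob :: "'x set set \<Rightarrow> 'x set \<Rightarrow> 'x set \<Rightarrow> real" where
  "mob \<M> K N = (\<Sum>S | S \<subseteq> \<M> \<and> K \<inter> \<Inter>S = N. (-1) ^ card S)"

text \<open>For maximal normal subgroups of \<open>K\<close> this condition makes the joint map to
  the fibre product of the quotients surjective, just as for vectors in general position.\<close>

definition indep :: "'x set \<Rightarrow> 'x set list \<Rightarrow> bool" where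
  "indep K l \<longleftrightarrow> (\<forall>i<length l. \<not> K \<inter> \<Inter>(set (take i l)) \<subseteq> l ! i)"

lemma indep_Nil [simp]: "indep K []"
  by (simp add: indep_def)

lemma indep_snoc [simp]: "indep K (l @ [a]) \<longleftrightarrow> indep K l \<and> \<not> K \<inter> \<Inter>(set l) \<subseteq> a"
  by (auto simp: indep_def nth_append less_Suc_eq)

lemma indep_distinct: "indep K l \<Longrightarrow> distinct l"
  by (induction l rule: rev_induct) auto

text \<open>Toggling membership of \<open>a\<close> is an involution of \<open>A\<close> that
  changes the parity of \<open>card S\<close>.\<close>

lemma sum_toggle_eq_0:
  assumes "finite A" "\<And>S. S \<in> A \<Longrightarrow> finite S"
    and "\<And>S. S \<in> A \<Longrightarrow> insert a S \<in> A" "\<And>S. S \<in> A \<Longrightarrow> S - {a} \<in> A"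
  shows "(\<Sum>S\<in>A. (-1 :: real) ^ card S) = 0"
proof -
  let ?B = "{S \<in> A. a \<in> S}" and ?C = "{S \<in> A. a \<notin> S}"
  have "(\<Sum>S\<in>?C. (-1 :: real) ^ card S) = (\<Sum>S\<in>?B. - ((-1) ^ card S))"
    by (rule sum.reindex_bij_witness[where i = "\<lambda>S. S - {a}" and j = "insert a"])
      (use assms in \<open>auto simp: insert_absorb\<close>)
  moreover have "A = ?B \<union> ?C" by auto
  then have "(\<Sum>S\<in>A. (-1 :: real) ^ card S) = (\<Sum>S\<in>?B. (-1) ^ card S) + (\<Sum>S\<in>?C. (-1) ^ card S)"
    using assms(1) by (subst sum.union_disjoint[symmetric]) auto
  ultimately show ?thesis by (simp add: sum_negf)
qed

text \<open>The subsets of \<open>\<M>\<close> are grouped by their intersection with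
  \<open>K\<close>. A member of \<open>\<F>\<close> that is no such intersection carries an empty
  sum, so \<open>\<F>\<close> may be any finite family that contains the intersections.\<close>

lemma sum_mob:
  assumes "finite \<M>" "finite \<F>" "\<And>S. S \<subseteq> \<M> \<Longrightarrow> K \<inter> \<Inter>S \<in> \<F>"
  shows "(\<Sum>N | N \<in> \<F> \<and> P N. mob \<M> K N) = (\<Sum>S | S \<subseteq> \<M> \<and> P (K \<inter> \<Inter>S). (-1) ^ card S)"
proof -
  have "(\<Sum>S | S \<subseteq> \<M> \<and> P (K \<inter> \<Inter>S). (-1 :: real) ^ card S) =
    (\<Sum>N | N \<in> \<F> \<and> P N. \<Sum>S | S \<in> {S. S \<subseteq> \<M> \<and> P (K \<inter> \<Inter>S)} \<and> K \<inter> \<Inter>S = N. (-1) ^ card S)"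
    by (rule sum.group[symmetric]) (use assms in auto)
  also have "\<dots> = (\<Sum>N | N \<in> \<F> \<and> P N. mob \<M> K N)"
    unfolding mob_def by (intro sum.cong refl) auto
  finally show ?thesis by simp
qed

text \<open>The condition on \<open>S\<close> becomes
  \<open>K \<inter> \<Inter>S \<inter> a = y\<close>, which does not see whether \<open>a\<close>
  belongs to \<open>S\<close>, so toggling \<open>a\<close> cancels everything.\<close>

lemma weisner:
  assumes "finite \<M>" "finite \<F>" "\<And>S. S \<subseteq> \<M> \<Longrightarrow> K \<inter> \<Inter>S \<in> \<F>" "a \<in> \<M>"
  shows "(\<Sum>z | z \<in> \<F> \<and> z \<inter> a = y. mob \<M> K z) = 0"
proof -
  have "(\<Sum>z | z \<in> \<F> \<and> z \<inter> a = y. mob \<M> K z) =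
    (\<Sum>S | S \<subseteq> \<M> \<and> K \<inter> \<Inter>S \<inter> a = y. (-1) ^ card S)"
    by (rule sum_mob) (use assms in auto)
  also have "\<dots> = 0"
    by (rule sum_toggle_eq_0[where a = a]) (use assms in \<open>auto intro: finite_subset\<close>)
  finally show ?thesis .
qed

text \<open>The \<open>N\<close> with \<open>P (N \<inter> a)\<close> sum to 0 by toggling
  \<open>a\<close>, and by monotonicity all of them satisfy \<open>P\<close>. What remains are the
  sets that intersection with \<open>a\<close> pushes out of the truncation. In the application
  \<open>P\<close> bounds the index.\<close>

lemma sum_truncated_mob:
  assumes "finite \<M>" "finite \<F>" "\<And>S. S \<subseteq> \<M> \<Longrightarrow> K \<inter> \<Inter>S \<in> \<F>" "a \<in> \<M>"
    and mono: "\<And>N N'. N \<subseteq> N' \<Longrightarrow> P N \<Longrightarrow> P N'"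
  shows "(\<Sum>N | N \<in> \<F> \<and> P N. mob \<M> K N) = (\<Sum>N | N \<in> \<F> \<and> P N \<and> \<not> P (N \<inter> a). mob \<M> K N)"
proof -
  have "(\<Sum>N | N \<in> \<F> \<and> P (N \<inter> a). mob \<M> K N) = 0"
  proof -
    have "(\<Sum>N | N \<in> \<F> \<and> P (N \<inter> a). mob \<M> K N) =
      (\<Sum>S | S \<subseteq> \<M> \<and> P (K \<inter> \<Inter>S \<inter> a). (-1) ^ card S)"
      by (rule sum_mob) (use assms in auto)
    also have "\<dots> = 0"
      by (rule sum_toggle_eq_0[where a = a])
        (use assms in \<open>auto intro: finite_subset elim!: back_subst[of P]\<close>)
    finally show ?thesis .
  qed
  moreover have "(\<Sum>N | N \<in> \<F> \<and> P N. mob \<M> K N) =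
    (\<Sum>N | N \<in> \<F> \<and> P (N \<inter> a). mob \<M> K N) + (\<Sum>N | N \<in> \<F> \<and> P N \<and> \<not> P (N \<inter> a). mob \<M> K N)"
    using assms(2) mono[of "_ \<inter> a"] by (subst sum.union_disjoint[symmetric]) (auto intro: sum.cong)
  ultimately show ?thesis by simp
qed

section \<open>Moebius values and independent lists\<close>

definition indeps :: "'x set set \<Rightarrow> 'x set \<Rightarrow> 'x set list set" where
  "indeps \<M> K = {l. set l \<subseteq> \<M> \<and> indep K l}"

lemma finite_indeps: "finite \<M> \<Longrightarrow> finite (indeps \<M> K)"
  by (rule finite_subset[OF _ finite_subset_distinct[of \<M>]]) (auto simp: indeps_def indep_distinct)

lemma mob_top:
  assumes "\<And>a. a \<in> \<M> \<Longrightarrow> \<not> K \<subseteq> a"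
  shows "mob \<M> K K = 1"
proof -
  have "{S. S \<subseteq> \<M> \<and> K \<inter> \<Inter>S = K} = {{}}" using assms by auto
  then show ?thesis by (simp add: mob_def)
qed

text \<open>Weisner's theorem for a fixed \<open>a\<close> bounds the value at \<open>y\<close> by the values at larger sets; averaging
  over all \<open>a \<supseteq> y\<close> produces the factorial.\<close>

lemma mob_le_sum_indeps:
  fixes K :: "'x set"
  assumes "finite \<M>" "finite K" "\<And>a. a \<in> \<M> \<Longrightarrow> \<not> K \<subseteq> a"
  shows "\<bar>mob \<M> K y\<bar> \<le> (\<Sum>l | l \<in> indeps \<M> K \<and> K \<inter> \<Inter>(set l) = y. 1 / fact (length l))"
proof (induction "card K - card y" arbitrary: y rule: less_induct)
  case less
  define B where "B z = {l \<in> indeps \<M> K. K \<inter> \<Inter>(set l) = z}" for z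
  define w where "w z = (\<Sum>l\<in>B z. 1 / fact (length l) :: real)" for z
  have finB: "finite (B z)" for z using finite_indeps[OF assms(1)] by (simp add: B_def)
  have w0: "0 \<le> w z" for z unfolding w_def by (rule sum_nonneg) simp
  consider "y = K" | "\<nexists>S. S \<subseteq> \<M> \<and> K \<inter> \<Inter>S = y" | S where "y \<noteq> K" "S \<subseteq> \<M>" "K \<inter> \<Inter>S = y" by blast
  then have "\<bar>mob \<M> K y\<bar> \<le> w y"
  proof cases
    case 1
    have "(1::real) = (\<Sum>l\<in>{[] :: 'x set list}. 1 / fact (length l))" by simp
    also have "\<dots> \<le> w y"
      unfolding w_def by (rule sum_mono2) (use 1 finB in \<open>auto simp: B_def indeps_def\<close>)
    finally show ?thesis using mob_top[OF assms(3)] 1 by simp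
  next
    case 2
    then have "mob \<M> K y = 0" by (auto simp: mob_def intro!: sum.neutral)
    then show ?thesis using w0 by simp
  next
    case 3
    define M where "M = {a \<in> \<M>. y \<subseteq> a}"
    define F where "F = Pow K"
    have F: "finite F" "\<And>S. S \<subseteq> \<M> \<Longrightarrow> K \<inter> \<Inter>S \<in> F" using assms(2) by (auto simp: F_def)
    \<comment> \<open>\<open>S\<close> is nonempty because \<open>y \<noteq> K\<close>, and its
      members contain \<open>y\<close>.\<close>
    have M: "finite M" "M \<noteq> {}" using assms(1) 3 by (auto simp: M_def)
    define Z where "Z a = {z \<in> F. z \<inter> a = y \<and> z \<noteq> y}" for a
    have finZ: "finite (Z a)" for a using F by (simp add: Z_def)
    have ya: "\<bar>mob \<M> K y\<bar> \<le> (\<Sum>z\<in>Z a. w z)" if "a \<in> M" for a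
    proof -
      have "{z. z \<in> F \<and> z \<inter> a = y} = insert y (Z a)"
        using that 3 by (auto simp: Z_def M_def F_def)
      then have "mob \<M> K y + (\<Sum>z\<in>Z a. mob \<M> K z) = 0"
        using weisner[OF assms(1) F, of a y] that finZ by (simp add: M_def Z_def)
      then have "\<bar>mob \<M> K y\<bar> = \<bar>\<Sum>z\<in>Z a. mob \<M> K z\<bar>" by linarith
      also have "\<dots> \<le> (\<Sum>z\<in>Z a. \<bar>mob \<M> K z\<bar>)" by (rule sum_abs)
      also have "\<dots> \<le> (\<Sum>z\<in>Z a. w z)"
      proof (rule sum_mono)
        fix z assume "z \<in> Z a"
        then have "y \<subset> z" "z \<subseteq> K" by (auto simp: Z_def F_def)
        then have "card K - card z < card K - card y"
          using assms(2) by (meson card_mono diff_less_mono2 finite_subset order_less_le_trans psubset_card_mono)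
        from less[OF this] show "\<bar>mob \<M> K z\<bar> \<le> w z" by (simp add: w_def B_def)
      qed
      finally show ?thesis .
    qed
    have "card M * \<bar>mob \<M> K y\<bar> \<le> (\<Sum>a\<in>M. \<Sum>z\<in>Z a. w z)"
      using sum_mono[OF ya] by simp
    also have "\<dots> = (\<Sum>(a,z,l)\<in>(SIGMA a:M. SIGMA z:Z a. B z). 1 / fact (length l))"
      unfolding w_def using M finZ finB by (simp add: sum.Sigma)
    \<comment> \<open>The triple is recovered from the list \<open>l @ [a]\<close>, which is
      independent because \<open>z \<inter> a = y\<close> differs from \<open>z\<close>. Its entries
      are distinct members of \<open>M\<close>, so its length n is at most \<open>card M\<close>,
      and 1/(n-1)! = n/n! is at most \<open>card M\<close> / n!. Cancelling \<open>card M\<close> at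
      the end leaves the factorial.\<close>
    also have "\<dots> \<le> (\<Sum>l\<in>B y. card M / fact (length l))"
    proof (rule sum_le_included[where i = "\<lambda>l. (last l, K \<inter> \<Inter>(set (butlast l)), butlast l)"])
      show "finite (SIGMA a:M. SIGMA z:Z a. B z)" using M finZ finB by blast
      show "\<forall>x\<in>SIGMA a:M. SIGMA z:Z a. B z. \<exists>l\<in>B y.
        (last l, K \<inter> \<Inter>(set (butlast l)), butlast l) = x \<and>
        (case x of (a, z, l) \<Rightarrow> 1 / fact (length l)) \<le> real (card M) / fact (length l)"
      proof (rule ballI)
        fix x assume "x \<in> (SIGMA a:M. SIGMA z:Z a. B z)"
        then obtain a z l where x: "x = (a, z, l)" and *: "a \<in> M" "z \<in> Z a" "l \<in> B z" by auto
        have l: "l @ [a] \<in> B y" using * by (auto simp: M_def Z_def B_def indeps_def)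
        then have "distinct (l @ [a])" "set (l @ [a]) \<subseteq> M"
          using indep_distinct[of K "l @ [a]"] * by (auto simp: B_def indeps_def M_def simp del: indep_snoc)
        then have "length (l @ [a]) \<le> card M"
          using card_mono[OF M(1)] by (metis distinct_card)
        then have "1 / fact (length l) \<le> real (card M) / fact (length (l @ [a]))"
          by (simp add: divide_simps flip: of_nat_Suc)
        moreover have "K \<inter> \<Inter>(set l) = z" using * by (simp add: B_def)
        ultimately show "\<exists>l\<in>B y. (last l, K \<inter> \<Inter>(set (butlast l)), butlast l) = x \<and>
          (case x of (a, z, l) \<Rightarrow> 1 / fact (length l)) \<le> real (card M) / fact (length l)"
          unfolding x by (intro bexI[OF _ l]) auto
      qed
    qed (use finB in auto)
    also have "\<dots> = card M * w y" by (simp add: w_def sum_distrib_left)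
    finally show ?thesis using M by (simp add: card_gt_0_iff)
  qed
  then show ?case by (simp add: w_def B_def)
qed


section \<open>Invariant normal subgroups and surjections\<close>

definition gnormal :: "('g, 'm) monoid_scheme \<Rightarrow> ('a, 'g) gamma_group \<Rightarrow> 'a set set" where
  "gnormal \<Gamma> G = {N. N \<lhd> G \<and> gamma_invariant \<Gamma> G N}"

lemma gnormal_iff:
  assumes "is_gamma_group \<Gamma> G"
  shows "N \<in> gnormal \<Gamma> G \<longleftrightarrow> N \<subseteq> carrier G \<and> \<one>\<^bsub>G\<^esub> \<in> N \<and>
    (\<forall>x\<in>N. \<forall>y\<in>N. x \<otimes>\<^bsub>G\<^esub> y \<in> N) \<and> (\<forall>x\<in>N. inv\<^bsub>G\<^esub> x \<in> N) \<and>
    (\<forall>g\<in>carrier G. \<forall>x\<in>N. g \<otimes>\<^bsub>G\<^esub> x \<otimes>\<^bsub>G\<^esub> inv\<^bsub>G\<^esub> g \<in> N) \<and>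
    (\<forall>\<gamma>\<in>carrier \<Gamma>. \<forall>x\<in>N. act G \<gamma> x \<in> N)" (is "?L \<longleftrightarrow> ?R")
proof -
  interpret G: group G using is_gamma_group_group[OF assms] by simp
  have "subgroup N G \<longleftrightarrow> N \<subseteq> carrier G \<and> \<one>\<^bsub>G\<^esub> \<in> N \<and>
    (\<forall>x\<in>N. \<forall>y\<in>N. x \<otimes>\<^bsub>G\<^esub> y \<in> N) \<and> (\<forall>x\<in>N. inv\<^bsub>G\<^esub> x \<in> N)"
    by (auto simp: subgroup_def)
  then show ?thesis
    unfolding gnormal_def G.normal_inv_iff gamma_invariant_def mem_Collect_eq image_subset_iff by blast
qed

lemma gnormalD:
  assumes "is_gamma_group \<Gamma> G" "N \<in> gnormal \<Gamma> G"
  shows "N \<subseteq> carrier G" "\<one>\<^bsub>G\<^esub> \<in> N" "\<And>x y. x \<in> N \<Longrightarrow> y \<in> N \<Longrightarrow> x \<otimes>\<^bsub>G\<^esub> y \<in> N"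
    "\<And>x. x \<in> N \<Longrightarrow> inv\<^bsub>G\<^esub> x \<in> N"
    "\<And>g x. g \<in> carrier G \<Longrightarrow> x \<in> N \<Longrightarrow> g \<otimes>\<^bsub>G\<^esub> x \<otimes>\<^bsub>G\<^esub> inv\<^bsub>G\<^esub> g \<in> N"
    "\<And>\<gamma> x. \<gamma> \<in> carrier \<Gamma> \<Longrightarrow> x \<in> N \<Longrightarrow> act G \<gamma> x \<in> N"
  using assms(2) unfolding gnormal_iff[OF assms(1)] by blast+

lemma act_inv:
  assumes "is_gamma_group \<Gamma> G" "\<gamma> \<in> carrier \<Gamma>" "x \<in> carrier G"
  shows "act G \<gamma> (inv\<^bsub>G\<^esub> x) = inv\<^bsub>G\<^esub> (act G \<gamma> x)"
proof -
  interpret G: group G using is_gamma_group_group[OF assms(1)] by simp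
  have "act G \<gamma> \<in> hom G G" using assms act_closed act_hom by (auto simp: hom_def)
  then interpret group_hom G G "act G \<gamma>" by unfold_locales
  show ?thesis using assms by simp
qed

lemma act_one_eq:
  assumes "is_gamma_group \<Gamma> G" "\<gamma> \<in> carrier \<Gamma>"
  shows "act G \<gamma> \<one>\<^bsub>G\<^esub> = \<one>\<^bsub>G\<^esub>"
proof -
  interpret G: group G using is_gamma_group_group[OF assms(1)] by simp
  have "act G \<gamma> \<in> hom G G" using assms act_closed act_hom by (auto simp: hom_def)
  then interpret group_hom G G "act G \<gamma>" by unfold_locales
  show ?thesis by simp
qed

lemma one_gnormal:
  assumes "is_gamma_group \<Gamma> G"
  shows "{\<one>\<^bsub>G\<^esub>} \<in> gnormal \<Gamma> G"
proof -
  interpret G: group G using is_gamma_group_group[OF assms] by simp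
  show ?thesis using assms by (simp add: gnormal_iff act_one_eq)
qed

lemma Int_gnormal:
  assumes "is_gamma_group \<Gamma> G" "N \<in> gnormal \<Gamma> G" "M \<in> gnormal \<Gamma> G"
  shows "N \<inter> M \<in> gnormal \<Gamma> G"
  using assms(2,3) unfolding gnormal_iff[OF assms(1)] by blast

text \<open>Intersecting with \<open>K\<close> gives the empty family the value \<open>K\<close>
  instead of the whole type.\<close>

lemma Int_Inter_gnormal:
  assumes "is_gamma_group \<Gamma> G" "K \<in> gnormal \<Gamma> G" "S \<subseteq> gnormal \<Gamma> G"
  shows "K \<inter> \<Inter>S \<in> gnormal \<Gamma> G"
proof -
  define T where "T = insert K S"
  have *: "N \<in> gnormal \<Gamma> G" if "N \<in> T" for N using that assms by (auto simp: T_def)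
  note D = gnormalD[OF assms(1) *]
  have "\<Inter>T \<in> gnormal \<Gamma> G"
    unfolding gnormal_iff[OF assms(1)]
  proof (intro conjI ballI subsetI InterI)
    fix x assume "x \<in> \<Inter>T"
    then show "x \<in> carrier G" using D(1)[of K] by (auto simp: T_def)
  qed (rule D; (assumption | (erule InterD, assumption)))+
  then show ?thesis by (simp add: T_def)
qed

lemma finite_gnormal: "finite (carrier G) \<Longrightarrow> is_gamma_group \<Gamma> G \<Longrightarrow> finite (gnormal \<Gamma> G)"
  by (rule finite_subset[of _ "Pow (carrier G)"]) (auto dest: gnormalD(1))

locale gamma_epimorphism =
  fixes \<Gamma> :: "('g, 'm) monoid_scheme" and G :: "('a, 'g) gamma_group"
    and H :: "('b, 'g) gamma_group" and f :: "'a \<Rightarrow> 'b"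
  assumes source: "is_gamma_group \<Gamma> G" and target: "is_gamma_group \<Gamma> H"
    and epi: "f \<in> gamma_epi \<Gamma> G H"
begin

sublocale group_hom G H f
  using is_gamma_group_group[OF source] is_gamma_group_group[OF target] epi
  by (simp add: gamma_epi_def epi_def group_hom_def group_hom_axioms_def)

lemma f_image: "f ` carrier G = carrier H"
  using epi by (simp add: gamma_epi_def epi_def)

lemma f_ext: "f \<in> extensional (carrier G)"
  using epi by (simp add: gamma_epi_def)

lemma f_act: "\<gamma> \<in> carrier \<Gamma> \<Longrightarrow> x \<in> carrier G \<Longrightarrow> f (act G \<gamma> x) = act H \<gamma> (f x)"
  using epi by (simp add: gamma_epi_def equivariant_def)

lemma f_surj: "y \<in> carrier H \<Longrightarrow> \<exists>x\<in>carrier G. f x = y"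
  by (metis f_image imageE)

lemma f_eq_iff:
  assumes "x \<in> carrier G" "y \<in> carrier G"
  shows "f x = f y \<longleftrightarrow> inv\<^bsub>G\<^esub> x \<otimes>\<^bsub>G\<^esub> y \<in> kernel G H f"
proof -
  have "inv\<^bsub>H\<^esub> (f x) \<otimes>\<^bsub>H\<^esub> f y = \<one>\<^bsub>H\<^esub> \<longleftrightarrow> f x = f y"
    using assms H.inv_solve_left'[of "\<one>\<^bsub>H\<^esub>" "f x" "f y"] by auto
  then show ?thesis using assms by (auto simp: kernel_def)
qed

lemma preimage_gnormal:
  assumes "M \<in> gnormal \<Gamma> H"
  shows "{x \<in> carrier G. f x \<in> M} \<in> gnormal \<Gamma> G"
  using gnormalD[OF target assms] unfolding gnormal_iff[OF source]
  by (auto simp: f_act act_closed[OF source])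

lemma kernel_gnormal: "kernel G H f \<in> gnormal \<Gamma> G"
  using preimage_gnormal[OF one_gnormal[OF target]] by (simp add: kernel_def)

lemma image_gnormal:
  assumes "N \<in> gnormal \<Gamma> G"
  shows "f ` N \<in> gnormal \<Gamma> H"
proof -
  note N = gnormalD[OF source assms]
  have im: "w \<in> f ` N" if "z \<in> N" "f z = w" for z w using that by blast
  have c: "x \<in> carrier G" if "x \<in> N" for x using N(1) that by (rule subsetD)
  have 1: "f x \<otimes>\<^bsub>H\<^esub> f y \<in> f ` N" if "x \<in> N" "y \<in> N" for x y
    by (rule im[OF N(3)[OF that]]) (simp add: that c)
  have 2: "inv\<^bsub>H\<^esub> f x \<in> f ` N" if "x \<in> N" for x
    by (rule im[OF N(4)[OF that]]) (simp add: that c)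
  have 3: "g \<otimes>\<^bsub>H\<^esub> f x \<otimes>\<^bsub>H\<^esub> inv\<^bsub>H\<^esub> g \<in> f ` N" if x: "x \<in> N" and g: "g \<in> carrier H" for x g
  proof -
    obtain g' where g': "g' \<in> carrier G" "f g' = g" using f_surj[OF g] by blast
    show ?thesis by (rule im[OF N(5)[OF g'(1) x]]) (simp add: x c g')
  qed
  have 4: "act H \<gamma> (f x) \<in> f ` N" if "\<gamma> \<in> carrier \<Gamma>" "x \<in> N" for x \<gamma>
    by (rule im[OF N(6)[OF that]]) (simp add: that c f_act)
  have 5: "\<one>\<^bsub>H\<^esub> \<in> f ` N" by (rule im[OF N(2)]) simp
  have 6: "f ` N \<subseteq> carrier H" using c by auto
  show ?thesis
    unfolding gnormal_iff[OF target] ball_simps using 1 2 3 4 5 6 by simp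
qed

lemma image_preimage: "M \<subseteq> carrier H \<Longrightarrow> f ` {x \<in> carrier G. f x \<in> M} = M"
  using f_image by (auto simp: subset_iff)

lemma preimage_image:
  assumes "N \<in> gnormal \<Gamma> G" "kernel G H f \<subseteq> N"
  shows "{x \<in> carrier G. f x \<in> f ` N} = N"
proof (intro equalityI subsetI)
  note N = gnormalD[OF source assms(1)]
  fix x assume "x \<in> {x \<in> carrier G. f x \<in> f ` N}"
  then obtain y where y: "y \<in> N" "f y = f x" "x \<in> carrier G" by auto
  then have "inv\<^bsub>G\<^esub> y \<otimes>\<^bsub>G\<^esub> x \<in> N" using assms(2) f_eq_iff[of y x] N(1) by auto
  then have "y \<otimes>\<^bsub>G\<^esub> (inv\<^bsub>G\<^esub> y \<otimes>\<^bsub>G\<^esub> x) \<in> N" using y N by blast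
  moreover have "y \<in> carrier G" using y N by blast
  ultimately show "x \<in> N" using y by (simp flip: G.m_assoc)
qed (use gnormalD(1)[OF source assms(1)] in auto)

lemma card_preimage:
  assumes "finite (carrier G)" "M \<subseteq> carrier H"
  shows "card {x \<in> carrier G. f x \<in> M} = card M * card (kernel G H f)"
proof -
  have fib: "card {x \<in> carrier G. f x = y} = card (kernel G H f)" if y: "y \<in> carrier H" for y
  proof -
    obtain a where a: "a \<in> carrier G" "f a = y" using f_surj[OF y] by blast
    have "bij_betw (\<lambda>x. a \<otimes>\<^bsub>G\<^esub> x) (kernel G H f) {x \<in> carrier G. f x = y}"
      by (rule bij_betw_byWitness[where f' = "\<lambda>x. inv\<^bsub>G\<^esub> a \<otimes>\<^bsub>G\<^esub> x"])
        (use a y in \<open>auto simp: kernel_def G.m_assoc[symmetric]\<close>)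
    then show ?thesis by (simp add: bij_betw_same_card)
  qed
  have "finite M" using assms f_image by (metis finite_imageI finite_subset)
  have "{x \<in> carrier G. f x \<in> M} = (\<Union>y\<in>M. {x \<in> carrier G. f x = y})" by auto
  also have "card \<dots> = (\<Sum>y\<in>M. card {x \<in> carrier G. f x = y})"
    by (rule card_UN_disjoint) (use assms \<open>finite M\<close> in auto)
  also have "\<dots> = card M * card (kernel G H f)" using fib assms(2) by (simp add: subset_iff)
  finally show ?thesis .
qed

lemma card_carrier:
  assumes "finite (carrier G)"
  shows "card (carrier G) = card (carrier H) * card (kernel G H f)"
proof -
  have "{x \<in> carrier G. f x \<in> carrier H} = carrier G" by auto
  then show ?thesis using card_preimage[OF assms, of "carrier H"] by simp
qed

lemma finite_target: "finite (carrier G) \<Longrightarrow> finite (carrier H)"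
  using f_image by (metis finite_imageI)

end

section \<open>Factoring surjections, quotients and level groups\<close>

lemma gamma_epi_compose:
  assumes "f \<in> gamma_epi \<Gamma> G H" "k \<in> gamma_epi \<Gamma> H L"
    and "is_gamma_group \<Gamma> G" 
  shows "compose (carrier G) k f \<in> gamma_epi \<Gamma> G L"
proof -
  have f: "f \<in> hom G H" "f ` carrier G = carrier H" using assms by (auto simp: gamma_epi_def epi_def)
  then have fx: "f x \<in> carrier H" if "x \<in> carrier G" for x using that by blast
  have "compose (carrier G) k f \<in> hom G L"
    using assms f is_gamma_group_group(2)[OF assms(3)]
    by (auto simp: gamma_epi_def epi_def intro: group.hom_compose)
  moreover have "compose (carrier G) k f ` carrier G = k ` (f ` carrier G)"
    by (auto simp: compose_def image_image)
  moreover have "equivariant \<Gamma> G L (compose (carrier G) k f)"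
    using assms fx by (auto simp: equivariant_def gamma_epi_def compose_eq act_closed[OF assms(3)])
  ultimately show ?thesis using f assms by (simp add: gamma_epi_def epi_def)
qed

lemma iso_gamma_epi:
  assumes "f \<in> iso G H" "equivariant \<Gamma> G H f" "is_gamma_group \<Gamma> G"
  shows "restrict f (carrier G) \<in> gamma_epi \<Gamma> G H"
proof -
  interpret group G using is_gamma_group_group[OF assms(3)] by simp
  show ?thesis
  using assms act_closed[OF assms(3)]
  by (auto simp: gamma_epi_def epi_def iso_def hom_def equivariant_def bij_betw_def)
qed

text \<open>Any section of \<open>f\<close> followed by \<open>p\<close> will do; the inclusion of
  kernels makes the result independent of the section.\<close>

lemma gamma_epi_factor:
  assumes "is_gamma_group \<Gamma> G" "is_gamma_group \<Gamma> H" "is_gamma_group \<Gamma> L"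
    and "f \<in> gamma_epi \<Gamma> G H" "p \<in> gamma_epi \<Gamma> G L" "kernel G H f \<subseteq> kernel G L p"
  shows "\<exists>r\<in>gamma_epi \<Gamma> H L. p = compose (carrier G) r f"
proof -
  interpret f: gamma_epimorphism \<Gamma> G H f by unfold_locales (use assms in auto)
  interpret p: gamma_epimorphism \<Gamma> G L p by unfold_locales (use assms in auto)
  define r where "r = (\<lambda>y\<in>carrier H. p (inv_into (carrier G) f y))"
  have rf: "r (f x) = p x" if x: "x \<in> carrier G" for x
  proof -
    have "f (inv_into (carrier G) f (f x)) = f x" "inv_into (carrier G) f (f x) \<in> carrier G"
      using x by (auto simp: f_inv_into_f inv_into_into)
    then have "p (inv_into (carrier G) f (f x)) = p x"
      using x assms(6) f.f_eq_iff p.f_eq_iff by blast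
    then show ?thesis using x by (simp add: r_def)
  qed
  have "r \<in> gamma_epi \<Gamma> H L"
  proof -
    have 1: "r y \<in> carrier L" if "y \<in> carrier H" for y
      using f.f_surj[OF that] rf by auto
    have 2: "r (y \<otimes>\<^bsub>H\<^esub> z) = r y \<otimes>\<^bsub>L\<^esub> r z" if y: "y \<in> carrier H" and z: "z \<in> carrier H" for y z
    proof -
      obtain a b where "a \<in> carrier G" "f a = y" "b \<in> carrier G" "f b = z"
        using f.f_surj y z by metis
      then show ?thesis using rf[of "a \<otimes>\<^bsub>G\<^esub> b"] rf[of a] rf[of b] by auto
    qed
    have 3: "r (act H \<gamma> y) = act L \<gamma> (r y)" if y: "y \<in> carrier H" and g: "\<gamma> \<in> carrier \<Gamma>" for \<gamma> y
    proof -
      obtain a where "a \<in> carrier G" "f a = y" using f.f_surj y by metis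
      then show ?thesis
        using rf[of "act G \<gamma> a"] rf[of a] act_closed[OF assms(1) g] g by (auto simp: f.f_act p.f_act)
    qed
    have "r ` carrier H = p ` carrier G"
      by (subst f.f_image[symmetric]) (simp add: image_image rf)
    then show ?thesis
      using 1 2 3 by (auto simp: gamma_epi_def epi_def hom_def equivariant_def p.f_image r_def)
  qed
  moreover have "p = compose (carrier G) r f"
    by (rule extensionalityI[OF p.f_ext]) (auto simp: compose_def rf)
  ultimately show ?thesis by blast
qed

lemma quotient_gamma_epi:
  assumes "is_gamma_group \<Gamma> G" "N \<in> gnormal \<Gamma> G"
  defines "q \<equiv> \<lambda>x\<in>carrier G. N #>\<^bsub>G\<^esub> x"
  shows "q \<in> gamma_epi \<Gamma> G (gamma_quotient G N)"
    and "kernel G (gamma_quotient G N) q = N"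
    and "is_gamma_group \<Gamma> (gamma_quotient G N)"
proof -
  have N: "N \<lhd> G" "gamma_invariant \<Gamma> G N" using assms(2) by (auto simp: gnormal_def)
  interpret N: normal N G by (rule N)
  note ND = gnormalD[OF assms(1,2)]
  show Q: "is_gamma_group \<Gamma> (gamma_quotient G N)"
    by (rule is_gamma_group_quotient) (use assms N in auto)
  have ac: "act G g ` (N #>\<^bsub>G\<^esub> a) = N #>\<^bsub>G\<^esub> act G g a" if g: "g \<in> carrier \<Gamma>" and a: "a \<in> carrier G" for g a
  proof -
    have "\<exists>n\<in>N. act G g n = m" if m: "m \<in> N" for m
    proof -
      interpret \<Gamma>: group \<Gamma> using is_gamma_group_group(1)[OF assms(1)] .
      have "act G g (act G (inv\<^bsub>\<Gamma>\<^esub> g) m) = m"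
        using g m ND(1) by (subst act_mult[OF assms(1), symmetric]) (auto simp: act_one[OF assms(1)])
      then show ?thesis using ND(6)[of "inv\<^bsub>\<Gamma>\<^esub> g" m] g m by auto
    qed
    then have im: "act G g ` N = N" using ND(6)[OF g] by blast
    have "act G g ` (N #>\<^bsub>G\<^esub> a) = (\<lambda>n. act G g n \<otimes>\<^bsub>G\<^esub> act G g a) ` N"
      using that ND(1) by (force simp: r_coset_def act_hom[OF assms(1)])
    also have "\<dots> = (\<lambda>n. n \<otimes>\<^bsub>G\<^esub> act G g a) ` (act G g ` N)" by (simp add: image_image)
    also have "\<dots> = N #>\<^bsub>G\<^esub> act G g a" by (auto simp: im r_coset_def)
    finally show ?thesis .
  qed
  show "q \<in> gamma_epi \<Gamma> G (gamma_quotient G N)"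
    using ac act_closed[OF assms(1)]
    by (auto simp: gamma_epi_def epi_def hom_def carrier_FactGroup N.rcos_sum equivariant_def q_def)
  show "kernel G (gamma_quotient G N) q = N"
    using ND(1) N.rcos_const N.rcos_self[OF _ N.subgroup_axioms]
    by (auto simp: kernel_def q_def FactGroup_def)
qed


lemma gamma_epi_iso:
  assumes "is_gamma_group \<Gamma> G" "is_gamma_group \<Gamma> H" "is_gamma_group \<Gamma> L"
    and "f \<in> gamma_epi \<Gamma> G H" "p \<in> gamma_epi \<Gamma> G L" "kernel G H f = kernel G L p"
  obtains r where "r \<in> gamma_epi \<Gamma> H L" "r \<in> iso H L" "p = compose (carrier G) r f"
proof -
  interpret f: gamma_epimorphism \<Gamma> G H f by unfold_locales (use assms in auto)
  interpret p: gamma_epimorphism \<Gamma> G L p by unfold_locales (use assms in auto)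
  obtain r where r: "r \<in> gamma_epi \<Gamma> H L" "p = compose (carrier G) r f"
    using gamma_epi_factor[OF assms(1-5)] assms(6) by auto
  have "inj_on r (carrier H)"
  proof (rule inj_onI)
    fix y z assume yz: "y \<in> carrier H" "z \<in> carrier H" and eq: "r y = r z"
    obtain a b where ab: "a \<in> carrier G" "f a = y" "b \<in> carrier G" "f b = z"
      using f.f_surj yz by metis
    then have "p a = p b" using eq by (simp add: r(2) compose_eq)
    then show "y = z" using ab assms(6) f.f_eq_iff[of a b] p.f_eq_iff[of a b] by simp
  qed
  then have "r \<in> iso H L" using r(1) by (auto simp: gamma_epi_def epi_def iso_def bij_betw_def)
  then show ?thesis using that r by blast
qed

text \<open>Together with its converse \<open>level_imp_gamma_epi\<close>, this replaces the coset
  construction in \<open>level\<close> by an arbitrary equivariant surjection, so that closure under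
  quotients is just composition of maps.\<close>

lemma gamma_epi_imp_level:
  assumes "is_gamma_group \<Gamma> H" and F: "\<And>i. i < (n::nat) \<Longrightarrow> F i \<in> \<C>" "\<And>G. G \<in> \<C> \<Longrightarrow> is_gamma_group \<Gamma> G"
    and K: "subgroup K (gamma_product {..<n} F)" "gamma_invariant \<Gamma> (gamma_product {..<n} F) K"
    and f: "f \<in> gamma_epi \<Gamma> (gamma_subgroup (gamma_product {..<n} F) K) H"
  shows "level \<Gamma> \<C> H"
proof -
  define Y where "Y = gamma_subgroup (gamma_product {..<n} F) K"
  have "is_gamma_group \<Gamma> (gamma_product {..<n} F)"
    using F is_gamma_group_group(1)[OF assms(1)] by (intro is_gamma_group_product) auto
  then have Y: "is_gamma_group \<Gamma> Y" unfolding Y_def by (rule is_gamma_group_subgroup) (fact K)+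
  interpret f: gamma_epimorphism \<Gamma> Y H f
    by unfold_locales (use Y assms(1) f in \<open>auto simp: Y_def\<close>)
  define N where "N = kernel Y H f"
  have N: "N \<in> gnormal \<Gamma> Y" unfolding N_def by (rule f.kernel_gnormal)
  obtain r where "r \<in> gamma_epi \<Gamma> H (gamma_quotient Y N)" "r \<in> iso H (gamma_quotient Y N)"
    using gamma_epi_iso[OF Y assms(1) quotient_gamma_epi(3)[OF Y N] f.epi
        quotient_gamma_epi(1)[OF Y N]] quotient_gamma_epi(2)[OF Y N] N_def by metis
  then have "gamma_isomorphic \<Gamma> H (gamma_quotient Y N)"
    by (auto simp: gamma_isomorphic_def gamma_epi_def)
  then show ?thesis
    unfolding level_def using F K N
    by (intro exI[of _ n] exI[of _ F] exI[of _ K] exI[of _ N]) (auto simp: Y_def gnormal_def)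
qed

lemma level_imp_gamma_epi:
  assumes "is_gamma_group \<Gamma> H" "level \<Gamma> \<C> H" "\<And>G. G \<in> \<C> \<Longrightarrow> is_gamma_group \<Gamma> G"
  obtains n F K f where "\<And>i. i < (n::nat) \<Longrightarrow> F i \<in> \<C>" "subgroup K (gamma_product {..<n} F)"
    "gamma_invariant \<Gamma> (gamma_product {..<n} F) K"
    "is_gamma_group \<Gamma> (gamma_subgroup (gamma_product {..<n} F) K)"
    "f \<in> gamma_epi \<Gamma> (gamma_subgroup (gamma_product {..<n} F) K) H"
proof -
  obtain n F K N where F: "\<And>i. i < (n::nat) \<Longrightarrow> F i \<in> \<C>" and K: "subgroup K (gamma_product {..<n} F)"
    "gamma_invariant \<Gamma> (gamma_product {..<n} F) K"
    and N: "N \<in> gnormal \<Gamma> (gamma_subgroup (gamma_product {..<n} F) K)"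
    and iso: "gamma_isomorphic \<Gamma> H (gamma_quotient (gamma_subgroup (gamma_product {..<n} F) K) N)"
    using assms(2) unfolding level_def gnormal_def by blast
  define Y where "Y = gamma_subgroup (gamma_product {..<n} F) K"
  have "is_gamma_group \<Gamma> (gamma_product {..<n} F)"
    using F assms(3) is_gamma_group_group(1)[OF assms(1)] by (intro is_gamma_group_product) auto
  then have Y: "is_gamma_group \<Gamma> Y" unfolding Y_def by (rule is_gamma_group_subgroup) (fact K)+
  have N: "N \<in> gnormal \<Gamma> Y" using N by (simp add: Y_def)
  obtain k where k: "k \<in> iso (gamma_quotient Y N) H" "equivariant \<Gamma> (gamma_quotient Y N) H k"
    using gamma_isomorphic_sym[OF assms(1) iso] by (auto simp: gamma_isomorphic_def Y_def)
  note q = quotient_gamma_epi[OF Y N]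
  show ?thesis
    using that[OF F K Y[unfolded Y_def]] gamma_epi_compose[OF q(1) iso_gamma_epi[OF k q(3)] Y]
    unfolding Y_def by blast
qed

text \<open>Consequently surjection counts from level-\<open>\<C>\<close> groups vanish on all other
  targets, and moment hypotheses about level-\<open>\<C>\<close> targets cover every target that can
  occur.\<close>

lemma level_gamma_epi:
  assumes "is_gamma_group \<Gamma> G" "level \<Gamma> \<C> G" "\<And>G. G \<in> \<C> \<Longrightarrow> is_gamma_group \<Gamma> G"
    and "is_gamma_group \<Gamma> H" "h \<in> gamma_epi \<Gamma> G H"
  shows "level \<Gamma> \<C> H"
proof (rule level_imp_gamma_epi[OF assms(1-3)])
  fix n F K f
  assume "\<And>i. i < (n::nat) \<Longrightarrow> F i \<in> \<C>" "subgroup K (gamma_product {..<n} F)"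
    "gamma_invariant \<Gamma> (gamma_product {..<n} F) K"
    "is_gamma_group \<Gamma> (gamma_subgroup (gamma_product {..<n} F) K)"
    "f \<in> gamma_epi \<Gamma> (gamma_subgroup (gamma_product {..<n} F) K) G"
  then show "level \<Gamma> \<C> H"
    using gamma_epi_compose[OF _ assms(5)] by (intro gamma_epi_imp_level[OF assms(4) _ assms(3)])
qed

text \<open>All operations are \<open>undefined\<close> off the carrier, so that there are finitely many models and exactly
  one for each transport of structure.\<close>

definition models :: "('g, 'm) monoid_scheme \<Rightarrow> nat \<Rightarrow> (nat, 'g) gamma_group set" where
  "models \<Gamma> k = {G. is_gamma_group \<Gamma> G \<and> carrier G = {..<k} \<and>
     (\<forall>x y. \<not> (x < k \<and> y < k) \<longrightarrow> x \<otimes>\<^bsub>G\<^esub> y = undefined) \<and>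
     (\<forall>\<gamma> x. \<not> (\<gamma> \<in> carrier \<Gamma> \<and> x < k) \<longrightarrow> act G \<gamma> x = undefined)}"

lemma models_eqI:
  assumes "G \<in> models \<Gamma> k" "G' \<in> models \<Gamma> k"
    and mult: "\<And>x y. x < k \<Longrightarrow> y < k \<Longrightarrow> x \<otimes>\<^bsub>G\<^esub> y = x \<otimes>\<^bsub>G'\<^esub> y"
    and act: "\<And>\<gamma> x. \<gamma> \<in> carrier \<Gamma> \<Longrightarrow> x < k \<Longrightarrow> act G \<gamma> x = act G' \<gamma> x"
  shows "G = G'"
proof -
  have "monoid.mult G = monoid.mult G'"
    by (intro ext) (use assms in \<open>auto simp: models_def, metis\<close>)
  moreover have "act G = act G'"
    by (intro ext) (use assms in \<open>auto simp: models_def, metis\<close>)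
  moreover have c: "carrier G = {..<k}" "carrier G' = {..<k}" using assms by (auto simp: models_def)
  moreover have "\<one>\<^bsub>G\<^esub> = \<one>\<^bsub>G'\<^esub>"
  proof -
    interpret G: group G using assms(1) is_gamma_group_group(2) by (auto simp: models_def)
    interpret G': group G' using assms(2) is_gamma_group_group(2) by (auto simp: models_def)
    have "\<one>\<^bsub>G\<^esub> \<otimes>\<^bsub>G'\<^esub> \<one>\<^bsub>G'\<^esub> = \<one>\<^bsub>G\<^esub>" "\<one>\<^bsub>G\<^esub> \<otimes>\<^bsub>G\<^esub> \<one>\<^bsub>G'\<^esub> = \<one>\<^bsub>G'\<^esub>"
      using G.one_closed G'.one_closed G'.r_one G.l_one c by simp_all
    then show ?thesis using \<open>monoid.mult G = monoid.mult G'\<close> by simp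
  qed
  ultimately show ?thesis by (cases G; cases G') simp
qed

lemma finite_models:
  fixes \<Gamma> :: "('g, 'm) monoid_scheme"
  assumes "finite (carrier \<Gamma>)"
  shows "finite (models \<Gamma> k)"
proof -
  let ?h = "\<lambda>G :: (nat, 'g) gamma_group. (\<lambda>p\<in>{..<k} \<times> {..<k}. monoid.mult G (fst p) (snd p),
    \<lambda>p\<in>carrier \<Gamma> \<times> {..<k}. act G (fst p) (snd p))"
  have "?h ` models \<Gamma> k \<subseteq> ({..<k} \<times> {..<k} \<rightarrow>\<^sub>E {..<k}) \<times> (carrier \<Gamma> \<times> {..<k} \<rightarrow>\<^sub>E {..<k})"
  proof (intro image_subsetI)
    fix G assume G: "G \<in> models \<Gamma> k"
    then have gg: "is_gamma_group \<Gamma> G" and c: "carrier G = {..<k}" by (auto simp: models_def)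
    interpret group G using is_gamma_group_group[OF gg] by simp
    show "?h G \<in> ({..<k} \<times> {..<k} \<rightarrow>\<^sub>E {..<k}) \<times> (carrier \<Gamma> \<times> {..<k} \<rightarrow>\<^sub>E {..<k})"
      using m_closed act_closed[OF gg] c by auto
  qed
  moreover have "inj_on ?h (models \<Gamma> k)"
  proof (rule inj_onI)
    fix G G' assume *: "G \<in> models \<Gamma> k" "G' \<in> models \<Gamma> k" "?h G = ?h G'"
    show "G = G'"
    proof (rule models_eqI[OF *(1,2)])
      show "x \<otimes>\<^bsub>G\<^esub> y = x \<otimes>\<^bsub>G'\<^esub> y" if "x < k" "y < k" for x y
        using fun_cong[OF conjunct1[OF *(3)[unfolded prod.inject]], of "(x, y)"] that by simp
      show "act G \<gamma> x = act G' \<gamma> x" if "\<gamma> \<in> carrier \<Gamma>" "x < k" for \<gamma> x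
        using fun_cong[OF conjunct2[OF *(3)[unfolded prod.inject]], of "(\<gamma>, x)"] that by simp
    qed
  qed
  moreover have "finite (({..<k} \<times> {..<k} \<rightarrow>\<^sub>E {..<k}) \<times> (carrier \<Gamma> \<times> {..<k} \<rightarrow>\<^sub>E {..<k}))"
    using assms by (intro finite_cartesian_product finite_PiE) auto
  ultimately show ?thesis using inj_on_finite by blast
qed

text \<open>Existence is transport of structure along \<open>b\<close>. Uniqueness combines the
  homomorphism property, which fixes the operations on the carrier, with the value
  \<open>undefined\<close> elsewhere.\<close>

lemma ex1_model:
  fixes \<Gamma> :: "('g, 'm) monoid_scheme"
  assumes Y: "is_gamma_group \<Gamma> Y" and b: "bij_betw b (carrier Y) {..<k}" "b \<in> extensional (carrier Y)"
  shows "\<exists>!G. (G \<in> models \<Gamma> k \<and> b \<in> gamma_epi \<Gamma> Y G)"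
proof (rule ex_ex1I)
  interpret Y: group Y using is_gamma_group_group[OF Y] by simp
  define c where "c = inv_into (carrier Y) b"
  have c: "c y \<in> carrier Y" "b (c y) = y" if "y < k" for y
    using b(1) that by (auto simp: c_def bij_betw_def inv_into_into f_inv_into_f)
  have cb: "c (b x) = x" and bk: "b x < k" if "x \<in> carrier Y" for x
    using b(1) that by (auto simp: c_def bij_betw_def)
  define G :: "(nat, 'g) gamma_group" where "G = \<lparr>carrier = {..<k},
    monoid.mult = (\<lambda>x y. if x < k \<and> y < k then b (c x \<otimes>\<^bsub>Y\<^esub> c y) else undefined), one = b \<one>\<^bsub>Y\<^esub>,
    act = (\<lambda>\<gamma> x. if \<gamma> \<in> carrier \<Gamma> \<and> x < k then b (act Y \<gamma> (c x)) else undefined)\<rparr>"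
  interpret \<Gamma>: group \<Gamma> using is_gamma_group_group[OF Y] by simp
  have gG: "group G"
  proof (rule groupI)
    fix x assume "x \<in> carrier G"
    then show "\<exists>y\<in>carrier G. y \<otimes>\<^bsub>G\<^esub> x = \<one>\<^bsub>G\<^esub>"
      using c bk cb by (intro bexI[of _ "b (inv\<^bsub>Y\<^esub> (c x))"]) (auto simp: G_def)
  qed (use c cb bk in \<open>auto simp: G_def Y.m_assoc\<close>)
  have "is_gamma_group \<Gamma> G"
    by (rule is_gamma_groupI[OF \<Gamma>.is_group gG])
      (use c cb bk in \<open>auto simp: G_def extensional_def act_hom[OF Y] act_one[OF Y] act_mult[OF Y]
        act_closed[OF Y]\<close>)
  then have "G \<in> models \<Gamma> k" by (auto simp: models_def G_def)
  moreover have "b \<in> gamma_epi \<Gamma> Y G"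
    using b cb bk act_closed[OF Y]
    by (auto simp: gamma_epi_def epi_def hom_def equivariant_def G_def bij_betw_def)
  ultimately show "\<exists>G. G \<in> models \<Gamma> k \<and> b \<in> gamma_epi \<Gamma> Y G" by blast
next
  fix G G' assume *: "G \<in> models \<Gamma> k \<and> b \<in> gamma_epi \<Gamma> Y G" "G' \<in> models \<Gamma> k \<and> b \<in> gamma_epi \<Gamma> Y G'"
  have b_surj: "\<exists>a\<in>carrier Y. b a = x" if "x < k" for x
    using b(1) that by (metis bij_betw_def imageE lessThan_iff)
  show "G = G'"
  proof (rule models_eqI[of G \<Gamma> k G'])
    fix x y assume "x < k" "y < k"
    then obtain a a' where "a \<in> carrier Y" "b a = x" "a' \<in> carrier Y" "b a' = y" using b_surj by metis
    then show "x \<otimes>\<^bsub>G\<^esub> y = x \<otimes>\<^bsub>G'\<^esub> y"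
      using * hom_mult[of b Y G a a'] hom_mult[of b Y G' a a'] by (auto simp: gamma_epi_def epi_def)
  next
    fix \<gamma> x assume "\<gamma> \<in> carrier \<Gamma>" "x < k"
    then obtain a where "a \<in> carrier Y" "b a = x" using b_surj by metis
    then show "act G \<gamma> x = act G' \<gamma> x"
      using * \<open>\<gamma> \<in> carrier \<Gamma>\<close> by (auto simp: gamma_epi_def equivariant_def)
  qed (use * in auto)
qed

text \<open>Each such pair comes from exactly one bijection of the quotient by \<open>N\<close> with
  \<open>{..<k}\<close>: the bijection transports the structure that becomes \<open>G\<close>, and
  \<open>f\<close> is its composite with the quotient map. Counting pairs, not isomorphism classes,
  gives every \<open>N\<close> the same multiplicity and keeps automorphism groups out of the
  formula.\<close>

lemma card_models_gamma_epi:
  assumes Y: "is_gamma_group \<Gamma> Y" "finite (carrier Y)" and N: "N \<in> gnormal \<Gamma> Y"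
    and k: "card (carrier Y) = k * card N"
  shows "card {(G, f). G \<in> models \<Gamma> k \<and> f \<in> gamma_epi \<Gamma> Y G \<and> kernel Y G f = N} = fact k"
proof -
  define Q where "Q = gamma_quotient Y N"
  define q where "q = (\<lambda>x\<in>carrier Y. N #>\<^bsub>Y\<^esub> x)"
  note q = quotient_gamma_epi[OF Y(1) N, folded Q_def q_def]
  interpret q: gamma_epimorphism \<Gamma> Y Q q by unfold_locales (use Y q in auto)
  have fQ: "finite (carrier Q)" by (rule q.finite_target[OF Y(2)])
  have "card N > 0"
    using gnormalD(1,2)[OF Y(1) N] Y(2) by (metis card_gt_0_iff empty_iff finite_subset)
  then have cQ: "card (carrier Q) = k"
    using q.card_carrier[OF Y(2)] k q(2) by simp
  define B where "B = {b \<in> carrier Q \<rightarrow>\<^sub>E {..<k}. inj_on b (carrier Q)}"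
  have "card B = fact k"
    unfolding B_def using card_inj_on_subset_funcset[OF fQ, of "{..<k}" "carrier Q"] cQ
    by (simp add: fact_prod_rev)
  have bij: "bij_betw b (carrier Q) {..<k}" if "b \<in> B" for b
  proof -
    have "b ` carrier Q = {..<k}"
      by (rule card_subset_eq) (use that cQ in \<open>auto simp: B_def card_image\<close>)
    then show ?thesis using that by (simp add: B_def bij_betw_def)
  qed
  define \<psi> where "\<psi> b = ((THE G. G \<in> models \<Gamma> k \<and> b \<in> gamma_epi \<Gamma> Q G), compose (carrier Y) b q)" for b
  have "bij_betw \<psi> B {(G, f). G \<in> models \<Gamma> k \<and> f \<in> gamma_epi \<Gamma> Y G \<and> kernel Y G f = N}" (is "bij_betw _ _ ?R")
  proof (rule bij_betwI')
    fix b b' assume b: "b \<in> B" "b' \<in> B"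
    show "\<psi> b = \<psi> b' \<longleftrightarrow> b = b'"
    proof
      assume "\<psi> b = \<psi> b'"
      then have eq: "compose (carrier Y) b q = compose (carrier Y) b' q" by (simp add: \<psi>_def)
      show "b = b'"
      proof (rule extensionalityI[where A = "carrier Q"])
        fix y assume "y \<in> carrier Q"
        then obtain x where "x \<in> carrier Y" "q x = y" using q.f_surj by blast
        then show "b y = b' y" using fun_cong[OF eq, of x] by (simp add: compose_eq)
      qed (use b in \<open>auto simp: B_def PiE_iff\<close>)
    qed simp
  next
    fix b assume b: "b \<in> B"
    define G where "G = (THE G. G \<in> models \<Gamma> k \<and> b \<in> gamma_epi \<Gamma> Q G)"
    have "G \<in> models \<Gamma> k \<and> b \<in> gamma_epi \<Gamma> Q G"
      unfolding G_def by (rule theI', rule ex1_model[OF q(3) bij[OF b]]) (use b in \<open>simp add: B_def PiE_iff\<close>)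
    then have G: "G \<in> models \<Gamma> k" "b \<in> gamma_epi \<Gamma> Q G" "is_gamma_group \<Gamma> G" by (auto simp: models_def)
    interpret b: gamma_epimorphism \<Gamma> Q G b by unfold_locales (use q G in auto)
    have "b y = \<one>\<^bsub>G\<^esub> \<longleftrightarrow> y = \<one>\<^bsub>Q\<^esub>" if "y \<in> carrier Q" for y
      using b that inj_on_eq_iff[of b "carrier Q" y "\<one>\<^bsub>Q\<^esub>"] b.hom_one q.H.one_closed
      by (simp add: B_def)
    then have "kernel Y G (compose (carrier Y) b q) = kernel Y Q q"
      by (auto simp: kernel_def compose_eq)
    then show "\<psi> b \<in> ?R"
      using G gamma_epi_compose[OF q(1) G(2) Y(1)] q(2) by (simp add: \<psi>_def flip: G_def)
  next
    fix p assume "p \<in> ?R"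
    then obtain G f where p: "p = (G, f)" "G \<in> models \<Gamma> k" "f \<in> gamma_epi \<Gamma> Y G" "kernel Y G f = N" by auto
    then have G: "is_gamma_group \<Gamma> G" "carrier G = {..<k}" by (auto simp: models_def)
    obtain r where r: "r \<in> gamma_epi \<Gamma> Q G" "r \<in> iso Q G" "f = compose (carrier Y) r q"
      using gamma_epi_iso[OF Y(1) q(3) G(1) q(1) p(3)] q(2) p(4) by metis
    then have rB: "r \<in> B" using G(2) by (auto simp: B_def iso_def bij_betw_def gamma_epi_def PiE_iff)
    have "(THE G. G \<in> models \<Gamma> k \<and> r \<in> gamma_epi \<Gamma> Q G) = G"
      by (rule the1_equality[OF ex1_model[OF q(3) bij[OF rB]]])
        (use rB r(1) p(2) in \<open>auto simp: B_def PiE_iff\<close>)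
    then show "\<exists>b\<in>B. p = \<psi> b" using rB r(3) p(1) by (auto simp: \<psi>_def)
  qed
  then show ?thesis using \<open>card B = fact k\<close> by (simp add: bij_betw_same_card)
qed

lemma ex_model_gamma_epi:
  assumes "is_gamma_group \<Gamma> Y" "finite (carrier Y)" "N \<in> gnormal \<Gamma> Y" "card (carrier Y) = k * card N"
  obtains G f where "G \<in> models \<Gamma> k" "f \<in> gamma_epi \<Gamma> Y G" "kernel Y G f = N"
proof -
  have "card {(G, f). G \<in> models \<Gamma> k \<and> f \<in> gamma_epi \<Gamma> Y G \<and> kernel Y G f = N} \<noteq> 0"
    by (simp add: card_models_gamma_epi[OF assms])
  then have "{(G, f). G \<in> models \<Gamma> k \<and> f \<in> gamma_epi \<Gamma> Y G \<and> kernel Y G f = N} \<noteq> {}"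
    by (metis card.empty)
  then show ?thesis using that by blast
qed


section \<open>The order of a minimal invariant normal subgroup\<close>

text \<open>Each generator contributes a cyclic factor of order at most \<open>e\<close>. The
  induction only asks for some subgroup that contains \<open>A\<close>, so it can take the product
  of the previous subgroup with a cyclic one.\<close>

lemma (in comm_group) card_generate_le:
  assumes "finite A" "A \<subseteq> carrier G" "\<And>x. x \<in> A \<Longrightarrow> x [^] e = \<one>" "0 < (e::nat)"
  shows "finite (generate G A) \<and> card (generate G A) \<le> e ^ card A"
proof -
  have "\<exists>W. subgroup W G \<and> A \<subseteq> W \<and> finite W \<and> card W \<le> e ^ card A"
    using assms
  proof (induction A rule: finite_induct)
    case empty
    then show ?case using triv_subgroup by (intro exI[of _ "{\<one>}"]) auto
  next
    case (insert a A)
    then obtain W where W: "subgroup W G" "A \<subseteq> W" "finite W" "card W \<le> e ^ card A" by auto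
    define B where "B = generate G {a}"
    have a: "a \<in> carrier G" "ord a dvd e" using insert.prems pow_eq_id[of a e] by auto
    then have "card B \<le> e" "0 < card B"
      unfolding B_def generate_pow_card[OF a(1), symmetric]
      using insert.prems by (auto simp: dvd_imp_le dvd_pos_nat)
    then have B: "subgroup B G" "a \<in> B" "finite B" "card B \<le> e"
      using a generate_is_subgroup[of "{a}"] generate.incl[of a "{a}"] by (auto simp: B_def card_gt_0_iff)
    have WB: "W <#> B = (\<lambda>(x, y). x \<otimes> y) ` (W \<times> B)" by (auto simp: set_mult_def)
    have "card (W <#> B) \<le> card W * card B"
      unfolding WB using card_image_le[of "W \<times> B"] W B by (simp add: card_cartesian_product)
    also have "\<dots> \<le> e ^ card A * e" using W B by (intro mult_le_mono) auto
    finally have "card (W <#> B) \<le> e ^ card (insert a A)" using insert.hyps by (simp add: mult.commute)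
    moreover have "subgroup (W <#> B) G" by (rule mult_subgroups) (fact W B)+
    moreover have "finite (W <#> B)" unfolding WB using W B by simp
    moreover have "insert a A \<subseteq> W <#> B"
    proof -
      have "a = \<one> \<otimes> a" using a by simp
      then have "a \<in> W <#> B"
        unfolding set_mult_def using W(1) B(2) subgroup.one_closed by blast
      moreover have "x \<in> W <#> B" if "x \<in> A" for x
      proof -
        have "x = x \<otimes> \<one>" using that insert.prems by auto
        then show ?thesis
          unfolding set_mult_def using that W(2) B(1) subgroup.one_closed by blast
      qed
      ultimately show ?thesis by blast
    qed
    ultimately show ?case by blast
  qed
  then obtain W where W: "subgroup W G" "A \<subseteq> W" "finite W" "card W \<le> e ^ card A" by blast
  have "generate G A \<subseteq> W" by (rule generate_subgroup_incl) (fact W)+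
  then show ?thesis using W by (metis card_mono finite_subset le_trans)
qed

lemma carrier_gnormal:
  assumes "is_gamma_group \<Gamma> G"
  shows "carrier G \<in> gnormal \<Gamma> G"
proof -
  interpret group G using is_gamma_group_group[OF assms] by simp
  show ?thesis by (simp add: gnormal_iff[OF assms] act_closed[OF assms])
qed

text \<open>An abelian minimal normal subgroup \<open>V\<close> is generated by the orbit of any of its nontrivial
  elements, and conjugation on \<open>V\<close> factors through \<open>G / V\<close>.\<close>

lemma card_abelian_minimal_gnormal_le:
  assumes G: "is_gamma_group \<Gamma> G" "finite (carrier G)" and fin: "finite (carrier \<Gamma>)"
    and e: "\<And>x. x \<in> carrier G \<Longrightarrow> x [^]\<^bsub>G\<^esub> e = \<one>\<^bsub>G\<^esub>" "0 < (e::nat)"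
    and V: "V \<in> gnormal \<Gamma> G" "V \<noteq> {\<one>\<^bsub>G\<^esub>}"
    and min: "\<And>M. M \<in> gnormal \<Gamma> G \<Longrightarrow> M \<subseteq> V \<Longrightarrow> M = {\<one>\<^bsub>G\<^esub>} \<or> M = V"
    and comm: "\<And>x y. x \<in> V \<Longrightarrow> y \<in> V \<Longrightarrow> x \<otimes>\<^bsub>G\<^esub> y = y \<otimes>\<^bsub>G\<^esub> x"
    and h: "card (carrier G) = h * card V"
  shows "card V \<le> e ^ (h * card (carrier \<Gamma>))"
proof -
  interpret G: group G using is_gamma_group_group[OF G(1)] by simp
  interpret \<Gamma>: group \<Gamma> using is_gamma_group_group[OF G(1)] by simp
  note VD = gnormalD[OF G(1) V(1)]
  note ac = act_closed[OF G(1)]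
  define Q where "Q = gamma_quotient G V"
  define q where "q = (\<lambda>x\<in>carrier G. V #>\<^bsub>G\<^esub> x)"
  note q = quotient_gamma_epi[OF G(1) V(1), folded Q_def q_def]
  interpret q: gamma_epimorphism \<Gamma> G Q q by unfold_locales (use G q in auto)
  have "card V > 0"
    using VD(1,2) G(2) by (metis card_gt_0_iff empty_iff finite_subset)
  then have cQ: "card (carrier Q) = h" using q.card_carrier[OF G(2)] h q(2) by simp
  have fQ: "finite (carrier Q)" by (rule q.finite_target[OF G(2)])
  obtain v where v: "v \<in> V" "v \<noteq> \<one>\<^bsub>G\<^esub>" using V(2) VD(2) by blast
  have vc: "v \<in> carrier G" using v VD by blast
  define cj where "cj g = g \<otimes>\<^bsub>G\<^esub> v \<otimes>\<^bsub>G\<^esub> inv\<^bsub>G\<^esub> g" for g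
  define A where "A = (\<lambda>(\<gamma>, g). act G \<gamma> (cj g)) ` (carrier \<Gamma> \<times> carrier G)"
  have cjV: "cj g \<in> V" if "g \<in> carrier G" for g using VD(5)[OF that v(1)] by (simp add: cj_def)
  have cjc: "cj g \<in> carrier G" if "g \<in> carrier G" for g using cjV[OF that] VD(1) by blast
  have cj_eq: "cj g = cj g'" if g: "g \<in> carrier G" "g' \<in> carrier G" "q g = q g'" for g g'
  proof -
    define d where "d = inv\<^bsub>G\<^esub> g \<otimes>\<^bsub>G\<^esub> g'"
    have d: "d \<in> V" using that q.f_eq_iff[of g g'] q(2) by (simp add: d_def)
    have dc: "d \<in> carrier G" using d VD by blast
    have g': "g' = g \<otimes>\<^bsub>G\<^esub> d" using g by (simp add: d_def flip: G.m_assoc)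
    have "cj g' = g \<otimes>\<^bsub>G\<^esub> (d \<otimes>\<^bsub>G\<^esub> v \<otimes>\<^bsub>G\<^esub> inv\<^bsub>G\<^esub> d) \<otimes>\<^bsub>G\<^esub> inv\<^bsub>G\<^esub> g"
      using g dc vc by (simp add: cj_def g' G.m_assoc G.inv_mult_group)
    also have "d \<otimes>\<^bsub>G\<^esub> v \<otimes>\<^bsub>G\<^esub> inv\<^bsub>G\<^esub> d = v"
      using comm[OF d v(1)] dc vc by (simp add: G.m_assoc)
    finally show ?thesis by (simp add: cj_def)
  qed
  have "A \<subseteq> (\<lambda>(\<gamma>, c). act G \<gamma> (cj (inv_into (carrier G) q c))) ` (carrier \<Gamma> \<times> carrier Q)"
  proof
    fix x assume "x \<in> A"
    then obtain \<gamma> g where x: "x = act G \<gamma> (cj g)" "\<gamma> \<in> carrier \<Gamma>" "g \<in> carrier G" by (auto simp: A_def)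
    have "cj g = cj (inv_into (carrier G) q (q g))"
      by (rule cj_eq) (use x in \<open>auto simp: inv_into_into f_inv_into_f\<close>)
    then show "x \<in> (\<lambda>(\<gamma>, c). act G \<gamma> (cj (inv_into (carrier G) q c))) ` (carrier \<Gamma> \<times> carrier Q)"
      using x by (intro image_eqI[of _ _ "(\<gamma>, q g)"]) auto
  qed
  from card_mono[OF _ this] have "card A \<le> card (carrier \<Gamma> \<times> carrier Q)"
    using fin fQ card_image_le[of "carrier \<Gamma> \<times> carrier Q"] le_trans by blast
  then have cA: "card A \<le> h * card (carrier \<Gamma>)" using cQ by (simp add: card_cartesian_product mult.commute)
  have finA: "finite A" using fin G by (simp add: A_def)
  have AV: "A \<subseteq> V" using cjV VD(6) by (auto simp: A_def)
  have "v = act G \<one>\<^bsub>\<Gamma>\<^esub> (cj \<one>\<^bsub>G\<^esub>)" using act_one[OF G(1) vc] vc by (simp add: cj_def)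
  then have vA: "v \<in> A" unfolding A_def by (intro image_eqI[of _ _ "(\<one>\<^bsub>\<Gamma>\<^esub>, \<one>\<^bsub>G\<^esub>)"]) auto
  have Ac: "A \<subseteq> carrier G" using AV VD(1) by blast
  have conjA: "g \<otimes>\<^bsub>G\<^esub> x \<otimes>\<^bsub>G\<^esub> inv\<^bsub>G\<^esub> g \<in> A" if x: "x \<in> A" and g: "g \<in> carrier G" for x g
  proof -
    obtain \<gamma> a where x: "x = act G \<gamma> (cj a)" "\<gamma> \<in> carrier \<Gamma>" "a \<in> carrier G" using x by (auto simp: A_def)
    \<comment> \<open>Conjugation by \<open>g\<close> after \<open>act G \<gamma>\<close> equals
      \<open>act G \<gamma>\<close> after conjugation by the element that \<open>\<gamma>\<close>
      sends to \<open>g\<close>. Hence \<open>A\<close> is closed under conjugation although its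
      elements are conjugated before \<open>\<gamma>\<close> acts.\<close>
    define g' where "g' = act G (inv\<^bsub>\<Gamma>\<^esub> \<gamma>) g"
    have g': "g' \<in> carrier G" "act G \<gamma> g' = g"
      using ac g x act_mult[OF G(1), of \<gamma> "inv\<^bsub>\<Gamma>\<^esub> \<gamma>" g] act_one[OF G(1), of g]
      by (simp_all add: g'_def)
    have "cj (g' \<otimes>\<^bsub>G\<^esub> a) = g' \<otimes>\<^bsub>G\<^esub> cj a \<otimes>\<^bsub>G\<^esub> inv\<^bsub>G\<^esub> g'"
      using g' x(3) vc by (simp add: cj_def G.m_assoc G.inv_mult_group)
    then have "act G \<gamma> (cj (g' \<otimes>\<^bsub>G\<^esub> a)) = g \<otimes>\<^bsub>G\<^esub> x \<otimes>\<^bsub>G\<^esub> inv\<^bsub>G\<^esub> g"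
      using g' x cjc[OF x(3)] by (simp add: act_hom[OF G(1)] act_inv[OF G(1)])
    then show ?thesis
      unfolding A_def using x g' by (intro image_eqI[of _ _ "(\<gamma>, g' \<otimes>\<^bsub>G\<^esub> a)"]) auto
  qed
  have actA: "act G \<gamma> x \<in> A" if x: "x \<in> A" and g: "\<gamma> \<in> carrier \<Gamma>" for x \<gamma>
  proof -
    obtain \<delta> a where x: "x = act G \<delta> (cj a)" "\<delta> \<in> carrier \<Gamma>" "a \<in> carrier G" using x by (auto simp: A_def)
    then show ?thesis
      unfolding A_def using g cjc
      by (intro image_eqI[of _ _ "(\<gamma> \<otimes>\<^bsub>\<Gamma>\<^esub> \<delta>, a)"]) (auto simp: act_mult[OF G(1)])
  qed
  have "generate G A \<lhd> G" by (rule G.normal_generateI[OF Ac conjA])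
  moreover have "act G \<gamma> ` generate G A \<subseteq> generate G A" if g: "\<gamma> \<in> carrier \<Gamma>" for \<gamma>
  proof -
    have "act G \<gamma> \<in> hom G G" using g act_closed[OF G(1)] act_hom[OF G(1)] by (auto simp: hom_def)
    then interpret a: group_hom G G "act G \<gamma>" by unfold_locales
    have "act G \<gamma> ` generate G A = generate G (act G \<gamma> ` A)" using a.generate_img[OF Ac] by simp
    also have "\<dots> \<subseteq> generate G A" by (rule G.mono_generate) (use actA g in auto)
    finally show ?thesis .
  qed
  ultimately have gen: "generate G A \<in> gnormal \<Gamma> G" by (simp add: gnormal_def gamma_invariant_def)
  have sV: "subgroup V G" using V(1) by (simp add: gnormal_def normal_imp_subgroup)
  have "generate G A \<subseteq> V" by (rule G.generate_subgroup_incl[OF AV sV])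
  moreover have "generate G A \<noteq> {\<one>\<^bsub>G\<^esub>}" using generate.incl[OF vA, of G] v(2) by auto
  ultimately have "generate G A = V" using min[OF gen] by blast
  \<comment> \<open>\<open>card_generate_le\<close> is about abelian groups, so generation is moved
    from \<open>G\<close> into \<open>V\<close>.\<close>
  interpret V: group "G\<lparr>carrier := V\<rparr>" by (rule G.subgroup_imp_group[OF sV])
  interpret V: comm_group "G\<lparr>carrier := V\<rparr>"
    by (rule V.group_comm_groupI) (use comm in auto)
  have "x [^]\<^bsub>G\<lparr>carrier := V\<rparr>\<^esub> e = \<one>\<^bsub>G\<lparr>carrier := V\<rparr>\<^esub>" if "x \<in> A" for x
    using that Ac e(1) by (simp add: nat_pow_def subset_iff)
  then have *: "finite (generate (G\<lparr>carrier := V\<rparr>) A)" "card (generate (G\<lparr>carrier := V\<rparr>) A) \<le> e ^ card A"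
    using V.card_generate_le[OF finA, of e] AV e(2) by auto
  have "V \<subseteq> generate (G\<lparr>carrier := V\<rparr>) A"
    using G.generate_subgroup_incl[of A "generate (G\<lparr>carrier := V\<rparr>) A"]
      G.incl_subgroup[OF sV V.generate_is_subgroup[of A]] AV generate.incl[of _ A] \<open>generate G A = V\<close>
    by auto
  then have "card V \<le> e ^ card A" using * by (meson card_mono le_trans)
  also have "\<dots> \<le> e ^ (h * card (carrier \<Gamma>))" using cA e(2) by (intro power_increasing) auto
  finally show ?thesis .
qed

text \<open>If no coordinate of the product \<open>\<Prod>F\<^sub>i\<close> detects the nonabelian \<open>V\<close>, then commutators of elements
  of \<open>V\<close> lift to elements which are trivial in more and more coordinates.\<close>

lemma card_nonabelian_minimal_gnormal_le:
  fixes F :: "nat \<Rightarrow> ('a, 'g) gamma_group" and G :: "('b, 'g) gamma_group"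
  assumes G: "is_gamma_group \<Gamma> G" "finite (carrier G)"
    and F: "\<And>i. i < n \<Longrightarrow> finite_gamma_group \<Gamma> (F i)"
    and K: "K \<subseteq> (\<Pi>\<^sub>E i\<in>{..<n}. carrier (F i))"
    and Y: "is_gamma_group \<Gamma> (gamma_subgroup (gamma_product {..<n} F) K)"
    and f: "f \<in> gamma_epi \<Gamma> (gamma_subgroup (gamma_product {..<n} F) K) G"
    and V: "V \<in> gnormal \<Gamma> G"
    and min: "\<And>M. M \<in> gnormal \<Gamma> G \<Longrightarrow> M \<subseteq> V \<Longrightarrow> M = {\<one>\<^bsub>G\<^esub>} \<or> M = V"
    and nc: "u \<in> V" "w \<in> V" "u \<otimes>\<^bsub>G\<^esub> w \<noteq> w \<otimes>\<^bsub>G\<^esub> u"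
  shows "\<exists>i<n. card V \<le> card (carrier (F i))"
proof (rule ccontr)
  assume contr: "\<not> ?thesis"
  define Y where "Y = gamma_subgroup (gamma_product {..<n} F) K"
  have YG: "is_gamma_group \<Gamma> Y" using Y by (simp add: Y_def)
  interpret f: gamma_epimorphism \<Gamma> Y G f by unfold_locales (use YG G f in \<open>auto simp: Y_def\<close>)
  note VD = gnormalD[OF G(1) V]
  have Fg: "is_gamma_group \<Gamma> (F i)" "finite (carrier (F i))" if "i < n" for i
    using F[OF that] by (auto simp: finite_gamma_group_def)
  have cY: "carrier Y = K" by (simp add: Y_def)
  have Yc: "y i \<in> carrier (F i)" if "y \<in> carrier Y" "i < n" for y i
    using that K by (auto simp: cY)
  have ev: "group_hom Y (F i) (\<lambda>y. y i)" if "i < n" for i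
    using that Yc[OF _ that] is_gamma_group_group(2)[OF Fg(1)[OF that]] f.G.is_group
    by (auto simp: group_hom_def group_hom_axioms_def hom_def Y_def)
  define N where "N J = carrier Y \<inter> \<Inter>((\<lambda>i. kernel Y (F i) (\<lambda>y. y i)) ` J)" for J
  have N: "N J \<in> gnormal \<Gamma> Y" if "J \<subseteq> {..<n}" for J
    unfolding N_def
  proof (rule Int_Inter_gnormal[OF YG carrier_gnormal[OF YG]], safe)
    fix i assume "i \<in> J"
    then have i: "i < n" using that by auto
    interpret ev: group_hom Y "F i" "\<lambda>y. y i" by (rule ev[OF i])
    have "act Y \<gamma> y i = \<one>\<^bsub>F i\<^esub>" if "\<gamma> \<in> carrier \<Gamma>" "y \<in> carrier Y" "y i = \<one>\<^bsub>F i\<^esub>" for \<gamma> y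
      using that K i act_one_eq[OF Fg(1)[OF i]] by (auto simp: Y_def)
    then show "kernel Y (F i) (\<lambda>y. y i) \<in> gnormal \<Gamma> Y"
      using ev.normal_kernel act_closed[OF YG]
      by (auto simp: gnormal_def gamma_invariant_def kernel_def)
  qed
  \<comment> \<open>The part of \<open>V\<close> with lifts that are trivial on the coordinates in
    \<open>J\<close>. It is normal and invariant, so minimality of \<open>V\<close> leaves two
    possibilities.\<close>
  define Z where "Z J = f ` N J \<inter> V" for J
  have Z: "Z J = {\<one>\<^bsub>G\<^esub>} \<or> Z J = V" if "J \<subseteq> {..<n}" for J
    using min[of "Z J"] Int_gnormal[OF G(1) f.image_gnormal[OF N[OF that]] V] by (simp add: Z_def)
  have mem: "y \<in> N J \<longleftrightarrow> y \<in> carrier Y \<and> (\<forall>i\<in>J. y i = \<one>\<^bsub>F i\<^esub>)" for y J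
    by (auto simp: N_def kernel_def)
  \<comment> \<open>Otherwise two elements of \<open>V\<close> whose lifts agree in coordinate
    \<open>i\<close> would have to be equal, which would inject \<open>V\<close> into
    \<open>F i\<close> and contradict \<open>contr\<close>.\<close>
  have Z1: "Z {i} = V" if i: "i < n" for i
  proof (rule ccontr)
    assume "Z {i} \<noteq> V"
    then have Zi: "Z {i} = {\<one>\<^bsub>G\<^esub>}" using Z[of "{i}"] i by auto
    define g where "g v = inv_into (carrier Y) f v" for v
    have g: "g v \<in> carrier Y" "f (g v) = v" if "v \<in> V" for v
      using that VD(1) f.f_image by (auto simp: g_def inv_into_into f_inv_into_f subset_iff)
    interpret ev: group_hom Y "F i" "\<lambda>y. y i" by (rule ev[OF i])
    have "inj_on (\<lambda>v. g v i) V"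
    proof (rule inj_onI)
      fix v v' assume v: "v \<in> V" "v' \<in> V" and eq: "g v i = g v' i"
      define y where "y = inv\<^bsub>Y\<^esub> (g v) \<otimes>\<^bsub>Y\<^esub> g v'"
      have y: "y \<in> carrier Y" using g v by (simp add: y_def)
      have "y i = \<one>\<^bsub>F i\<^esub>"
        using g v eq by (simp only: y_def ev.hom_mult f.G.inv_closed ev.hom_inv ev.H.l_inv Yc[OF _ i])
      then have "f y \<in> f ` N {i}" using y by (auto simp: mem)
      moreover have fy: "f y = inv\<^bsub>G\<^esub> v \<otimes>\<^bsub>G\<^esub> v'" using g v by (simp add: y_def)
      ultimately have "f y \<in> Z {i}" using VD v by (auto simp: Z_def)
      then have "inv\<^bsub>G\<^esub> v \<otimes>\<^bsub>G\<^esub> v' = \<one>\<^bsub>G\<^esub>" using Zi fy by simp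
      moreover have "v \<in> carrier G" "v' \<in> carrier G" using v VD(1) by auto
      ultimately show "v = v'" using f.H.inv_equality f.H.inv_inv f.H.inv_closed by metis
    qed
    then have "card V \<le> card (carrier (F i))"
      by (rule card_inj_on_le) (use g Yc i Fg in auto)
    then show False using contr i by blast
  qed
  have "Z {..<m} = V" if "m \<le> n" for m
    using that
  proof (induction m)
    case 0
    have "N {} = carrier Y" by (simp add: N_def)
    then show ?case using VD(1) f.f_image by (auto simp: Z_def)
  next
    case (Suc m)
    then have "u \<in> Z {..<m}" "w \<in> Z {m}" using nc Z1[of m] by auto
    then obtain y z where y: "y \<in> N {..<m}" "f y = u" and z: "z \<in> N {m}" "f z = w"
      by (auto simp: Z_def)
    have N1: "N {..<m} \<in> gnormal \<Gamma> Y" and N2: "N {m} \<in> gnormal \<Gamma> Y" using N Suc.prems by auto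
    note D1 = gnormalD[OF YG N1] and D2 = gnormalD[OF YG N2]
    have yc: "y \<in> carrier Y" and zc: "z \<in> carrier Y" using y z by (auto simp: mem)
    have uc: "u \<in> carrier G" "w \<in> carrier G" using nc VD(1) by auto
    \<comment> \<open>\<open>y\<close> is trivial on the first \<open>m\<close> coordinates and
      \<open>z\<close> on coordinate \<open>m\<close>, so their commutator is trivial on all of
      them. Its image is not \<open>\<one>\<close>, since \<open>u\<close> and \<open>w\<close> do
      not commute.\<close>
    define c where "c = y \<otimes>\<^bsub>Y\<^esub> z \<otimes>\<^bsub>Y\<^esub> inv\<^bsub>Y\<^esub> y \<otimes>\<^bsub>Y\<^esub> inv\<^bsub>Y\<^esub> z"
    have "c = y \<otimes>\<^bsub>Y\<^esub> (z \<otimes>\<^bsub>Y\<^esub> inv\<^bsub>Y\<^esub> y \<otimes>\<^bsub>Y\<^esub> inv\<^bsub>Y\<^esub> z)" using yc zc by (simp add: c_def f.G.m_assoc)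
    then have c1: "c \<in> N {..<m}" using y D1 zc by simp
    have c2: "c \<in> N {m}" unfolding c_def using z D2 yc by simp
    have cN: "c \<in> N {..<Suc m}" using c1 c2 by (auto simp: mem less_Suc_eq)
    have fc: "f c = u \<otimes>\<^bsub>G\<^esub> w \<otimes>\<^bsub>G\<^esub> inv\<^bsub>G\<^esub> u \<otimes>\<^bsub>G\<^esub> inv\<^bsub>G\<^esub> w" using y z yc zc by (simp add: c_def)
    have "f c \<in> V" unfolding fc using VD nc uc by simp
    then have fcZ: "f c \<in> Z {..<Suc m}" using cN by (auto simp: Z_def)
    have "f c \<noteq> \<one>\<^bsub>G\<^esub>"
    proof
      assume "f c = \<one>\<^bsub>G\<^esub>"
      then have "u \<otimes>\<^bsub>G\<^esub> w \<otimes>\<^bsub>G\<^esub> inv\<^bsub>G\<^esub> (w \<otimes>\<^bsub>G\<^esub> u) = \<one>\<^bsub>G\<^esub>"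
        using uc by (simp add: fc f.H.inv_mult_group f.H.m_assoc)
      from f.H.inv_equality[OF this] have "u \<otimes>\<^bsub>G\<^esub> w = w \<otimes>\<^bsub>G\<^esub> u" using uc by simp
      then show False using nc by simp
    qed
    then have "Z {..<Suc m} \<noteq> {\<one>\<^bsub>G\<^esub>}" using fcZ by auto
    then show ?case using Z[of "{..<Suc m}"] Suc.prems by auto
  qed
  from this[of n] have "Z {..<n} = V" by simp
  moreover have "f y = \<one>\<^bsub>G\<^esub>" if "y \<in> N {..<n}" for y
  proof -
    have "y = \<one>\<^bsub>Y\<^esub>"
    proof
      fix i show "y i = \<one>\<^bsub>Y\<^esub> i" using that K by (cases "i < n") (auto simp: mem Y_def)
    qed
    then show ?thesis by simp
  qed
  ultimately have "V \<subseteq> {\<one>\<^bsub>G\<^esub>}" by (auto simp: Z_def)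
  then have "u = \<one>\<^bsub>G\<^esub>" "w = \<one>\<^bsub>G\<^esub>" using nc by auto
  then show False using nc by simp
qed

text \<open>Here \<open>h\<close> is the order of the quotient by the minimal normal subgroup. The
  first summand serves the abelian case: the product of the orders is an exponent of every
  level-\<open>\<C>\<close> group, and \<open>h * card (carrier \<Gamma>)\<close> elements generate.
  The second serves the nonabelian case, where a single member of \<open>\<C>\<close> is large
  enough.\<close>

definition chief_bound :: "('g, 'm) monoid_scheme \<Rightarrow> ('a, 'g) gamma_group set \<Rightarrow> nat \<Rightarrow> nat" where
  "chief_bound \<Gamma> \<C> h = (\<Prod>F\<in>\<C>. card (carrier F)) ^ (h * card (carrier \<Gamma>)) + (\<Sum>F\<in>\<C>. card (carrier F))"

lemma card_minimal_gnormal_le: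
  assumes G: "is_gamma_group \<Gamma> G" "finite (carrier G)" "level \<Gamma> \<C> G"
    and C: "finite \<C>" "\<And>F. F \<in> \<C> \<Longrightarrow> finite_gamma_group \<Gamma> F" and fin: "finite (carrier \<Gamma>)"
    and V: "V \<in> gnormal \<Gamma> G" "V \<noteq> {\<one>\<^bsub>G\<^esub>}"
    and min: "\<And>M. M \<in> gnormal \<Gamma> G \<Longrightarrow> M \<subseteq> V \<Longrightarrow> M = {\<one>\<^bsub>G\<^esub>} \<or> M = V"
    and h: "card (carrier G) = h * card V"
  shows "card V \<le> chief_bound \<Gamma> \<C> h"
proof -
  have Cg: "is_gamma_group \<Gamma> F" "finite (carrier F)" if "F \<in> \<C>" for F
    using C(2)[OF that] by (auto simp: finite_gamma_group_def)
  define e where "e = (\<Prod>F\<in>\<C>. card (carrier F))"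
  have "card (carrier F) > 0" if "F \<in> \<C>" for F
    using Cg[OF that] is_gamma_group_group(2)[OF Cg(1)[OF that]]
    by (metis card_gt_0_iff empty_iff group.is_monoid monoid.one_closed)
  then have e0: "e > 0" by (simp add: e_def prod_pos)
  show ?thesis
  proof (rule level_imp_gamma_epi[OF G(1,3) Cg(1)])
    fix n F K f
    assume F: "\<And>i. i < (n::nat) \<Longrightarrow> F i \<in> \<C>" and K: "subgroup K (gamma_product {..<n} F)"
      and Y: "is_gamma_group \<Gamma> (gamma_subgroup (gamma_product {..<n} F) K)"
      and f: "f \<in> gamma_epi \<Gamma> (gamma_subgroup (gamma_product {..<n} F) K) G"
    have Kc: "K \<subseteq> (\<Pi>\<^sub>E i\<in>{..<n}. carrier (F i))" using subgroup.subset[OF K] by simp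
    show ?thesis
    proof (cases "\<forall>x\<in>V. \<forall>y\<in>V. x \<otimes>\<^bsub>G\<^esub> y = y \<otimes>\<^bsub>G\<^esub> x")
      case True
      define Y where "Y = gamma_subgroup (gamma_product {..<n} F) K"
      interpret f: gamma_epimorphism \<Gamma> Y G f by unfold_locales (use Y G f in \<open>auto simp: Y_def\<close>)
      have "x [^]\<^bsub>G\<^esub> e = \<one>\<^bsub>G\<^esub>" if x: "x \<in> carrier G" for x
      proof -
        obtain y where y: "y \<in> carrier Y" "f y = x" using f.f_surj[OF x] by blast
        have "(y [^]\<^bsub>Y\<^esub> m) i = y i [^]\<^bsub>F i\<^esub> m" if "i < n" for m :: nat and i
          by (induction m) (use that in \<open>auto simp: Y_def\<close>)
        moreover have "y i [^]\<^bsub>F i\<^esub> e = \<one>\<^bsub>F i\<^esub>" if i: "i < n" for i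
        proof -
          interpret Fi: group "F i" using is_gamma_group_group(2)[OF Cg(1)[OF F[OF i]]] .
          have yi: "y i \<in> carrier (F i)" using y i Kc by (auto simp: Y_def)
          have "card (carrier (F i)) dvd e" unfolding e_def using C(1) F[OF i] by (rule dvd_prodI)
          then obtain d where "e = card (carrier (F i)) * d" by (rule dvdE)
          then have "y i [^]\<^bsub>F i\<^esub> e = (y i [^]\<^bsub>F i\<^esub> Coset.order (F i)) [^]\<^bsub>F i\<^esub> d"
            using yi by (simp add: Coset.order_def Fi.nat_pow_pow)
          then show ?thesis using Fi.pow_order_eq_1[OF yi] by simp
        qed
        moreover have "y [^]\<^bsub>Y\<^esub> e \<in> carrier Y" using y by simp
        then have "(y [^]\<^bsub>Y\<^esub> e) i = undefined" if "\<not> i < n" for i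
          using Kc that by (auto simp: Y_def PiE_iff extensional_def)
        ultimately have "y [^]\<^bsub>Y\<^esub> e = \<one>\<^bsub>Y\<^esub>" by (auto simp: fun_eq_iff Y_def)
        then have "f y [^]\<^bsub>G\<^esub> e = \<one>\<^bsub>G\<^esub>" using f.hom_nat_pow[OF y(1), of e] by simp
        then show ?thesis using y by simp
      qed
      then have "card V \<le> e ^ (h * card (carrier \<Gamma>))"
        using True by (intro card_abelian_minimal_gnormal_le[OF G(1,2) fin _ e0 V min _ h]) auto
      then show ?thesis by (simp add: chief_bound_def e_def)
    next
      case False
      then obtain u w where nc: "u \<in> V" "w \<in> V" "u \<otimes>\<^bsub>G\<^esub> w \<noteq> w \<otimes>\<^bsub>G\<^esub> u" by blast
      obtain i where i: "i < n" "card V \<le> card (carrier (F i))"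
        using card_nonabelian_minimal_gnormal_le[OF G(1,2) C(2)[OF F] Kc Y f V(1) min nc] by blast
      have "card (carrier (F i)) \<le> (\<Sum>F\<in>\<C>. card (carrier F))"
        using C(1) F[OF i(1)] by (intro member_le_sum) auto
      then show ?thesis using i by (simp add: chief_bound_def)
    qed
  qed
qed


section \<open>Moebius sums as combinations of surjection counts\<close>

definition gmaximal :: "('g, 'm) monoid_scheme \<Rightarrow> ('a, 'g) gamma_group \<Rightarrow> 'a set \<Rightarrow> 'a set set" where
  "gmaximal \<Gamma> G K = {M \<in> gnormal \<Gamma> G. M \<subset> K \<and> (\<forall>L\<in>gnormal \<Gamma> G. M \<subseteq> L \<longrightarrow> L \<subseteq> K \<longrightarrow> L = M \<or> L = K)}"

lemma finite_gmaximal: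
  "is_gamma_group \<Gamma> G \<Longrightarrow> finite (carrier G) \<Longrightarrow> finite (gmaximal \<Gamma> G K)"
  by (rule finite_subset[OF _ finite_gnormal]) (auto simp: gmaximal_def)

lemma gmaximal_nonempty:
  assumes "is_gamma_group \<Gamma> G" "finite (carrier G)" "K \<in> gnormal \<Gamma> G" "K \<noteq> {\<one>\<^bsub>G\<^esub>}"
  shows "gmaximal \<Gamma> G K \<noteq> {}"
proof -
  define A where "A = {M \<in> gnormal \<Gamma> G. M \<subset> K}"
  have "finite A" using finite_gnormal[OF assms(2,1)] by (simp add: A_def)
  moreover have "{\<one>\<^bsub>G\<^esub>} \<in> A"
    using one_gnormal[OF assms(1)] gnormalD(2)[OF assms(1,3)] assms(4) by (auto simp: A_def)
  ultimately obtain M where M: "M \<in> A" "\<And>L. L \<in> A \<Longrightarrow> M \<subseteq> L \<Longrightarrow> M = L"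
    using finite_has_maximal[of A] by blast
  have "M \<in> gmaximal \<Gamma> G K"
    unfolding gmaximal_def
  proof (intro CollectI conjI ballI impI)
    show "M \<in> gnormal \<Gamma> G" "M \<subset> K" using M by (auto simp: A_def)
    fix L assume "L \<in> gnormal \<Gamma> G" "M \<subseteq> L" "L \<subseteq> K"
    then show "L = M \<or> L = K" using M(2)[of L] by (auto simp: A_def)
  qed
  then show ?thesis by blast
qed

lemma gmaximal_trivial:
  assumes "is_gamma_group \<Gamma> G"
  shows "gmaximal \<Gamma> G {\<one>\<^bsub>G\<^esub>} = {}"
  using gnormalD(2)[OF assms] by (auto simp: gmaximal_def)

section \<open>Pulling Moebius values back along a surjection\<close>

context gamma_epimorphism
begin

abbreviation preim :: "'b set \<Rightarrow> 'a set" where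
  "preim M \<equiv> {x \<in> carrier G. f x \<in> M}"

lemma preim_subset_iff:
  assumes "M \<subseteq> carrier H" "M' \<subseteq> carrier H"
  shows "preim M \<subseteq> preim M' \<longleftrightarrow> M \<subseteq> M'"
  using image_preimage[OF assms(1)] image_preimage[OF assms(2)] by blast

lemma preim_eq_iff:
  assumes "M \<subseteq> carrier H" "M' \<subseteq> carrier H"
  shows "preim M = preim M' \<longleftrightarrow> M = M'"
  using preim_subset_iff[OF assms] preim_subset_iff[OF assms(2,1)] by blast

lemma kernel_subset_preim: "M \<in> gnormal \<Gamma> H \<Longrightarrow> kernel G H f \<subseteq> preim M"
  using gnormalD(2)[OF target] by (auto simp: kernel_def)

text \<open>Correspondence theorem: taking preimages is an order isomorphism from the invariant
  normal subgroups of \<open>H\<close> to those of \<open>G\<close> containing the kernel.\<close>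

lemma gmaximal_preim:
  assumes K: "K \<in> gnormal \<Gamma> H"
  shows "{M \<in> gmaximal \<Gamma> G (preim K). kernel G H f \<subseteq> M} = preim ` gmaximal \<Gamma> H K"
proof (intro equalityI subsetI)
  note sub = gnormalD(1)[OF target]
  note subG = gnormalD(1)[OF source]
  fix M assume "M \<in> {M \<in> gmaximal \<Gamma> G (preim K). kernel G H f \<subseteq> M}"
  then have M: "M \<in> gnormal \<Gamma> G" "M \<subset> preim K" "kernel G H f \<subseteq> M"
    and max: "\<And>L. L \<in> gnormal \<Gamma> G \<Longrightarrow> M \<subseteq> L \<Longrightarrow> L \<subseteq> preim K \<Longrightarrow> L = M \<or> L = preim K"
    by (auto simp: gmaximal_def)
  have pM: "preim (f ` M) = M" by (rule preimage_image) fact+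
  note fM = image_gnormal[OF M(1)]
  have "f ` M \<in> gmaximal \<Gamma> H K"
    unfolding gmaximal_def
  proof (intro CollectI conjI ballI impI)
    show "f ` M \<in> gnormal \<Gamma> H" by fact
    show "f ` M \<subset> K" using M(2) pM by auto
    fix L assume L: "L \<in> gnormal \<Gamma> H" "f ` M \<subseteq> L" "L \<subseteq> K"
    then have "preim L = M \<or> preim L = preim K"
      using M subG[OF M(1)] by (intro max preimage_gnormal) auto
    then show "L = f ` M \<or> L = K"
    proof (elim disjE)
      assume "preim L = M"
      then have "f ` preim L = f ` M" by (rule arg_cong)
      then show ?thesis unfolding image_preimage[OF sub[OF L(1)]] ..
    next
      assume "preim L = preim K"
      then have "f ` preim L = f ` preim K" by (rule arg_cong)
      then show ?thesis unfolding image_preimage[OF sub[OF L(1)]] image_preimage[OF sub[OF K]] ..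
    qed
  qed
  then show "M \<in> preim ` gmaximal \<Gamma> H K" by (rule image_eqI[where x = "f ` M", rotated]) (simp only: pM)
next
  note sub = gnormalD(1)[OF target]
  fix M assume "M \<in> preim ` gmaximal \<Gamma> H K"
  then obtain M' where M': "M = preim M'" "M' \<in> gnormal \<Gamma> H" "M' \<subset> K"
    and max: "\<And>L. L \<in> gnormal \<Gamma> H \<Longrightarrow> M' \<subseteq> L \<Longrightarrow> L \<subseteq> K \<Longrightarrow> L = M' \<or> L = K"
    by (auto simp: gmaximal_def)
  have ker: "kernel G H f \<subseteq> M" unfolding M'(1) by (rule kernel_subset_preim[OF M'(2)])
  have "M \<in> gmaximal \<Gamma> G (preim K)"
    unfolding gmaximal_def
  proof (intro CollectI conjI ballI impI)
    show "M \<in> gnormal \<Gamma> G" unfolding M'(1) by (rule preimage_gnormal[OF M'(2)])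
    show "M \<subset> preim K"
      using M' preim_eq_iff[OF sub[OF M'(2)] sub[OF K]] preim_subset_iff[OF sub[OF M'(2)] sub[OF K]] by blast
    fix L assume L: "L \<in> gnormal \<Gamma> G" "M \<subseteq> L" "L \<subseteq> preim K"
    then have pL: "preim (f ` L) = L" using ker by (intro preimage_image) auto
    have "M' \<subseteq> f ` L" using image_preimage[OF sub[OF M'(2)]] L(2) M'(1) by blast
    moreover have "f ` L \<subseteq> K" using L(3) by auto
    ultimately have "f ` L = M' \<or> f ` L = K" using max[OF image_gnormal[OF L(1)]] by blast
    then show "L = M \<or> L = preim K" using pL M'(1) by auto
  qed
  then show "M \<in> {M \<in> gmaximal \<Gamma> G (preim K). kernel G H f \<subseteq> M}" using ker by blast
qed

text \<open>Maximal subgroups that meet \<open>preim K\<close> exactly in the kernel all contain the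
  kernel, hence are preimages. So the Moebius value at a normal subgroup can be computed in the
  quotient by it.\<close>

lemma mob_preim:
  assumes K: "K \<in> gnormal \<Gamma> H"
  shows "mob (gmaximal \<Gamma> G (preim K)) (preim K) (kernel G H f) = mob (gmaximal \<Gamma> H K) K {\<one>\<^bsub>H\<^esub>}"
proof -
  note sub = gnormalD(1)[OF target]
  have msub: "M \<subseteq> carrier H" if "M \<in> gmaximal \<Gamma> H K" for M using that sub by (auto simp: gmaximal_def)
  have inj: "inj_on preim (gmaximal \<Gamma> H K)"
    using preim_eq_iff msub by (auto simp: inj_on_def)
  have flat: "preim K \<inter> \<Inter>(preim ` S) = preim (K \<inter> \<Inter>S)" for S by auto
  have one: "kernel G H f = preim {\<one>\<^bsub>H\<^esub>}" by (auto simp: kernel_def)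
  have eq: "preim K \<inter> \<Inter>(preim ` S) = kernel G H f \<longleftrightarrow> K \<inter> \<Inter>S = {\<one>\<^bsub>H\<^esub>}" for S
    unfolding flat one by (rule preim_eq_iff) (use sub[OF K] in auto)
  have "(\<Sum>S | S \<subseteq> gmaximal \<Gamma> H K \<and> K \<inter> \<Inter>S = {\<one>\<^bsub>H\<^esub>}. (-1 :: real) ^ card S) =
    (\<Sum>S\<in>image preim ` {S. S \<subseteq> gmaximal \<Gamma> H K \<and> K \<inter> \<Inter>S = {\<one>\<^bsub>H\<^esub>}}. (-1) ^ card S)"
  proof (subst sum.reindex)
    show "inj_on ((`) preim) {S. S \<subseteq> gmaximal \<Gamma> H K \<and> K \<inter> \<Inter>S = {\<one>\<^bsub>H\<^esub>}}"
      using inj_on_image_eq_iff[OF inj] by (auto simp: inj_on_def)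
    show "(\<Sum>S | S \<subseteq> gmaximal \<Gamma> H K \<and> K \<inter> \<Inter>S = {\<one>\<^bsub>H\<^esub>}. (-1 :: real) ^ card S) =
      sum ((\<lambda>S. (-1) ^ card S) \<circ> (`) preim) {S. S \<subseteq> gmaximal \<Gamma> H K \<and> K \<inter> \<Inter>S = {\<one>\<^bsub>H\<^esub>}}"
      by (rule sum.cong) (auto simp: card_image inj_on_subset[OF inj])
  qed
  also have "image preim ` {S. S \<subseteq> gmaximal \<Gamma> H K \<and> K \<inter> \<Inter>S = {\<one>\<^bsub>H\<^esub>}} =
    {S. S \<subseteq> gmaximal \<Gamma> G (preim K) \<and> preim K \<inter> \<Inter>S = kernel G H f}"
  proof (intro equalityI subsetI)
    fix S assume "S \<in> image preim ` {S. S \<subseteq> gmaximal \<Gamma> H K \<and> K \<inter> \<Inter>S = {\<one>\<^bsub>H\<^esub>}}"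
    then obtain S' where S': "S = preim ` S'" "S' \<subseteq> gmaximal \<Gamma> H K" "K \<inter> \<Inter>S' = {\<one>\<^bsub>H\<^esub>}" by auto
    have "preim ` S' \<subseteq> gmaximal \<Gamma> G (preim K)" using gmaximal_preim[OF K] S'(2) by blast
    then show "S \<in> {S. S \<subseteq> gmaximal \<Gamma> G (preim K) \<and> preim K \<inter> \<Inter>S = kernel G H f}"
      using eq[of S'] S'(1,3) by simp
  next
    fix S assume S: "S \<in> {S. S \<subseteq> gmaximal \<Gamma> G (preim K) \<and> preim K \<inter> \<Inter>S = kernel G H f}"
    then have "S \<subseteq> preim ` gmaximal \<Gamma> H K" unfolding gmaximal_preim[OF K, symmetric] by auto
    then obtain S' where S': "S' \<subseteq> gmaximal \<Gamma> H K" "S = preim ` S'" by (rule subset_imageE)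
    then show "S \<in> image preim ` {S. S \<subseteq> gmaximal \<Gamma> H K \<and> K \<inter> \<Inter>S = {\<one>\<^bsub>H\<^esub>}}"
      using S eq[of S'] by (intro image_eqI[where x = S']) simp_all
  qed
  finally show ?thesis by (simp add: mob_def)
qed

end

text \<open>\<open>w\<close> is the identity for the truncated Moebius sum and the absolute value
  for the majorant of its error, so that one argument expands both in moments. Collecting all
  \<open>p\<close> for a given \<open>N\<close> is what makes the value an invariant of the quotient
  by \<open>N\<close>.\<close>

definition weight ::
  "(real \<Rightarrow> real) \<Rightarrow> ('g, 'm) monoid_scheme \<Rightarrow> ('b, 'g) gamma_group \<Rightarrow> ('a, 'g) gamma_group \<Rightarrow> 'a set \<Rightarrow> real" where
  "weight w \<Gamma> H G N = (\<Sum>p | p \<in> gamma_epi \<Gamma> G H \<and> N \<subseteq> kernel G H p.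
     w (mob (gmaximal \<Gamma> G (kernel G H p)) (kernel G H p) N))"

lemma finite_gamma_epi:
  assumes "finite (carrier G)" "finite (carrier H)"
  shows "finite (gamma_epi \<Gamma> G H)"
proof (rule finite_subset)
  show "gamma_epi \<Gamma> G H \<subseteq> carrier G \<rightarrow>\<^sub>E carrier H"
    by (auto simp: gamma_epi_def epi_def PiE_def)
qed (use assms in \<open>auto intro!: finite_PiE\<close>)

lemma kernel_compose:
  assumes "f \<in> gamma_epi \<Gamma> G L" 
  shows "kernel G H (compose (carrier G) p f) = {x \<in> carrier G. f x \<in> kernel L H p}"
  using assms by (auto simp: kernel_def compose_eq gamma_epi_def epi_def)

lemma compose_epi_inj:
  assumes "f \<in> gamma_epi \<Gamma> G L" "p \<in> extensional (carrier L)" "p' \<in> extensional (carrier L)"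
    and eq: "compose (carrier G) p f = compose (carrier G) p' f"
  shows "p = p'"
proof (rule extensionalityI[OF assms(2,3)])
  fix y assume "y \<in> carrier L"
  then have "y \<in> f ` carrier G" using assms(1) by (simp add: gamma_epi_def epi_def)
  then obtain x where "x \<in> carrier G" "f x = y" by blast
  then show "p y = p' y" using fun_cong[OF eq, of x] by (simp add: compose_eq)
qed

text \<open>The surjections onto \<open>H\<close> that kill the kernel of \<open>f\<close> are the
  composites of \<open>f\<close> with surjections from \<open>L\<close>, and
  \<open>mob_preim\<close> matches the summands. This is the invariance that
  \<open>sum_gnormal_eq\<close> asks of \<open>\<phi>\<close>.\<close>

lemma weight_kernel:
  assumes G: "is_gamma_group \<Gamma> G" "is_gamma_group \<Gamma> L" "is_gamma_group \<Gamma> H"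
    and f: "f \<in> gamma_epi \<Gamma> G L"
  shows "weight w \<Gamma> H G (kernel G L f) = weight w \<Gamma> H L {\<one>\<^bsub>L\<^esub>}"
proof -
  interpret f: gamma_epimorphism \<Gamma> G L f by unfold_locales (use G f in auto)
  have epi: "gamma_epimorphism \<Gamma> L H p" if "p \<in> gamma_epi \<Gamma> L H" for p
    by unfold_locales (use G that in auto)
  have "{p. p \<in> gamma_epi \<Gamma> G H \<and> kernel G L f \<subseteq> kernel G H p} =
    (\<lambda>p. compose (carrier G) p f) ` gamma_epi \<Gamma> L H" (is "?A = ?B")
  proof (intro equalityI subsetI)
    fix p assume "p \<in> ?A"
    then show "p \<in> ?B" using gamma_epi_factor[OF G f] by blast
  next
    fix p assume "p \<in> ?B"
    then obtain r where r: "r \<in> gamma_epi \<Gamma> L H" "p = compose (carrier G) r f" by blast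
    have "p \<in> gamma_epi \<Gamma> G H" unfolding r(2) by (rule gamma_epi_compose[OF f r(1) G(1)])
    moreover have "kernel G L f \<subseteq> kernel G H p"
      unfolding r(2) kernel_compose[OF f]
      using f.kernel_subset_preim gamma_epimorphism.kernel_gnormal[OF epi[OF r(1)]] by blast
    ultimately show "p \<in> ?A" by blast
  qed
  then have "weight w \<Gamma> H G (kernel G L f) = (\<Sum>p\<in>(\<lambda>p. compose (carrier G) p f) ` gamma_epi \<Gamma> L H.
     w (mob (gmaximal \<Gamma> G (kernel G H p)) (kernel G H p) (kernel G L f)))"
    by (simp add: weight_def)
  also have "\<dots> = (\<Sum>p\<in>gamma_epi \<Gamma> L H. w (mob (gmaximal \<Gamma> L (kernel L H p)) (kernel L H p) {\<one>\<^bsub>L\<^esub>}))"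
  proof (subst sum.reindex)
    show "inj_on (\<lambda>p. compose (carrier G) p f) (gamma_epi \<Gamma> L H)"
      using compose_epi_inj[OF f] by (auto simp: inj_on_def gamma_epi_def)
    show "sum ((\<lambda>p. w (mob (gmaximal \<Gamma> G (kernel G H p)) (kernel G H p) (kernel G L f))) \<circ>
        (\<lambda>p. compose (carrier G) p f)) (gamma_epi \<Gamma> L H) =
      (\<Sum>p\<in>gamma_epi \<Gamma> L H. w (mob (gmaximal \<Gamma> L (kernel L H p)) (kernel L H p) {\<one>\<^bsub>L\<^esub>}))"
      using f.mob_preim[OF gamma_epimorphism.kernel_gnormal[OF epi]]
      by (intro sum.cong) (auto simp: kernel_compose[OF f])
  qed
  also have "\<dots> = weight w \<Gamma> H L {\<one>\<^bsub>L\<^esub>}"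
    unfolding weight_def
  proof (rule sum.cong)
    show "gamma_epi \<Gamma> L H = {p \<in> gamma_epi \<Gamma> L H. {\<one>\<^bsub>L\<^esub>} \<subseteq> kernel L H p}"
      using gnormalD(2)[OF G(2) gamma_epimorphism.kernel_gnormal[OF epi]] by blast
  qed simp
  finally show ?thesis .
qed

section \<open>Sums over normal subgroups as combinations of surjection counts\<close>

lemma gnormal_card:
  assumes "is_gamma_group \<Gamma> G" "finite (carrier G)" "N \<in> gnormal \<Gamma> G"
  shows "0 < card N" "card N dvd card (carrier G)"
proof -
  show "0 < card N"
    using gnormalD(1,2)[OF assms(1,3)] assms(2) by (metis card_gt_0_iff empty_iff finite_subset)
  interpret gamma_epimorphism \<Gamma> G "gamma_quotient G N" "\<lambda>x\<in>carrier G. N #>\<^bsub>G\<^esub> x"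
    by unfold_locales (use quotient_gamma_epi[OF assms(1,3)] assms in auto)
  show "card N dvd card (carrier G)"
    using card_carrier[OF assms(2)] quotient_gamma_epi(2)[OF assms(1,3)] by simp
qed

text \<open>Every quotient of order \<open>k\<close> is counted \<open>k!\<close> times by the \<open>\<Gamma>\<close>-group structures on
  \<open>{..<k}\<close>, so a sum over normal subgroups of an invariant of the quotient is a linear combination of
  surjection counts.\<close>

lemma sum_gnormal_eq:
  fixes G :: "(nat, 'g) gamma_group"
  assumes G: "is_gamma_group \<Gamma> G" "finite (carrier G)" and fin: "finite (carrier \<Gamma>)" "finite I"
    and inv: "\<And>L k f. L \<in> models \<Gamma> k \<Longrightarrow> f \<in> gamma_epi \<Gamma> G L \<Longrightarrow> \<phi> (kernel G L f) = c L"
  shows "(\<Sum>N | N \<in> gnormal \<Gamma> G \<and> card (carrier G) div card N \<in> I. \<phi> N) =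
    (\<Sum>k\<in>I. \<Sum>L\<in>models \<Gamma> k. c L / fact k * real (card (gamma_epi \<Gamma> G L)))"
proof -
  define A where "A k = {N \<in> gnormal \<Gamma> G. card (carrier G) = k * card N}" for k
  have finG: "finite (gnormal \<Gamma> G)" by (rule finite_gnormal) (fact G)+
  have Ak: "A k = {N \<in> gnormal \<Gamma> G. card (carrier G) div card N = k}" for k
    unfolding A_def using gnormal_card[OF G] by (intro Collect_cong conj_cong refl) auto
  have inner: "(\<Sum>N\<in>A k. \<phi> N) = (\<Sum>L\<in>models \<Gamma> k. c L / fact k * real (card (gamma_epi \<Gamma> G L)))" for k
  proof -
    define B where "B = (SIGMA L:models \<Gamma> k. gamma_epi \<Gamma> G L)"
    have finL: "finite (gamma_epi \<Gamma> G L)" if "L \<in> models \<Gamma> k" for L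
      using that G by (intro finite_gamma_epi) (auto simp: models_def)
    have finB: "finite B" unfolding B_def using finL finite_models[OF fin(1)] by auto
    have kerA: "kernel G L f \<in> A k" if "(L, f) \<in> B" for L f
    proof -
      have L: "is_gamma_group \<Gamma> L" "carrier L = {..<k}" "f \<in> gamma_epi \<Gamma> G L"
        using that by (auto simp: B_def models_def)
      interpret gamma_epimorphism \<Gamma> G L f by unfold_locales (use L G in auto)
      show ?thesis using kernel_gnormal card_carrier[OF G(2)] L by (simp add: A_def)
    qed
    have "(\<Sum>L\<in>models \<Gamma> k. c L / fact k * real (card (gamma_epi \<Gamma> G L))) =
      (\<Sum>L\<in>models \<Gamma> k. \<Sum>f\<in>gamma_epi \<Gamma> G L. \<phi> (kernel G L f) / fact k)"
      by (rule sum.cong) (auto simp: inv mult.commute)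
    also have "\<dots> = (\<Sum>p\<in>B. \<phi> (kernel G (fst p) (snd p)) / fact k)"
      unfolding B_def using finL finite_models[OF fin(1)] by (subst sum.Sigma) (auto simp: case_prod_beta)
    also have "\<dots> = (\<Sum>N\<in>A k. \<Sum>p | p \<in> B \<and> kernel G (fst p) (snd p) = N. \<phi> (kernel G (fst p) (snd p)) / fact k)"
      by (rule sum.group[symmetric]) (use finB finG kerA in \<open>auto simp: A_def\<close>)
    also have "\<dots> = (\<Sum>N\<in>A k. \<phi> N)"
    proof (rule sum.cong[OF refl])
      fix N assume N: "N \<in> A k"
      have "{p. p \<in> B \<and> kernel G (fst p) (snd p) = N} =
        {(L, f). L \<in> models \<Gamma> k \<and> f \<in> gamma_epi \<Gamma> G L \<and> kernel G L f = N}"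
        by (auto simp: B_def)
      also have "card \<dots> = fact k" by (rule card_models_gamma_epi[OF G]) (use N in \<open>auto simp: A_def\<close>)
      finally show "(\<Sum>p | p \<in> B \<and> kernel G (fst p) (snd p) = N. \<phi> (kernel G (fst p) (snd p)) / fact k) = \<phi> N"
        by simp
    qed
    finally show ?thesis by simp
  qed
  have "{N. N \<in> gnormal \<Gamma> G \<and> card (carrier G) div card N \<in> I} = (\<Union>k\<in>I. A k)"
    by (auto simp: Ak)
  then have "(\<Sum>N | N \<in> gnormal \<Gamma> G \<and> card (carrier G) div card N \<in> I. \<phi> N) = (\<Sum>N\<in>(\<Union>k\<in>I. A k). \<phi> N)"
    by simp
  also have "\<dots> = (\<Sum>k\<in>I. \<Sum>N\<in>A k. \<phi> N)"
    by (rule sum.UNION_disjoint) (use fin finG in \<open>auto simp: Ak\<close>)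
  finally show ?thesis by (simp add: inner)
qed


section \<open>Index bounds and the truncation error\<close>

lemma (in gamma_epimorphism) card_le_Int_kernel:
  assumes "finite (carrier G)" "N \<in> gnormal \<Gamma> G" "f ` N \<subseteq> B" "finite B"
  shows "card N \<le> card B * card (N \<inter> kernel G H f)"
proof -
  note N = gnormalD[OF source assms(2)]
  have finN: "finite N" using N(1) assms(1) finite_subset by blast
  have c: "x \<in> carrier G" if "x \<in> N" for x using N(1) that by (rule subsetD)
  have fib: "card {x \<in> N. f x = y} \<le> card (N \<inter> kernel G H f)" for y
  proof (cases "\<exists>a\<in>N. f a = y")
    case True
    then obtain a where a: "a \<in> N" "f a = y" by blast
    show ?thesis
    proof (rule card_inj_on_le)
      show "inj_on (\<lambda>x. inv\<^bsub>G\<^esub> a \<otimes>\<^bsub>G\<^esub> x) {x \<in> N. f x = y}"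
        using c a by (auto simp: inj_on_def)
      show "(\<lambda>x. inv\<^bsub>G\<^esub> a \<otimes>\<^bsub>G\<^esub> x) ` {x \<in> N. f x = y} \<subseteq> N \<inter> kernel G H f"
        using c a N(3,4) by (auto simp: kernel_def)
    qed (use finN in auto)
  next
    case False
    then have *: "{x \<in> N. f x = y} = {}" by auto
    show ?thesis unfolding * by simp
  qed
  have "N = (\<Union>y\<in>B. {x \<in> N. f x = y})" using assms(3) by auto
  then have "card N \<le> (\<Sum>y\<in>B. card {x \<in> N. f x = y})"
    using card_UN_le[OF assms(4), of "\<lambda>y. {x \<in> N. f x = y}"] by simp
  also have "\<dots> \<le> (\<Sum>y\<in>B. card (N \<inter> kernel G H f))" by (rule sum_mono) (rule fib)
  finally show ?thesis by simp
qed

text \<open>With K the kernel of \<open>p\<close>, the quotient K/\<open>a\<close> is a minimal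
  invariant normal subgroup of \<open>G\<close>/\<open>a\<close> of index
  \<open>card (carrier H)\<close>, so its order is at most \<open>s\<close>. It also contains a copy
  of N/(N \<inter> \<open>a\<close>), which gives the second bound.\<close>

lemma gmaximal_chief_bound:
  fixes G :: "(nat, 'g) gamma_group"
  assumes G: "is_gamma_group \<Gamma> G" "finite (carrier G)" "level \<Gamma> \<C> G"
    and C: "finite \<C>" "\<And>F. F \<in> \<C> \<Longrightarrow> finite_gamma_group \<Gamma> F" and fin: "finite (carrier \<Gamma>)"
    and H: "is_gamma_group \<Gamma> H" "p \<in> gamma_epi \<Gamma> G H" and a: "a \<in> gmaximal \<Gamma> G (kernel G H p)"
  defines "s \<equiv> chief_bound \<Gamma> \<C> (card (carrier H))"
  shows "card (carrier G) div card a \<le> card (carrier H) * s"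
    and "\<And>N. N \<in> gnormal \<Gamma> G \<Longrightarrow> N \<subseteq> kernel G H p \<Longrightarrow> card N \<le> s * card (N \<inter> a)"
proof -
  interpret p: gamma_epimorphism \<Gamma> G H p by unfold_locales (use G H in auto)
  define K where "K = kernel G H p"
  have K: "K \<in> gnormal \<Gamma> G" unfolding K_def by (rule p.kernel_gnormal)
  have a: "a \<in> gnormal \<Gamma> G" "a \<subset> K"
    and max: "\<And>L. L \<in> gnormal \<Gamma> G \<Longrightarrow> a \<subseteq> L \<Longrightarrow> L \<subseteq> K \<Longrightarrow> L = a \<or> L = K"
    using a by (auto simp: gmaximal_def K_def)
  note ca = gnormal_card[OF G(1,2) a(1)]
  obtain k where k: "card (carrier G) = k * card a" using ca(2) by (metis dvdE mult.commute)
  obtain L f where L: "L \<in> models \<Gamma> k" and f: "f \<in> gamma_epi \<Gamma> G L" "kernel G L f = a"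
    using ex_model_gamma_epi[OF G(1,2) a(1) k] by metis
  have Lg: "is_gamma_group \<Gamma> L" "finite (carrier L)" using L by (auto simp: models_def)
  interpret f: gamma_epimorphism \<Gamma> G L f by unfold_locales (use G Lg f in auto)
  define V where "V = f ` K"
  have V: "V \<in> gnormal \<Gamma> L" unfolding V_def by (rule f.image_gnormal[OF K])
  have VK: "f.preim V = K" unfolding V_def by (rule f.preimage_image[OF K]) (use f a in auto)
  have V1: "f.preim {\<one>\<^bsub>L\<^esub>} = a" using f(2) by (simp add: kernel_def)
  then have Vne: "V \<noteq> {\<one>\<^bsub>L\<^esub>}" using VK a(2) by auto
  note sub = gnormalD(1)[OF Lg(1)]
  have min: "M = {\<one>\<^bsub>L\<^esub>} \<or> M = V" if M: "M \<in> gnormal \<Gamma> L" "M \<subseteq> V" for M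
  proof -
    have "f.preim M = a \<or> f.preim M = K"
    proof (rule max)
      show "f.preim M \<in> gnormal \<Gamma> G" by (rule f.preimage_gnormal[OF M(1)])
      show "a \<subseteq> f.preim M" using f.kernel_subset_preim[OF M(1)] f(2) by simp
      show "f.preim M \<subseteq> K" unfolding VK[symmetric] using M(2) by auto
    qed
    then have "f.preim M = f.preim {\<one>\<^bsub>L\<^esub>} \<or> f.preim M = f.preim V" unfolding VK V1 .
    then show ?thesis
      using f.preim_eq_iff[OF sub[OF M(1)], of "{\<one>\<^bsub>L\<^esub>}"] f.preim_eq_iff[OF sub[OF M(1)] sub[OF V]]
      by simp
  qed
  have "card K = card V * card a"
    using f.card_preimage[OF G(2) sub[OF V]] VK f(2) by simp
  moreover have "k * card a = card (carrier H) * card K"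
    using p.card_carrier[OF G(2)] k by (simp add: K_def)
  ultimately have "k * card a = (card (carrier H) * card V) * card a" by (simp only: mult.assoc)
  then have kV: "k = card (carrier H) * card V" using ca(1) by simp
  have "level \<Gamma> \<C> L"
    by (rule level_gamma_epi[OF G(1,3) _ Lg(1) f(1)]) (use C in \<open>auto simp: finite_gamma_group_def\<close>)
  then have Vs: "card V \<le> s"
    unfolding s_def
    by (rule card_minimal_gnormal_le[OF Lg _ C fin V Vne min])
      (use kV L in \<open>auto simp: models_def\<close>)
  show "card (carrier G) div card a \<le> card (carrier H) * s"
    using k ca(1) kV Vs by simp
  fix N assume N: "N \<in> gnormal \<Gamma> G" "N \<subseteq> kernel G H p"
  have "card N \<le> card V * card (N \<inter> a)"
    using f.card_le_Int_kernel[OF G(2) N(1), of V] N(2) finite_subset[OF sub[OF V] Lg(2)] f(2)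
    by (auto simp: V_def K_def)
  also have "\<dots> \<le> s * card (N \<inter> a)" using Vs by simp
  finally show "card N \<le> s * card (N \<inter> a)" .
qed

text \<open>Each further intersection costs at most a factor \<open>s\<close>.\<close>

lemma flat_card_bound:
  assumes s: "\<And>a N. a \<in> \<M> \<Longrightarrow> N \<in> \<F> \<Longrightarrow> card N \<le> s * card (N \<inter> a)"
    and F: "\<And>S. S \<subseteq> \<M> \<Longrightarrow> K \<inter> \<Inter>S \<in> \<F>" and l: "set l \<subseteq> \<M>"
  shows "card K \<le> s ^ length l * card (K \<inter> \<Inter>(set l))"
  using l
proof (induction l rule: rev_induct)
  case (snoc a l)
  then have "card K \<le> s ^ length l * card (K \<inter> \<Inter>(set l))" by simp
  also have "\<dots> \<le> s ^ length l * (s * card (K \<inter> \<Inter>(set l) \<inter> a))"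
    using s[of a "K \<inter> \<Inter>(set l)"] F[of "set l"] snoc.prems by (intro mult_le_mono2) auto
  also have "K \<inter> \<Inter>(set l) \<inter> a = K \<inter> \<Inter>(set (l @ [a]))" by auto
  finally show ?case by (simp add: ac_simps)
qed simp

text \<open>For trivial \<open>K\<close> the sum is the single term 1, which the cutoff admits
  because \<open>card (carrier H) \<le> Q\<close>. Otherwise the terms that survive cancellation
  have index at most \<open>Q\<close>, while intersecting with \<open>a\<close> lifts the index
  above \<open>Q\<close>; since this multiplies it by at most \<open>s\<close>, they lie in the
  window. For the second bound, the intersection of a list \<open>l\<close> has index at most |H|
  s^(length l), so it can only reach the window if \<open>l\<close> is long.\<close>

lemma truncated_mob_sum:
  fixes G :: "(nat, 'g) gamma_group"
  assumes G: "is_gamma_group \<Gamma> G" "finite (carrier G)"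
    and H: "is_gamma_group \<Gamma> H" "p \<in> gamma_epi \<Gamma> G H"
    and Q: "card (carrier H) \<le> Q"
  defines "K \<equiv> kernel G H p"
  defines "\<M> \<equiv> gmaximal \<Gamma> G K"
  defines "\<F> \<equiv> {N \<in> gnormal \<Gamma> G. N \<subseteq> K}"
  assumes s: "\<And>a N. a \<in> \<M> \<Longrightarrow> N \<in> \<F> \<Longrightarrow> card N \<le> s * card (N \<inter> a)"
  shows "\<bar>(\<Sum>N | N \<in> \<F> \<and> card (carrier G) div card N \<in> {..Q}. mob \<M> K N) - of_bool (K = {\<one>\<^bsub>G\<^esub>})\<bar> \<le>
    (\<Sum>N | N \<in> \<F> \<and> card (carrier G) div card N \<in> {k. k \<le> Q \<and> Q < k * s}. \<bar>mob \<M> K N\<bar>)"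
    and "(\<Sum>N | N \<in> \<F> \<and> card (carrier G) div card N \<in> {k. k \<le> Q \<and> Q < k * s}. \<bar>mob \<M> K N\<bar>) \<le>
    (\<Sum>l | l \<in> indeps \<M> K \<and> Q < card (carrier H) * s ^ Suc (length l). 1 / fact (length l))"
proof -
  interpret p: gamma_epimorphism \<Gamma> G H p by unfold_locales (use G H in auto)
  have K: "K \<in> gnormal \<Gamma> G" unfolding K_def by (rule p.kernel_gnormal)
  have finM: "finite \<M>" unfolding \<M>_def by (rule finite_gmaximal) fact+
  have finF: "finite \<F>" unfolding \<F>_def using finite_gnormal[OF G(2,1)] by simp
  have flat: "K \<inter> \<Inter>S \<in> \<F>" if "S \<subseteq> \<M>" for S
    using Int_Inter_gnormal[OF G(1) K, of S] that by (auto simp: \<F>_def \<M>_def gmaximal_def)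
  have cK: "card (carrier G) = card (carrier H) * card K"
    unfolding K_def by (rule p.card_carrier[OF G(2)])
  have finK: "finite K" using gnormalD(1)[OF G(1) K] G(2) finite_subset by blast
  have proper: "\<not> K \<subseteq> a" if "a \<in> \<M>" for a using that by (auto simp: \<M>_def gmaximal_def)
  define i where "i N = card (carrier G) div card N" for N :: "nat set"
  have iN: "card (carrier G) = i N * card N" "0 < card N" if "N \<in> \<F>" for N
    using gnormal_card[OF G, of N] that by (auto simp: i_def \<F>_def)
  define J where "J = {k. k \<le> Q \<and> Q < k * s}"
  \<comment> \<open>Multiplying out avoids the truncating division. Admitting infinite sets, whose
    \<open>card\<close> is 0, makes \<open>P\<close> monotone on all sets.\<close>
  define P where "P N \<longleftrightarrow> infinite N \<or> card (carrier G) \<le> Q * card N" for N :: "nat set"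
  have finN: "finite N" if "N \<in> \<F>" for N using that finK finite_subset by (auto simp: \<F>_def)
  have P: "P N \<longleftrightarrow> i N \<le> Q" if "N \<in> \<F>" for N
    using iN[OF that] finN[OF that] by (simp add: P_def)
  have sum_P: "(\<Sum>N | N \<in> \<F> \<and> i N \<in> {..Q}. mob \<M> K N) = (\<Sum>N | N \<in> \<F> \<and> P N. mob \<M> K N)"
    by (rule sum.cong) (auto simp: P)
  show "\<bar>(\<Sum>N | N \<in> \<F> \<and> card (carrier G) div card N \<in> {..Q}. mob \<M> K N) - of_bool (K = {\<one>\<^bsub>G\<^esub>})\<bar> \<le>
    (\<Sum>N | N \<in> \<F> \<and> card (carrier G) div card N \<in> {k. k \<le> Q \<and> Q < k * s}. \<bar>mob \<M> K N\<bar>)"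
    unfolding i_def[symmetric] J_def[symmetric] sum_P
  proof (cases "K = {\<one>\<^bsub>G\<^esub>}")
    case True
    have F: "\<F> = {K}"
      using gnormalD(2)[OF G(1)] K True by (auto simp: \<F>_def)
    have "\<M> = {}" using gmaximal_trivial[OF G(1)] True by (simp add: \<M>_def)
    then have "mob \<M> K K = 1" by (intro mob_top) auto
    moreover have "P K" using cK Q by (simp add: P_def)
    then have "{N. N \<in> \<F> \<and> P N} = {K}" by (auto simp: F)
    ultimately have "(\<Sum>N | N \<in> \<F> \<and> P N. mob \<M> K N) = 1" by simp
    then show "\<bar>(\<Sum>N | N \<in> \<F> \<and> P N. mob \<M> K N) - of_bool (K = {\<one>\<^bsub>G\<^esub>})\<bar> \<le>
      (\<Sum>N | N \<in> \<F> \<and> i N \<in> J. \<bar>mob \<M> K N\<bar>)"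
      using True by (auto intro: sum_nonneg)
  next
    case False
    then obtain a where a: "a \<in> \<M>" using gmaximal_nonempty[OF G K] by (auto simp: \<M>_def)
    have "(\<Sum>N | N \<in> \<F> \<and> P N. mob \<M> K N) = (\<Sum>N | N \<in> \<F> \<and> P N \<and> \<not> P (N \<inter> a). mob \<M> K N)"
    proof (rule sum_truncated_mob[OF finM finF flat a])
      fix N N' :: "nat set" assume *: "N \<subseteq> N'" "P N"
      show "P N'"
      proof (cases "finite N'")
        case True
        then have "card N \<le> card N'" "finite N" using * by (auto intro: card_mono finite_subset)
        then show ?thesis using *(2) by (auto simp: P_def intro: le_trans mult_le_mono2)
      qed (simp add: P_def)
    qed
    then have "\<bar>\<Sum>N | N \<in> \<F> \<and> P N. mob \<M> K N\<bar> \<le> (\<Sum>N | N \<in> \<F> \<and> P N \<and> \<not> P (N \<inter> a). \<bar>mob \<M> K N\<bar>)"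
      by simp
    also have "\<dots> \<le> (\<Sum>N | N \<in> \<F> \<and> i N \<in> J. \<bar>mob \<M> K N\<bar>)"
    proof (rule sum_mono2)
      show "{N. N \<in> \<F> \<and> P N \<and> \<not> P (N \<inter> a)} \<subseteq> {N. N \<in> \<F> \<and> i N \<in> J}"
      proof safe
        fix N assume N: "N \<in> \<F>" "P N" "\<not> P (N \<inter> a)"
        have "Q * card (N \<inter> a) < i N * card N" using N(3) iN[OF N(1)] by (simp add: P_def)
        also have "\<dots> \<le> i N * (s * card (N \<inter> a))" using s[OF a N(1)] by simp
        finally have "Q * card (N \<inter> a) < (i N * s) * card (N \<inter> a)" by (simp only: mult.assoc)
        then show "i N \<in> J" using P[OF N(1)] N(2) by (simp add: J_def)
      qed
    qed (use finF in auto)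
    finally show "\<bar>(\<Sum>N | N \<in> \<F> \<and> P N. mob \<M> K N) - of_bool (K = {\<one>\<^bsub>G\<^esub>})\<bar> \<le>
      (\<Sum>N | N \<in> \<F> \<and> i N \<in> J. \<bar>mob \<M> K N\<bar>)" using False by simp
  qed
  define B where "B N = {l \<in> indeps \<M> K. K \<inter> \<Inter>(set l) = N}" for N
  have finI: "finite (indeps \<M> K)" by (rule finite_indeps[OF finM])
  have "(\<Sum>N | N \<in> \<F> \<and> i N \<in> J. \<bar>mob \<M> K N\<bar>) \<le> (\<Sum>N | N \<in> \<F> \<and> i N \<in> J. \<Sum>l\<in>B N. 1 / fact (length l))"
    unfolding B_def by (rule sum_mono, rule mob_le_sum_indeps[OF finM finK proper])
  also have "\<dots> = (\<Sum>l\<in>(\<Union>N\<in>{N. N \<in> \<F> \<and> i N \<in> J}. B N). 1 / fact (length l))"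
    by (rule sum.UNION_disjoint[symmetric]) (use finF finI in \<open>auto simp: B_def\<close>)
  also have "\<dots> \<le> (\<Sum>l | l \<in> indeps \<M> K \<and> Q < card (carrier H) * s ^ Suc (length l). 1 / fact (length l))"
  proof (rule sum_mono2)
    show "(\<Union>N\<in>{N. N \<in> \<F> \<and> i N \<in> J}. B N) \<subseteq>
      {l. l \<in> indeps \<M> K \<and> Q < card (carrier H) * s ^ Suc (length l)}"
    proof safe
      fix N l assume N: "N \<in> \<F>" "i N \<in> J" and l: "l \<in> B N"
      show "l \<in> indeps \<M> K" using l by (simp add: B_def)
      have "set l \<subseteq> \<M>" "K \<inter> \<Inter>(set l) = N" using l by (auto simp: B_def indeps_def)
      then have "card K \<le> s ^ length l * card N"
        using flat_card_bound[of \<M> \<F> s K l] s flat by auto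
      then have "i N * card N \<le> card (carrier H) * (s ^ length l * card N)"
        using cK iN[OF N(1)] by simp
      then have "i N * card N \<le> (card (carrier H) * s ^ length l) * card N" by (simp only: mult.assoc)
      then have "i N \<le> card (carrier H) * s ^ length l" using iN[OF N(1)] by simp
      then have "i N * s \<le> card (carrier H) * s ^ length l * s" by (rule mult_le_mono1)
      moreover have "Q < i N * s" using N(2) by (simp add: J_def)
      ultimately have "Q < card (carrier H) * s ^ length l * s" by (rule order.strict_trans2[rotated])
      then show "Q < card (carrier H) * s ^ Suc (length l)" by (simp only: power_Suc ac_simps)
    qed
  qed (use finI in auto)
  finally show "(\<Sum>N | N \<in> \<F> \<and> card (carrier G) div card N \<in> {k. k \<le> Q \<and> Q < k * s}. \<bar>mob \<M> K N\<bar>) \<le>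
    (\<Sum>l | l \<in> indeps \<M> K \<and> Q < card (carrier H) * s ^ Suc (length l). 1 / fact (length l))"
    by (simp only: i_def J_def)
qed


section \<open>Fibre products\<close>

text \<open>The common image in \<open>H\<close> is not stored but read off from coordinate 0. For
  the empty list the result is the trivial group and not \<open>H\<close>, so the counting below
  keeps to nonempty lists.\<close>

definition fibre_product ::
  "('b, 'g) gamma_group \<Rightarrow> ((nat, 'g) gamma_group \<times> (nat \<Rightarrow> 'b)) list \<Rightarrow> (nat \<Rightarrow> nat, 'g) gamma_group" where
  "fibre_product H r = gamma_subgroup (gamma_product {..<length r} (\<lambda>i. fst (r ! i)))
     {x \<in> (\<Pi>\<^sub>E i\<in>{..<length r}. carrier (fst (r ! i))). \<exists>y\<in>carrier H. \<forall>i<length r. snd (r ! i) (x i) = y}"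

lemma carrier_fibre_product:
  "carrier (fibre_product H r) =
    {x \<in> (\<Pi>\<^sub>E i\<in>{..<length r}. carrier (fst (r ! i))). \<exists>y\<in>carrier H. \<forall>i<length r. snd (r ! i) (x i) = y}"
  by (simp add: fibre_product_def)

lemma is_gamma_group_fibre_product:
  assumes H: "is_gamma_group \<Gamma> H"
    and r: "\<And>i. i < length r \<Longrightarrow> is_gamma_group \<Gamma> (fst (r ! i))"
      "\<And>i. i < length r \<Longrightarrow> snd (r ! i) \<in> gamma_epi \<Gamma> (fst (r ! i)) H"
  shows "is_gamma_group \<Gamma> (fibre_product H r)"
proof -
  define P where "P = gamma_product {..<length r} (\<lambda>i. fst (r ! i))"
  have P: "is_gamma_group \<Gamma> P"
    unfolding P_def using is_gamma_group_group(1)[OF H] r(1) by (intro is_gamma_group_product) auto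
  interpret P: group P using is_gamma_group_group[OF P] by simp
  interpret H: group H using is_gamma_group_group[OF H] by simp
  have h: "gamma_epimorphism \<Gamma> (fst (r ! i)) H (snd (r ! i))" if "i < length r" for i
    by unfold_locales (use H r that in auto)
  have comp: "group_hom P H (\<lambda>x. snd (r ! i) (x i))" if "i < length r" for i
  proof -
    interpret h: gamma_epimorphism \<Gamma> "fst (r ! i)" H "snd (r ! i)" by (rule h[OF that])
    show ?thesis using that by unfold_locales (auto simp: hom_def P_def PiE_iff)
  qed
  define D where "D = {x \<in> carrier P. \<exists>y\<in>carrier H. \<forall>i<length r. snd (r ! i) (x i) = y}"
  have "subgroup D P"
  proof
    show "D \<subseteq> carrier P" by (auto simp: D_def)
    show "\<one>\<^bsub>P\<^esub> \<in> D"
      using group_hom.hom_one[OF comp] by (auto simp: D_def intro!: bexI[of _ "\<one>\<^bsub>H\<^esub>"])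
  next
    fix x x' assume "x \<in> D" "x' \<in> D"
    then obtain y y' where *: "x \<in> carrier P" "x' \<in> carrier P" "y \<in> carrier H" "y' \<in> carrier H"
      "\<And>i. i < length r \<Longrightarrow> snd (r ! i) (x i) = y" "\<And>i. i < length r \<Longrightarrow> snd (r ! i) (x' i) = y'"
      by (auto simp: D_def)
    have "snd (r ! i) ((x \<otimes>\<^bsub>P\<^esub> x') i) = y \<otimes>\<^bsub>H\<^esub> y'" if "i < length r" for i
      using group_hom.hom_mult[OF comp[OF that] *(1,2)] *(5,6)[OF that] by simp
    then show "x \<otimes>\<^bsub>P\<^esub> x' \<in> D" using * unfolding D_def by blast
  next
    fix x assume "x \<in> D"
    then obtain y where *: "x \<in> carrier P" "y \<in> carrier H"
      "\<And>i. i < length r \<Longrightarrow> snd (r ! i) (x i) = y"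
      by (auto simp: D_def)
    have "snd (r ! i) ((inv\<^bsub>P\<^esub> x) i) = inv\<^bsub>H\<^esub> y" if "i < length r" for i
      using group_hom.hom_inv[OF comp[OF that] *(1)] *(3)[OF that] by simp
    then show "inv\<^bsub>P\<^esub> x \<in> D" using * unfolding D_def by blast
  qed
  moreover have "gamma_invariant \<Gamma> P D"
    unfolding gamma_invariant_def
  proof (intro ballI image_subsetI)
    fix \<gamma> x assume g: "\<gamma> \<in> carrier \<Gamma>" and "x \<in> D"
    then obtain y where *: "x \<in> carrier P" "y \<in> carrier H"
      "\<And>i. i < length r \<Longrightarrow> snd (r ! i) (x i) = y"
      by (auto simp: D_def)
    have "snd (r ! i) (act P \<gamma> x i) = act H \<gamma> y" if i: "i < length r" for i
      using * i gamma_epimorphism.f_act[OF h[OF i] g, of "x i"] by (auto simp: P_def)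
    then show "act P \<gamma> x \<in> D"
      using *(2) act_closed[OF H g] act_closed[OF P g *(1)] unfolding D_def by blast
  qed
  ultimately have "is_gamma_group \<Gamma> (gamma_subgroup P D)" by (rule is_gamma_group_subgroup[OF P])
  moreover have "gamma_subgroup P D = fibre_product H r"
    by (simp add: fibre_product_def D_def P_def)
  ultimately show ?thesis by simp
qed

text \<open>\<open>f\<close> collects the quotient maps by the entries of \<open>l\<close>.
  Independence and maximality make it surjective, as in Goursat's lemma. The last two equations
  recover \<open>p\<close> and \<open>l\<close> from \<open>r\<close> and \<open>f\<close>, so that
  independent lists can be counted by surjections.\<close>

lemma indep_fibre_product:
  fixes G :: "(nat, 'g) gamma_group" and H :: "(nat, 'g) gamma_group"
  assumes G: "is_gamma_group \<Gamma> G" "finite (carrier G)"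
    and H: "is_gamma_group \<Gamma> H" "p \<in> gamma_epi \<Gamma> G H"
  defines "K \<equiv> kernel G H p"
  assumes l: "l \<in> indeps (gmaximal \<Gamma> G K) K" "l \<noteq> []"
    and B: "\<And>a. a \<in> gmaximal \<Gamma> G K \<Longrightarrow> card (carrier G) div card a \<le> B"
  shows "\<exists>r f. length r = length l \<and> set r \<subseteq> (SIGMA L:(\<Union>k\<le>B. models \<Gamma> k). gamma_epi \<Gamma> L H) \<and>
    f \<in> gamma_epi \<Gamma> G (fibre_product H r) \<and>
    p = (\<lambda>x\<in>carrier G. snd (r ! 0) (f x 0)) \<and>
    l = map (\<lambda>i. {x \<in> carrier G. f x i = \<one>\<^bsub>fst (r ! i)\<^esub>}) [0..<length r]"
proof -
  interpret p: gamma_epimorphism \<Gamma> G H p by unfold_locales (use G H in auto)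
  have K: "K \<in> gnormal \<Gamma> G" unfolding K_def by (rule p.kernel_gnormal)
  define m where "m = length l"
  have lm: "l ! i \<in> gmaximal \<Gamma> G K" if "i < m" for i
    using l(1) that nth_mem[of i l] by (auto simp: indeps_def m_def)
  have "\<exists>q f. fst q \<in> (\<Union>k\<le>B. models \<Gamma> k) \<and> f \<in> gamma_epi \<Gamma> G (fst q) \<and> kernel G (fst q) f = l ! i \<and>
      snd q \<in> gamma_epi \<Gamma> (fst q) H \<and> p = compose (carrier G) (snd q) f" if i: "i < m" for i
  proof -
    have a: "l ! i \<in> gnormal \<Gamma> G" "l ! i \<subseteq> K" using lm[OF i] by (auto simp: gmaximal_def)
    note ca = gnormal_card[OF G a(1)]
    define k where "k = card (carrier G) div card (l ! i)"
    have k: "card (carrier G) = k * card (l ! i)" using ca by (simp add: k_def)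
    obtain L f where L: "L \<in> models \<Gamma> k" and f: "f \<in> gamma_epi \<Gamma> G L" "kernel G L f = l ! i"
      using ex_model_gamma_epi[OF G a(1) k] by metis
    have Lg: "is_gamma_group \<Gamma> L" using L by (simp add: models_def)
    obtain \<rho> where \<rho>: "\<rho> \<in> gamma_epi \<Gamma> L H" "p = compose (carrier G) \<rho> f"
      using gamma_epi_factor[OF G(1) Lg H(1) f(1) H(2)] f(2) a(2) by (auto simp: K_def)
    have "k \<le> B" using B[OF lm[OF i]] by (simp add: k_def)
    then show ?thesis using L f \<rho> by (intro exI[of _ "(L, \<rho>)"] exI[of _ f]) auto
  qed
  then obtain q g where qg: "\<And>i. i < m \<Longrightarrow> fst (q i) \<in> (\<Union>k\<le>B. models \<Gamma> k)"
    "\<And>i. i < m \<Longrightarrow> g i \<in> gamma_epi \<Gamma> G (fst (q i))" "\<And>i. i < m \<Longrightarrow> kernel G (fst (q i)) (g i) = l ! i"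
    "\<And>i. i < m \<Longrightarrow> snd (q i) \<in> gamma_epi \<Gamma> (fst (q i)) H"
    "\<And>i. i < m \<Longrightarrow> p = compose (carrier G) (snd (q i)) (g i)"
    by metis
  have qm: "is_gamma_group \<Gamma> (fst (q i))" if "i < m" for i using qg(1)[OF that] by (auto simp: models_def)
  define r where "r = map q [0..<m]"
  have r: "length r = m" "\<And>i. i < m \<Longrightarrow> r ! i = q i" by (auto simp: r_def)
  define f where "f = (\<lambda>x\<in>carrier G. \<lambda>i\<in>{..<m}. g i x)"
  have gi: "gamma_epimorphism \<Gamma> G (fst (q i)) (g i)" if "i < m" for i
    by unfold_locales (use G that qm qg in auto)
  have gc: "g i x \<in> carrier (fst (q i))" if "i < m" "x \<in> carrier G" for i x
    using gamma_epimorphism.f_image[OF gi[OF that(1)]] that(2) by blast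
  have gp: "snd (q i) (g i x) = p x" if "i < m" "x \<in> carrier G" for i x
    using fun_cong[OF qg(5)[OF that(1)], of x] that(2) by (simp add: compose_eq)
  have FP: "carrier (fibre_product H r) =
    {x \<in> (\<Pi>\<^sub>E i\<in>{..<m}. carrier (fst (q i))). \<exists>y\<in>carrier H. \<forall>i<m. snd (q i) (x i) = y}"
    unfolding carrier_fibre_product r(1) by (intro Collect_cong conj_cong) (auto simp: r PiE_iff)
  have fc: "f x \<in> carrier (fibre_product H r)" if "x \<in> carrier G" for x
    unfolding FP using that gc gp p.hom_closed[OF that] by (auto simp: f_def)
  \<comment> \<open>Coordinates are matched one at a time: an element that is correct below
    \<open>j\<close> is multiplied by a suitable element of \<open>N\<close>, which is trivial in
    the earlier coordinates and in \<open>H\<close>.\<close>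
  have surj: "\<exists>x\<in>carrier G. p x = y \<and> (\<forall>i<j. g i x = z i)"
    if z: "z \<in> (\<Pi>\<^sub>E i\<in>{..<m}. carrier (fst (q i)))" "y \<in> carrier H" "\<forall>i<m. snd (q i) (z i) = y"
      and j: "j \<le> m" for z y j
    using j
  proof (induction j)
    case 0
    then show ?case using p.f_surj[OF z(2)] by simp
  next
    case (Suc j)
    then have j: "j < m" by simp
    obtain x where x: "x \<in> carrier G" "p x = y" "\<And>i. i < j \<Longrightarrow> g i x = z i" using Suc by auto
    interpret gj: gamma_epimorphism \<Gamma> G "fst (q j)" "g j" by (rule gi[OF j])
    have zj: "z j \<in> carrier (fst (q j))" using z j by auto
    define N where "N = K \<inter> \<Inter>(set (take j l))"
    have N: "N \<in> gnormal \<Gamma> G"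
      unfolding N_def
      by (rule Int_Inter_gnormal[OF G(1) K])
        (use l in \<open>auto simp: indeps_def gmaximal_def dest!: in_set_takeD\<close>)
    have nN: "\<not> N \<subseteq> l ! j" using l(1) j by (auto simp: indeps_def indep_def N_def m_def)
    \<comment> \<open>This is the product of \<open>N\<close> and \<open>l ! j\<close>. It lies
      between \<open>l ! j\<close> and \<open>K\<close>, and it contains \<open>N\<close> whereas
      \<open>l ! j\<close> does not, so maximality of \<open>l ! j\<close> yields
      \<open>L = K\<close>.\<close>
    define L where "L = gj.preim (g j ` N)"
    have "L \<in> gnormal \<Gamma> G" unfolding L_def by (rule gj.preimage_gnormal[OF gj.image_gnormal[OF N]])
    moreover have "l ! j \<subseteq> L"
      unfolding L_def using gj.kernel_subset_preim[OF gj.image_gnormal[OF N]] qg(3)[OF j] by simp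
    moreover have "L \<subseteq> K"
    proof
      fix a assume "a \<in> L"
      then obtain n where n: "a \<in> carrier G" "n \<in> N" "g j a = g j n" by (auto simp: L_def)
      then have nK: "n \<in> K" "n \<in> carrier G" using gnormalD(1)[OF G(1) N] by (auto simp: N_def)
      have "p a = p n" using gp[OF j n(1)] gp[OF j nK(2)] n(3) by simp
      then show "a \<in> K" using n nK by (simp add: K_def kernel_def)
    qed
    ultimately have "L = l ! j \<or> L = K" using lm[OF j] by (auto simp: gmaximal_def)
    moreover have "N \<subseteq> L" using gnormalD(1)[OF G(1) N] by (auto simp: L_def)
    ultimately have LK: "L = K" using nN by auto
    obtain b where b: "b \<in> carrier G" "g j b = z j" using gj.f_surj[OF zj] by blast
    have "p b = y" using gp[OF j b(1)] b(2) z(3) j by simp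
    then have "inv\<^bsub>G\<^esub> x \<otimes>\<^bsub>G\<^esub> b \<in> L" unfolding LK K_def using x b p.f_eq_iff[of x b] by simp
    then obtain n where n: "n \<in> N" "g j (inv\<^bsub>G\<^esub> x \<otimes>\<^bsub>G\<^esub> b) = g j n" by (auto simp: L_def)
    have nc: "n \<in> carrier G" using n(1) gnormalD(1)[OF G(1) N] by blast
    have nK: "p n = \<one>\<^bsub>H\<^esub>" using n(1) by (auto simp: N_def K_def kernel_def)
    show ?case
    proof (intro bexI conjI allI impI)
      show "x \<otimes>\<^bsub>G\<^esub> n \<in> carrier G" using x nc by simp
      show "p (x \<otimes>\<^bsub>G\<^esub> n) = y" using x nc nK z(2) by simp
      fix i assume i: "i < Suc j"
      show "g i (x \<otimes>\<^bsub>G\<^esub> n) = z i"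
      proof (cases "i = j")
        case True
        have "g j n = inv\<^bsub>fst (q j)\<^esub> (g j x) \<otimes>\<^bsub>fst (q j)\<^esub> z j" using n(2) b x by simp
        then have "g j (x \<otimes>\<^bsub>G\<^esub> n) = z j" using x nc zj by (simp add: gj.H.m_assoc[symmetric])
        then show ?thesis using True by simp
      next
        case False
        then have i: "i < j" "i < m" using i j by auto
        interpret gi: gamma_epimorphism \<Gamma> G "fst (q i)" "g i" by (rule gi[OF i(2)])
        have "l ! i \<in> set (take j l)" using i j by (auto simp: in_set_conv_nth m_def intro!: exI[of _ i])
        then have "n \<in> l ! i" using n(1) by (auto simp: N_def)
        then have "g i n = \<one>\<^bsub>fst (q i)\<^esub>" using qg(3)[OF i(2)] by (auto simp: kernel_def)
        moreover have "z i \<in> carrier (fst (q i))" using z(1) i by auto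
        ultimately show ?thesis using x nc i by simp
      qed
    qed
  qed
  have "f ` carrier G = carrier (fibre_product H r)"
  proof (intro equalityI subsetI)
    fix z assume "z \<in> carrier (fibre_product H r)"
    then obtain y where z: "z \<in> (\<Pi>\<^sub>E i\<in>{..<m}. carrier (fst (q i)))" "y \<in> carrier H"
      "\<forall>i<m. snd (q i) (z i) = y" unfolding FP by blast
    obtain x where x: "x \<in> carrier G" "\<forall>i<m. g i x = z i" using surj[OF z order_refl] by blast
    then have "f x = z"
      using z(1) by (intro extensionalityI[of "f x" "{..<m}" z]) (auto simp: f_def PiE_iff)
    then show "z \<in> f ` carrier G" using x(1) by blast
  qed (use fc in auto)
  moreover have "f \<in> hom G (fibre_product H r)"
  proof (rule homI)
    fix x y assume xy: "x \<in> carrier G" "y \<in> carrier G"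
    have "g i (x \<otimes>\<^bsub>G\<^esub> y) = g i x \<otimes>\<^bsub>fst (q i)\<^esub> g i y" if "i < m" for i
      using qg(2)[OF that] xy by (simp add: gamma_epi_def epi_def hom_mult)
    then show "f (x \<otimes>\<^bsub>G\<^esub> y) = f x \<otimes>\<^bsub>fibre_product H r\<^esub> f y"
      using xy by (auto simp: fibre_product_def f_def r intro!: restrict_ext)
  qed (rule fc)
  moreover have "equivariant \<Gamma> G (fibre_product H r) f"
    unfolding equivariant_def
  proof (intro ballI)
    fix \<gamma> x assume *: "\<gamma> \<in> carrier \<Gamma>" "x \<in> carrier G"
    have "f x \<in> carrier (fibre_product H r)" by (rule fc[OF *(2)])
    then have "act (fibre_product H r) \<gamma> (f x) = (\<lambda>i\<in>{..<m}. act (fst (q i)) \<gamma> (f x i))"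
      by (auto simp: fibre_product_def r intro!: restrict_ext)
    also have "\<dots> = f (act G \<gamma> x)"
      using * act_closed[OF G(1) *] gamma_epimorphism.f_act[OF gi *]
      by (auto simp: f_def intro!: restrict_ext)
    finally show "f (act G \<gamma> x) = act (fibre_product H r) \<gamma> (f x)" by simp
  qed
  ultimately have "f \<in> gamma_epi \<Gamma> G (fibre_product H r)"
    by (simp add: gamma_epi_def epi_def f_def)
  moreover have "p = (\<lambda>x\<in>carrier G. snd (r ! 0) (f x 0))"
    using l(2) by (intro extensionalityI[OF p.f_ext]) (auto simp: f_def r gp m_def)
  moreover have "l = map (\<lambda>i. {x \<in> carrier G. f x i = \<one>\<^bsub>fst (r ! i)\<^esub>}) [0..<length r]"
    by (rule nth_equalityI) (use qg(3) in \<open>auto simp: r f_def kernel_def simp flip: m_def\<close>)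
  moreover have "set r \<subseteq> (SIGMA L:(\<Union>k\<le>B. models \<Gamma> k). gamma_epi \<Gamma> L H)"
  proof
    fix t assume "t \<in> set r"
    then obtain i where i: "i < m" "t = q i" by (auto simp: r_def)
    show "t \<in> (SIGMA L:(\<Union>k\<le>B. models \<Gamma> k). gamma_epi \<Gamma> L H)"
      unfolding i(2) mem_Sigma_iff[of "fst (q i)" "snd (q i)", unfolded prod.collapse]
      using qg(1,4)[OF i(1)] by blast
  qed
  ultimately show ?thesis using r(1) m_def by blast
qed

text \<open>By \<open>indep_fibre_product\<close> the map \<open>\<Phi>\<close> reaches every pair
  of a surjection and an independent list. The index set \<open>R\<close> depends on
  \<open>B\<close>, \<open>H\<close> and \<open>m\<close> but not on \<open>G\<close>, so the
  right-hand side uses the same finite set of targets for all \<open>G\<close>.\<close>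

lemma sum_indeps_le:
  fixes G :: "(nat, 'g) gamma_group" and H :: "(nat, 'g) gamma_group"
  assumes G: "is_gamma_group \<Gamma> G" "finite (carrier G)"
    and H: "is_gamma_group \<Gamma> H" "finite (carrier H)" and fin: "finite (carrier \<Gamma>)"
    and B: "\<And>p a. p \<in> gamma_epi \<Gamma> G H \<Longrightarrow> a \<in> gmaximal \<Gamma> G (kernel G H p) \<Longrightarrow>
      card (carrier G) div card a \<le> B"
    and m: "0 < m"
  defines "R \<equiv> {r. set r \<subseteq> (SIGMA L:(\<Union>k\<le>B. models \<Gamma> k). gamma_epi \<Gamma> L H) \<and> length r = m}"
  shows "(\<Sum>p\<in>gamma_epi \<Gamma> G H. card {l \<in> indeps (gmaximal \<Gamma> G (kernel G H p)) (kernel G H p). length l = m}) \<le>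
    (\<Sum>r\<in>R. card (gamma_epi \<Gamma> G (fibre_product H r)))"
proof -
  let ?I = "\<lambda>p. {l \<in> indeps (gmaximal \<Gamma> G (kernel G H p)) (kernel G H p). length l = m}"
  define A where "A = (SIGMA p:gamma_epi \<Gamma> G H. ?I p)"
  define D where "D = (SIGMA r:R. gamma_epi \<Gamma> G (fibre_product H r))"
  have finM: "finite (\<Union>k\<le>B. models \<Gamma> k)" using finite_models[OF fin] by simp
  have "finite (SIGMA L:(\<Union>k\<le>B. models \<Gamma> k). gamma_epi \<Gamma> L H)"
    by (rule finite_SigmaI[OF finM], rule finite_gamma_epi) (use H in \<open>auto simp: models_def\<close>)
  then have finR: "finite R" unfolding R_def by (rule finite_lists_length_eq)
  have finD': "finite (gamma_epi \<Gamma> G (fibre_product H r))" if "r \<in> R" for r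
  proof (rule finite_gamma_epi[OF G(2)])
    have "finite (\<Pi>\<^sub>E i\<in>{..<length r}. carrier (fst (r ! i)))"
    proof (rule finite_PiE)
      fix i assume "i \<in> {..<length r}"
      then have "r ! i \<in> (SIGMA L:(\<Union>k\<le>B. models \<Gamma> k). gamma_epi \<Gamma> L H)"
        using that by (auto simp: R_def dest: nth_mem)
      then show "finite (carrier (fst (r ! i)))" by (auto simp: models_def)
    qed simp
    then show "finite (carrier (fibre_product H r))"
      unfolding carrier_fibre_product by (rule rev_finite_subset) auto
  qed
  have finA: "finite (?I p)" for p
    using finite_indeps[OF finite_gmaximal[OF G]] by simp
  define \<Phi> where "\<Phi> d = ((\<lambda>x\<in>carrier G. snd (fst d ! 0) (snd d x 0)),
    map (\<lambda>i. {x \<in> carrier G. snd d x i = \<one>\<^bsub>fst (fst d ! i)\<^esub>}) [0..<length (fst d)])"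
    for d :: "((nat, 'g) gamma_group \<times> (nat \<Rightarrow> nat)) list \<times> (nat \<Rightarrow> nat \<Rightarrow> nat)"
  have "A \<subseteq> \<Phi> ` D"
  proof
    fix a assume "a \<in> A"
    then obtain p l where a: "a = (p, l)" "p \<in> gamma_epi \<Gamma> G H" "l \<in> ?I p" by (auto simp: A_def)
    then have l: "l \<in> indeps (gmaximal \<Gamma> G (kernel G H p)) (kernel G H p)" "l \<noteq> []" "length l = m"
      using m by auto
    obtain r f where rf: "length r = length l" "set r \<subseteq> (SIGMA L:(\<Union>k\<le>B. models \<Gamma> k). gamma_epi \<Gamma> L H)"
      "f \<in> gamma_epi \<Gamma> G (fibre_product H r)"
      "p = (\<lambda>x\<in>carrier G. snd (r ! 0) (f x 0))"
      "l = map (\<lambda>i. {x \<in> carrier G. f x i = \<one>\<^bsub>fst (r ! i)\<^esub>}) [0..<length r]"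
      using indep_fibre_product[OF G H(1) a(2) l(1,2) B[OF a(2)]] by blast
    then have "(r, f) \<in> D" using l(3) by (simp add: D_def R_def)
    moreover have "a = \<Phi> (r, f)" using rf(4,5) a(1) by (simp add: \<Phi>_def)
    ultimately show "a \<in> \<Phi> ` D" by blast
  qed
  moreover have "finite D" unfolding D_def using finR finD' by blast
  ultimately have "card A \<le> card D" by (meson card_image_le card_mono finite_imageI le_trans)
  moreover have "card A = (\<Sum>p\<in>gamma_epi \<Gamma> G H. card (?I p))"
    unfolding A_def using finite_gamma_epi[OF G(2) H(2)] finA by (subst card_SigmaI) auto
  moreover have "card D = (\<Sum>r\<in>R. card (gamma_epi \<Gamma> G (fibre_product H r)))"
    unfolding D_def using finR finD' by (subst card_SigmaI) auto
  ultimately show ?thesis by simp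
qed


section \<open>Convergence of integrals\<close>

text \<open>Integrability under \<open>\<mu>t t\<close> is asked only for large \<open>t\<close>: a
  finite limit of the integrals does not prevent finitely many of them from being infinite.\<close>

definition converges :: "(nat \<Rightarrow> 'a measure) \<Rightarrow> 'a measure \<Rightarrow> ('a \<Rightarrow> real) \<Rightarrow> bool" where
  "converges \<mu>t \<mu> u \<longleftrightarrow> (\<forall>\<^sub>F t in sequentially. integrable (\<mu>t t) u) \<and> integrable \<mu> u \<and>
     (\<lambda>t. integral\<^sup>L (\<mu>t t) u) \<longlonglongrightarrow> integral\<^sup>L \<mu> u"

lemma converges_cong:
  assumes "\<And>t. space (\<mu>t t) = space \<mu>" "\<And>x. x \<in> space \<mu> \<Longrightarrow> u x = v x"
  shows "converges \<mu>t \<mu> u \<longleftrightarrow> converges \<mu>t \<mu> v"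
proof -
  have "integrable (\<mu>t t) u \<longleftrightarrow> integrable (\<mu>t t) v" "integral\<^sup>L (\<mu>t t) u = integral\<^sup>L (\<mu>t t) v" for t
    using assms by (auto intro!: Bochner_Integration.integrable_cong Bochner_Integration.integral_cong)
  moreover have "integrable \<mu> u \<longleftrightarrow> integrable \<mu> v" "integral\<^sup>L \<mu> u = integral\<^sup>L \<mu> v"
    using assms by (auto intro!: Bochner_Integration.integrable_cong Bochner_Integration.integral_cong)
  ultimately show ?thesis by (simp add: converges_def)
qed

lemma converges_zero: "converges \<mu>t \<mu> (\<lambda>x. 0)"
  by (simp add: converges_def)

lemma converges_mult: "converges \<mu>t \<mu> u \<Longrightarrow> converges \<mu>t \<mu> (\<lambda>x. c * u x)"
  by (auto simp: converges_def intro: tendsto_mult_left elim: eventually_mono)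

lemma converges_sum:
  assumes "finite A" "\<And>a. a \<in> A \<Longrightarrow> converges \<mu>t \<mu> (u a)"
  shows "converges \<mu>t \<mu> (\<lambda>x. \<Sum>a\<in>A. u a x)"
  unfolding converges_def
proof (intro conjI)
  have ev: "\<forall>\<^sub>F t in sequentially. \<forall>a\<in>A. integrable (\<mu>t t) (u a)"
    using assms by (intro eventually_ball_finite) (auto simp: converges_def)
  then show "\<forall>\<^sub>F t in sequentially. integrable (\<mu>t t) (\<lambda>x. \<Sum>a\<in>A. u a x)"
    by (rule eventually_mono) auto
  show "integrable \<mu> (\<lambda>x. \<Sum>a\<in>A. u a x)" using assms by (auto simp: converges_def)
  have "(\<lambda>t. \<Sum>a\<in>A. integral\<^sup>L (\<mu>t t) (u a)) \<longlonglongrightarrow> (\<Sum>a\<in>A. integral\<^sup>L \<mu> (u a))"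
    using assms by (intro tendsto_sum) (auto simp: converges_def)
  moreover have "(\<Sum>a\<in>A. integral\<^sup>L \<mu> (u a)) = integral\<^sup>L \<mu> (\<lambda>x. \<Sum>a\<in>A. u a x)"
    using assms by (subst Bochner_Integration.integral_sum) (auto simp: converges_def)
  moreover have "\<forall>\<^sub>F t in sequentially.
      (\<Sum>a\<in>A. integral\<^sup>L (\<mu>t t) (u a)) = integral\<^sup>L (\<mu>t t) (\<lambda>x. \<Sum>a\<in>A. u a x)"
    using ev by (rule eventually_mono) (subst Bochner_Integration.integral_sum, auto)
  ultimately show "(\<lambda>t. integral\<^sup>L (\<mu>t t) (\<lambda>x. \<Sum>a\<in>A. u a x)) \<longlonglongrightarrow> integral\<^sup>L \<mu> (\<lambda>x. \<Sum>a\<in>A. u a x)"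
    by (simp add: tendsto_cong)
qed

text \<open>Replacing \<open>g\<close> by \<open>u\<close> costs at most the integral of
  \<open>v\<close>, both under \<open>\<mu>\<close> and under \<open>\<mu>t t\<close>. The latter is
  small for large \<open>t\<close> because \<open>v\<close> itself converges, so smallness has to be
  known under \<open>\<mu>\<close> only.\<close>

lemma converges_sandwich:
  assumes sp: "\<And>t. space (\<mu>t t) = space \<mu>"
    and meas: "g \<in> borel_measurable \<mu>" "\<And>t. g \<in> borel_measurable (\<mu>t t)"
    and approx: "\<And>e. 0 < e \<Longrightarrow> \<exists>u v. converges \<mu>t \<mu> u \<and> converges \<mu>t \<mu> v \<and>
      (\<forall>x\<in>space \<mu>. \<bar>g x - u x\<bar> \<le> v x) \<and> integral\<^sup>L \<mu> v < e"
  shows "converges \<mu>t \<mu> g"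
proof -
  have bound: "integrable M g \<and> \<bar>integral\<^sup>L M g - integral\<^sup>L M u\<bar> \<le> integral\<^sup>L M v"
    if M: "g \<in> borel_measurable M" "space M = space \<mu>" and "integrable M u" "integrable M v"
      and le: "\<forall>x\<in>space \<mu>. \<bar>g x - u x\<bar> \<le> v x" for M u v
  proof -
    have "integrable M (\<lambda>x. v x + \<bar>u x\<bar>)" using that by auto
    then have g: "integrable M g"
      by (rule Bochner_Integration.integrable_bound) (use that in \<open>force intro!: AE_I2\<close>)+
    have "\<bar>integral\<^sup>L M g - integral\<^sup>L M u\<bar> = \<bar>LINT x|M. g x - u x\<bar>" using g that by simp
    also have "\<dots> \<le> (LINT x|M. \<bar>g x - u x\<bar>)" by (rule integral_abs_bound)
    also have "\<dots> \<le> integral\<^sup>L M v" using g that by (intro integral_mono) auto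
    finally show ?thesis using g by simp
  qed
  have g: "integrable \<mu> g" using approx[of 1] bound[OF meas(1)] by (auto simp: converges_def)
  have "\<forall>\<^sub>F t in sequentially. integrable (\<mu>t t) g"
  proof -
    obtain u v where *: "converges \<mu>t \<mu> u" "converges \<mu>t \<mu> v" "\<forall>x\<in>space \<mu>. \<bar>g x - u x\<bar> \<le> v x"
      using approx[of 1] by auto
    then have "\<forall>\<^sub>F t in sequentially. integrable (\<mu>t t) u \<and> integrable (\<mu>t t) v"
      by (intro eventually_conj) (auto simp: converges_def)
    then show ?thesis by (rule eventually_mono) (use bound[OF meas(2) sp] *(3) in blast)
  qed
  moreover have "(\<lambda>t. integral\<^sup>L (\<mu>t t) g) \<longlonglongrightarrow> integral\<^sup>L \<mu> g"
  proof (rule tendstoI)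
    fix e :: real assume e: "0 < e"
    define d where "d = e / 4"
    have d: "0 < d" "e = 4 * d" using e by (auto simp: d_def)
    obtain u v where *: "converges \<mu>t \<mu> u" "converges \<mu>t \<mu> v" "\<forall>x\<in>space \<mu>. \<bar>g x - u x\<bar> \<le> v x"
      and v: "integral\<^sup>L \<mu> v < d"
      using approx[OF d(1)] by auto
    have "\<forall>\<^sub>F t in sequentially. integral\<^sup>L (\<mu>t t) v < d"
      using *(2) v by (intro order_tendstoD(2)[of _ "integral\<^sup>L \<mu> v"]) (auto simp: converges_def)
    moreover have "\<forall>\<^sub>F t in sequentially. dist (integral\<^sup>L (\<mu>t t) u) (integral\<^sup>L \<mu> u) < d"
      using *(1) d by (intro tendstoD) (auto simp: converges_def)
    moreover have "\<forall>\<^sub>F t in sequentially. integrable (\<mu>t t) u" "\<forall>\<^sub>F t in sequentially. integrable (\<mu>t t) v"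
      using * by (auto simp: converges_def)
    ultimately show "\<forall>\<^sub>F t in sequentially. dist (integral\<^sup>L (\<mu>t t) g) (integral\<^sup>L \<mu> g) < e"
    proof eventually_elim
      case (elim t)
      have "\<bar>integral\<^sup>L (\<mu>t t) g - integral\<^sup>L (\<mu>t t) u\<bar> \<le> integral\<^sup>L (\<mu>t t) v"
        using bound[OF meas(2) sp] elim *(3) by blast
      moreover have "\<bar>integral\<^sup>L \<mu> g - integral\<^sup>L \<mu> u\<bar> \<le> integral\<^sup>L \<mu> v"
        using bound[OF meas(1) refl] * by (auto simp: converges_def)
      ultimately show ?case using elim v unfolding dist_real_def d(2) by linarith
    qed
  qed
  ultimately show ?thesis using g by (simp add: converges_def)
qed

lemma converges_nonneg:
  assumes "\<And>x. 0 \<le> u x" "u \<in> borel_measurable \<mu>" "\<And>t. u \<in> borel_measurable (\<mu>t t)"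
    and "(\<integral>\<^sup>+x. ennreal (u x) \<partial>\<mu>) < \<infinity>"
    and lim: "(\<lambda>t. \<integral>\<^sup>+x. ennreal (u x) \<partial>\<mu>t t) \<longlonglongrightarrow> (\<integral>\<^sup>+x. ennreal (u x) \<partial>\<mu>)"
  shows "converges \<mu>t \<mu> u"
proof -
  have ev: "\<forall>\<^sub>F t in sequentially. (\<integral>\<^sup>+x. ennreal (u x) \<partial>\<mu>t t) < \<infinity>"
    by (rule order_tendstoD(2)[OF lim assms(4)])
  then have "\<forall>\<^sub>F t in sequentially. integrable (\<mu>t t) u"
    by (rule eventually_mono) (use assms in \<open>auto intro!: integrableI_nonneg\<close>)
  moreover have "integrable \<mu> u" using assms by (auto intro!: integrableI_nonneg)
  moreover have "integral\<^sup>L M u = enn2real (\<integral>\<^sup>+x. ennreal (u x) \<partial>M)" if "u \<in> borel_measurable M" for M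
    by (rule integral_eq_nn_integral) (use that assms in auto)
  then have "integral\<^sup>L \<mu> u = enn2real (\<integral>\<^sup>+x. ennreal (u x) \<partial>\<mu>)"
    "\<And>t. integral\<^sup>L (\<mu>t t) u = enn2real (\<integral>\<^sup>+x. ennreal (u x) \<partial>\<mu>t t)" using assms by auto
  moreover have "(\<lambda>t. enn2real (\<integral>\<^sup>+x. ennreal (u x) \<partial>\<mu>t t)) \<longlonglongrightarrow> enn2real (\<integral>\<^sup>+x. ennreal (u x) \<partial>\<mu>)"
    by (rule tendsto_enn2real) (use lim assms(4) in \<open>auto simp: less_top\<close>)
  ultimately show ?thesis by (simp add: converges_def)
qed

text \<open>In the application \<open>A\<close> varies with the group. Sorting by length turns the
  sum into a series over a fixed index set, which can be integrated term by term.\<close>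

lemma sum_fact_le_suminf:
  assumes "finite A" "\<And>x. x \<in> A \<Longrightarrow> M \<le> len x"
  shows "ennreal (\<Sum>x\<in>A. 1 / fact (len x)) \<le>
    suminf (\<lambda>i. ennreal (1 / fact (i + M)) * of_nat (card {x \<in> A. len x = i + M}))"
proof -
  define I where "I = (\<lambda>x. len x - M) ` A"
  have fI: "finite I" using assms by (simp add: I_def)
  have "(\<Sum>x\<in>A. 1 / fact (len x)) = (\<Sum>i\<in>I. \<Sum>x | x \<in> A \<and> len x - M = i. 1 / fact (len x) :: real)"
    by (rule sum.group[symmetric]) (use assms fI in \<open>auto simp: I_def\<close>)
  also have "\<dots> = (\<Sum>i\<in>I. 1 / fact (i + M) * card {x \<in> A. len x = i + M})"
  proof (rule sum.cong[OF refl])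
    fix i
    have "{x. x \<in> A \<and> len x - M = i} = {x \<in> A. len x = i + M}" using assms(2) by force
    then show "(\<Sum>x | x \<in> A \<and> len x - M = i. 1 / fact (len x)) =
        (1 / fact (i + M) * card {x \<in> A. len x = i + M} :: real)"
      by simp
  qed
  finally have "ennreal (\<Sum>x\<in>A. 1 / fact (len x)) =
      (\<Sum>i\<in>I. ennreal (1 / fact (i + M) * card {x \<in> A. len x = i + M}))"
    by (simp add: sum_ennreal)
  also have "\<dots> = (\<Sum>i\<in>I. ennreal (1 / fact (i + M)) * of_nat (card {x \<in> A. len x = i + M}))"
    by (rule sum.cong[OF refl]) (subst ennreal_mult, auto simp: ennreal_of_nat_eq_real_of_nat)
  also have "\<dots> \<le> suminf (\<lambda>i. ennreal (1 / fact (i + M)) * of_nat (card {x \<in> A. len x = i + M}))"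
    by (rule sum_le_suminf) (use fI in auto)
  finally show ?thesis .
qed

text \<open>The moment hypotheses concern carriers of natural numbers, whereas elements of a fibre
  product are functions. \<open>L\<close> is an isomorphic copy of \<open>F\<close>, and composing
  with the isomorphism transfers the surjections.\<close>

lemma card_gamma_epi_model:
  assumes F: "is_gamma_group \<Gamma> F" "finite (carrier F)"
  obtains L where "L \<in> models \<Gamma> (card (carrier F))"
    "\<And>G :: ('c, 'g) gamma_group. is_gamma_group \<Gamma> G \<Longrightarrow> finite (carrier G) \<Longrightarrow>
      card (gamma_epi \<Gamma> G F) \<le> card (gamma_epi \<Gamma> G L)"
proof -
  obtain L f where L: "L \<in> models \<Gamma> (card (carrier F))" and f: "f \<in> gamma_epi \<Gamma> F L" "kernel F L f = {\<one>\<^bsub>F\<^esub>}"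
    using ex_model_gamma_epi[OF F one_gnormal[OF F(1)]] by force
  have Lg: "is_gamma_group \<Gamma> L" "finite (carrier L)" using L by (auto simp: models_def)
  interpret f: gamma_epimorphism \<Gamma> F L f by unfold_locales (use F Lg f in auto)
  have inj: "x = y" if "x \<in> carrier F" "y \<in> carrier F" "f x = f y" for x y
  proof -
    have "inv\<^bsub>F\<^esub> x \<otimes>\<^bsub>F\<^esub> y = \<one>\<^bsub>F\<^esub>" using that f.f_eq_iff[of x y] f(2) by simp
    from f.G.inv_equality[OF this] show ?thesis using that by (metis f.G.inv_closed f.G.inv_inv)
  qed
  have "card (gamma_epi \<Gamma> G F) \<le> card (gamma_epi \<Gamma> G L)"
    if G: "is_gamma_group \<Gamma> G" "finite (carrier G)" for G :: "('c, 'g) gamma_group"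
  proof (rule card_inj_on_le)
    show "(\<lambda>g. compose (carrier G) f g) ` gamma_epi \<Gamma> G F \<subseteq> gamma_epi \<Gamma> G L"
      using gamma_epi_compose[OF _ f(1) G(1)] by blast
    show "finite (gamma_epi \<Gamma> G L)" by (rule finite_gamma_epi) fact+
    show "inj_on (\<lambda>g. compose (carrier G) f g) (gamma_epi \<Gamma> G F)"
    proof (rule inj_onI)
      fix g g' assume g: "g \<in> gamma_epi \<Gamma> G F" "g' \<in> gamma_epi \<Gamma> G F"
        and eq: "compose (carrier G) f g = compose (carrier G) f g'"
      show "g = g'"
      proof (rule extensionalityI)
        fix x assume x: "x \<in> carrier G"
        have "g x \<in> carrier F" "g' x \<in> carrier F" using g x by (auto simp: gamma_epi_def epi_def)
        then show "g x = g' x" using fun_cong[OF eq, of x] x by (auto simp: compose_eq intro: inj)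
      qed (use g in \<open>auto simp: gamma_epi_def\<close>)
    qed
  qed
  then show ?thesis using that L by blast
qed


section \<open>Proof of the theorem\<close>

lemma sum_weight:
  assumes G: "is_gamma_group \<Gamma> G" "finite (carrier G)" and H: "finite (carrier H)"
  shows "(\<Sum>N | N \<in> gnormal \<Gamma> G \<and> card (carrier G) div card N \<in> I. weight w \<Gamma> H G N) =
    (\<Sum>p\<in>gamma_epi \<Gamma> G H. \<Sum>N | N \<in> {N \<in> gnormal \<Gamma> G. N \<subseteq> kernel G H p} \<and> card (carrier G) div card N \<in> I.
      w (mob (gmaximal \<Gamma> G (kernel G H p)) (kernel G H p) N))"
proof -
  define A where "A = {N \<in> gnormal \<Gamma> G. card (carrier G) div card N \<in> I}"
  have "finite A" using finite_gnormal[OF G(2,1)] by (simp add: A_def)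
  have "(\<Sum>N\<in>A. weight w \<Gamma> H G N) = (\<Sum>p\<in>gamma_epi \<Gamma> G H. \<Sum>N | N \<in> A \<and> N \<subseteq> kernel G H p.
      w (mob (gmaximal \<Gamma> G (kernel G H p)) (kernel G H p) N))"
    unfolding weight_def using sum.swap_restrict[OF \<open>finite A\<close> finite_gamma_epi[OF G(2) H]] by simp
  also have "\<dots> = (\<Sum>p\<in>gamma_epi \<Gamma> G H. \<Sum>N | N \<in> {N \<in> gnormal \<Gamma> G. N \<subseteq> kernel G H p} \<and> card (carrier G) div card N \<in> I.
      w (mob (gmaximal \<Gamma> G (kernel G H p)) (kernel G H p) N))"
    by (intro sum.cong refl) (auto simp: A_def)
  finally show ?thesis by (simp add: A_def)
qed

lemma level_groupsD:
  assumes "H \<in> level_groups \<Gamma> \<C>"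
  shows "is_gamma_group \<Gamma> H" "finite (carrier H)" "level \<Gamma> \<C> H" "0 < card (carrier H)"
proof -
  show *: "is_gamma_group \<Gamma> H" "finite (carrier H)" "level \<Gamma> \<C> H"
    using assms by (auto simp: level_groups_def finite_gamma_group_def)
  interpret group H using is_gamma_group_group[OF *(1)] by simp
  show "0 < card (carrier H)" using *(2) one_closed card_gt_0_iff by blast
qed

text \<open>\<open>truncated_mob_sum\<close> is summed over all surjections onto \<open>H\<close>.
  For this choice of \<open>Q\<close> the condition Q < |H| s^(n+1) means M \<le> n, as the powers
  of \<open>s\<close> are strictly increasing.\<close>

lemma level_groups_truncation:
  fixes M :: nat
  assumes fin: "finite (carrier \<Gamma>)" "finite \<C>" and C: "\<And>F. F \<in> \<C> \<Longrightarrow> finite_gamma_group \<Gamma> F"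
    and G: "G \<in> level_groups \<Gamma> \<C>" and H: "H \<in> level_groups \<Gamma> \<C>"
    and s: "2 \<le> s" "chief_bound \<Gamma> \<C> (card (carrier H)) \<le> s"
  defines "Q \<equiv> card (carrier H) * s ^ M"
  defines "T \<equiv> \<lambda>w I. \<Sum>N | N \<in> gnormal \<Gamma> G \<and> card (carrier G) div card N \<in> I. weight w \<Gamma> H G N"
  defines "J \<equiv> {k. k \<le> Q \<and> Q < k * s}"
  shows "\<bar>(\<Sum>p\<in>gamma_epi \<Gamma> G H. of_bool (kernel G H p = {\<one>\<^bsub>G\<^esub>})) - T (\<lambda>x. x) {..Q}\<bar> \<le> T abs J"
    and "T abs J \<le> (\<Sum>p\<in>gamma_epi \<Gamma> G H. \<Sum>l | l \<in> indeps (gmaximal \<Gamma> G (kernel G H p)) (kernel G H p) \<and> M \<le> length l.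
      1 / fact (length l))"
proof -
  note Gd = level_groupsD[OF G] and Hd = level_groupsD[OF H]
  have s': "card N \<le> s * card (N \<inter> a)" if "p \<in> gamma_epi \<Gamma> G H"
    "a \<in> gmaximal \<Gamma> G (kernel G H p)" "N \<in> {N \<in> gnormal \<Gamma> G. N \<subseteq> kernel G H p}" for p a N
  proof -
    have "card N \<le> chief_bound \<Gamma> \<C> (card (carrier H)) * card (N \<inter> a)"
      by (rule gmaximal_chief_bound(2)[OF Gd(1-3) fin(2) C fin(1) Hd(1)]) (use that in auto)
    also have "\<dots> \<le> s * card (N \<inter> a)" using s(2) by simp
    finally show ?thesis .
  qed
  have hQ: "card (carrier H) \<le> Q" unfolding Q_def using s(1) by simp
  note tr = truncated_mob_sum[OF Gd(1,2) Hd(1) _ hQ s']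
  have "\<bar>T (\<lambda>x. x) {..Q} - (\<Sum>p\<in>gamma_epi \<Gamma> G H. of_bool (kernel G H p = {\<one>\<^bsub>G\<^esub>}))\<bar> \<le> T abs J"
    unfolding T_def sum_weight[OF Gd(1,2) Hd(2)] sum_subtractf[symmetric]
    by (rule order.trans[OF sum_abs], rule sum_mono) (use tr(1) in \<open>simp add: J_def\<close>)
  then show "\<bar>(\<Sum>p\<in>gamma_epi \<Gamma> G H. of_bool (kernel G H p = {\<one>\<^bsub>G\<^esub>})) - T (\<lambda>x. x) {..Q}\<bar> \<le> T abs J"
    by (simp add: abs_minus_commute)
  have len: "Q < card (carrier H) * s ^ Suc n \<longleftrightarrow> M \<le> n" for n
    using Hd(4) s(1) by (auto simp: Q_def less_Suc_eq_le simp del: power_Suc)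
  show "T abs J \<le> (\<Sum>p\<in>gamma_epi \<Gamma> G H. \<Sum>l | l \<in> indeps (gmaximal \<Gamma> G (kernel G H p)) (kernel G H p) \<and> M \<le> length l.
      1 / fact (length l))"
    unfolding T_def sum_weight[OF Gd(1,2) Hd(2)]
    by (rule sum_mono) (use tr(2) in \<open>simp add: J_def len del: power_Suc\<close>)
qed

lemma level_classes_rep:
  assumes "S \<in> level_classes \<Gamma> \<C>"
  shows "(SOME G. G \<in> S) \<in> level_groups \<Gamma> \<C>" "iso_class \<Gamma> \<C> (SOME G. G \<in> S) = S"
proof -
  obtain G where G: "G \<in> level_groups \<Gamma> \<C>" "S = iso_rel \<Gamma> \<C> `` {G}"
    using assms unfolding level_classes_def by (rule quotientE)
  define G' where "G' = (SOME G. G \<in> S)"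
  have "G \<in> S" using equiv_class_self[OF equiv_iso_rel G(1)] G(2) by simp
  then have "G' \<in> S" unfolding G'_def by (rule someI)
  then have "(G, G') \<in> iso_rel \<Gamma> \<C>" using G by simp
  then show "(SOME G. G \<in> S) \<in> level_groups \<Gamma> \<C>" "iso_class \<Gamma> \<C> (SOME G. G \<in> S) = S"
    using equiv_class_eq[OF equiv_iso_rel, of G G'] G
    unfolding G'_def[symmetric] by (auto simp: iso_rel_def iso_class_def)
qed

text \<open>A surjection with trivial kernel is an isomorphism, so it exists only on the class of
  \<open>H\<close>. There all surjections have trivial kernel by comparison of orders, and they are
  as numerous as the automorphisms of \<open>H\<close>.\<close>

lemma sum_kernel_trivial:
  assumes S: "S \<in> level_classes \<Gamma> \<C>" and H: "H \<in> level_groups \<Gamma> \<C>"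
  defines "G \<equiv> SOME G. G \<in> S"
  shows "(\<Sum>p\<in>gamma_epi \<Gamma> G H. of_bool (kernel G H p = {\<one>\<^bsub>G\<^esub>})) =
    real (card (gamma_epi \<Gamma> H H)) * indicator {iso_class \<Gamma> \<C> H} S"
proof -
  note rep = level_classes_rep[OF S, folded G_def]
  note Gd = level_groupsD[OF rep(1)] and Hd = level_groupsD[OF H]
  show ?thesis
  proof (cases "S = iso_class \<Gamma> \<C> H")
    case True
    have "G \<in> iso_class \<Gamma> \<C> G"
      using equiv_class_self[OF equiv_iso_rel rep(1)] by (simp add: iso_class_def)
    then have "G \<in> iso_class \<Gamma> \<C> H" using True rep(2) by simp
    then have "(H, G) \<in> iso_rel \<Gamma> \<C>" by (simp add: iso_class_def)
    then obtain f where "f \<in> iso H G" by (auto simp: iso_rel_def gamma_isomorphic_def)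
    then have c: "card (carrier H) = card (carrier G)" by (auto simp: iso_def bij_betw_same_card)
    have "kernel G H p = {\<one>\<^bsub>G\<^esub>}" if p: "p \<in> gamma_epi \<Gamma> G H" for p
    proof -
      interpret gamma_epimorphism \<Gamma> G H p by unfold_locales (use Gd Hd p in auto)
      have "card (kernel G H p) = 1" using card_carrier[OF Gd(2)] c Hd(4) by simp
      then obtain a where "kernel G H p = {a}" by (rule card_1_singletonE)
      moreover have "\<one>\<^bsub>G\<^esub> \<in> kernel G H p" by (simp add: kernel_def)
      ultimately show ?thesis by simp
    qed
    then have "(\<Sum>p\<in>gamma_epi \<Gamma> G H. of_bool (kernel G H p = {\<one>\<^bsub>G\<^esub>})) = real (card (gamma_epi \<Gamma> G H))"
      by simp
    also have "card (gamma_epi \<Gamma> G H) = Sur \<Gamma> S H" by (simp add: Sur_def G_def)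
    also have "\<dots> = card (gamma_epi \<Gamma> H H)" unfolding True by (rule Sur_iso_class[OF H])
    finally show ?thesis using True by simp
  next
    case False
    have "kernel G H p \<noteq> {\<one>\<^bsub>G\<^esub>}" if p: "p \<in> gamma_epi \<Gamma> G H" for p
    proof
      assume ker: "kernel G H p = {\<one>\<^bsub>G\<^esub>}"
      interpret gamma_epimorphism \<Gamma> G H p by unfold_locales (use Gd Hd p in auto)
      have "inj_on p (carrier G)" using ker by (simp add: inj_iff_trivial_ker)
      then have "p \<in> iso G H" using f_image homh by (simp add: iso_def bij_betw_def)
      then have "gamma_isomorphic \<Gamma> G H" using p by (auto simp: gamma_isomorphic_def gamma_epi_def)
      then have "(G, H) \<in> iso_rel \<Gamma> \<C>" using rep(1) H by (simp add: iso_rel_def)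
      then have "iso_class \<Gamma> \<C> G = iso_class \<Gamma> \<C> H"
        unfolding iso_class_def by (rule equiv_class_eq[OF equiv_iso_rel])
      then show False using rep(2) False by simp
    qed
    then show ?thesis using False by simp
  qed
qed


theorem theorem1p2:
  fixes \<Gamma> :: "('g, 'm) monoid_scheme"
    and \<C> :: "('a, 'g) gamma_group set"
    and \<mu> :: "(nat, 'g) gamma_group set measure"
    and \<mu>t :: "nat \<Rightarrow> (nat, 'g) gamma_group set measure"
  assumes "group \<Gamma>" and "finite (carrier \<Gamma>)"
    and "finite \<C>" and "\<And>G. G \<in> \<C> \<Longrightarrow> finite_gamma_group \<Gamma> G"
    and "gcd (Coset.order \<Gamma>) (LCM G\<in>\<C>. Coset.order G) = 1"
    and "sets \<mu> = Pow (level_classes \<Gamma> \<C>)"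
    and "\<And>t. sets (\<mu>t t) = Pow (level_classes \<Gamma> \<C>)"
    and "\<And>H. H \<in> level_groups \<Gamma> \<C> \<Longrightarrow>
           (\<lambda>t. \<integral>\<^sup>+S. of_nat (Sur \<Gamma> S H) \<partial>\<mu>t t) \<longlonglongrightarrow> (\<integral>\<^sup>+S. of_nat (Sur \<Gamma> S H) \<partial>\<mu>)"
    and "\<exists>A B :: real. \<forall>H\<in>level_groups \<Gamma> \<C>.
           (\<integral>\<^sup>+S. of_nat (Sur \<Gamma> S H) \<partial>\<mu>) \<le> ennreal (A * real (Coset.order H) powr B)"
  shows "\<forall>H\<in>level_groups \<Gamma> \<C>.
           (\<lambda>t. emeasure (\<mu>t t) {iso_class \<Gamma> \<C> H}) \<longlonglongrightarrow> emeasure \<mu> {iso_class \<Gamma> \<C> H}"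
proof
  fix H assume H: "H \<in> level_groups \<Gamma> \<C>"
  note C = assms(4) and fin = assms(2,3)
  note Hd = level_groupsD[OF H]
  define \<Omega> where "\<Omega> = level_classes \<Gamma> \<C>"
  define rep where "rep S = (SOME G. G \<in> S)" for S :: "(nat, 'g) gamma_group set"
  have rep: "rep S \<in> level_groups \<Gamma> \<C>" if "S \<in> \<Omega>" for S
    using level_classes_rep(1) that by (simp add: rep_def \<Omega>_def)
  note rd = level_groupsD[OF rep]
  have Sur: "Sur \<Gamma> S L = card (gamma_epi \<Gamma> (rep S) L)" for S and L :: "('x, 'g) gamma_group"
    by (simp add: Sur_def rep_def)
  have space: "space \<mu> = \<Omega>" "space (\<mu>t t) = \<Omega>" for t
    using sets_eq_imp_space_eq[of _ "count_space \<Omega>"] assms(6,7) by (auto simp: \<Omega>_def)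
  have meas: "f \<in> measurable \<mu> N \<longleftrightarrow> f \<in> \<Omega> \<rightarrow> space N" "f \<in> measurable (\<mu>t t) N \<longleftrightarrow> f \<in> \<Omega> \<rightarrow> space N"
    for f t and N :: "'x measure"
    using measurable_cong_sets[of \<mu> "count_space \<Omega>" N N] measurable_cong_sets[of "\<mu>t t" "count_space \<Omega>" N N]
      assms(6,7) by (auto simp: \<Omega>_def)
  have Cg: "is_gamma_group \<Gamma> F" if "F \<in> \<C>" for F using C[OF that] by (simp add: finite_gamma_group_def)
  have model_level: "L \<in> level_groups \<Gamma> \<C>" if L: "L \<in> models \<Gamma> k" and S: "S \<in> \<Omega>"
    "gamma_epi \<Gamma> (rep S) L \<noteq> {}" for L k S
  proof -
    have "is_gamma_group \<Gamma> L" "finite (carrier L)" using L by (auto simp: models_def)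
    moreover obtain f where "f \<in> gamma_epi \<Gamma> (rep S) L" using S(2) by blast
    ultimately show ?thesis
      using level_gamma_epi[OF rd(1,3)[OF S(1)] Cg] by (auto simp: level_groups_def finite_gamma_group_def)
  qed
  obtain A0 B0 where moments: "(\<integral>\<^sup>+S. of_nat (Sur \<Gamma> S L) \<partial>\<mu>) \<le> ennreal (A0 * real (Coset.order L) powr B0)"
    if "L \<in> level_groups \<Gamma> \<C>" for L
    using assms(9) by blast
  \<comment> \<open>With nonnegative constants the bound is monotone in the order of the target, so
    upper bounds on the order can be inserted.\<close>
  define A B where "A = max A0 0" and "B = max B0 0"
  have conv_Sur: "converges \<mu>t \<mu> (\<lambda>S. real (card (gamma_epi \<Gamma> (rep S) L)))" if L: "L \<in> models \<Gamma> k" for L k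
  proof (cases "L \<in> level_groups \<Gamma> \<C>")
    case True
    have "(\<integral>\<^sup>+S. of_nat (Sur \<Gamma> S L) \<partial>\<mu>) < \<infinity>"
      using moments[OF True] by (simp add: order_le_less_trans)
    then show ?thesis
      using assms(8)[OF True]
      by (intro converges_nonneg) (auto simp: meas Sur simp flip: ennreal_of_nat_eq_real_of_nat)
  next
    case False
    then have "gamma_epi \<Gamma> (rep S) L = {}" if "S \<in> \<Omega>" for S using model_level[OF L that] by blast
    then show ?thesis
      using converges_cong[of \<mu>t \<mu> "\<lambda>S. real (card (gamma_epi \<Gamma> (rep S) L))" "\<lambda>_. 0"] converges_zero
      by (simp add: space)
  qed
  define T where "T S w I = (\<Sum>N | N \<in> gnormal \<Gamma> (rep S) \<and> card (carrier (rep S)) div card N \<in> I.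
    weight w \<Gamma> H (rep S) N)" for S w I
  \<comment> \<open>\<open>S\<close> enters only through surjection counts onto finitely many
    models; the coefficients are weights of the models themselves.\<close>
  have conv_T: "converges \<mu>t \<mu> (\<lambda>S. T S w I)" if I: "finite I" for w I
  proof -
    have "converges \<mu>t \<mu> (\<lambda>S. \<Sum>k\<in>I. \<Sum>L\<in>models \<Gamma> k.
        weight w \<Gamma> H L {\<one>\<^bsub>L\<^esub>} / fact k * real (card (gamma_epi \<Gamma> (rep S) L)))"
      by (intro converges_sum I finite_models fin converges_mult conv_Sur)
    moreover have "T S w I = (\<Sum>k\<in>I. \<Sum>L\<in>models \<Gamma> k.
        weight w \<Gamma> H L {\<one>\<^bsub>L\<^esub>} / fact k * real (card (gamma_epi \<Gamma> (rep S) L)))" if "S \<in> \<Omega>" for S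
      unfolding T_def
      by (rule sum_gnormal_eq[OF rd(1,2)[OF that] fin(1) I], rule weight_kernel[OF rd(1)[OF that] _ Hd(1)])
        (auto simp: models_def)
    ultimately show ?thesis
      using converges_cong[of \<mu>t \<mu> "\<lambda>S. T S w I"] by (simp add: space)
  qed
  define s where "s = max 2 (chief_bound \<Gamma> \<C> (card (carrier H)))"
  have s: "2 \<le> s" "chief_bound \<Gamma> \<C> (card (carrier H)) \<le> s" by (auto simp: s_def)
  \<comment> \<open>\<open>b\<close> bounds the order of every quotient by a maximal subgroup of a
    kernel. Hence \<open>U\<close> holds all possible factors of the fibre products, uniformly in
    the class \<open>S\<close>.\<close>
  define b where "b = card (carrier H) * s"
  define U where "U = (SIGMA L:(\<Union>k\<le>b. models \<Gamma> k). gamma_epi \<Gamma> L H)"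
  define R where "R m = {r. set r \<subseteq> U \<and> length r = m}" for m
  have "finite (\<Union>k\<le>b. models \<Gamma> k)" using finite_models[OF fin(1)] by simp
  then have finU: "finite U"
    unfolding U_def by (rule finite_SigmaI, intro finite_gamma_epi) (use Hd in \<open>auto simp: models_def\<close>)
  have finR: "finite (R m)" and cardR: "card (R m) = card U ^ m" for m
    using finite_lists_length_eq[OF finU, of m] card_lists_length_eq[OF finU, of m]
    by (auto simp: R_def)
  \<comment> \<open>A fibre product of \<open>m\<close> factors has order at most
    \<open>b ^ m\<close>, which the polynomial bound turns into the moment bound
    \<open>A * D ^ m\<close>.\<close>
  define D where "D = real b powr B"
  have moment_FP: "(\<integral>\<^sup>+S. of_nat (card (gamma_epi \<Gamma> (rep S) (fibre_product H r))) \<partial>\<mu>) \<le> ennreal (A * D ^ m)"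
    if r: "r \<in> R m" for r m
  proof -
    have ri: "is_gamma_group \<Gamma> (fst (r ! i))" "snd (r ! i) \<in> gamma_epi \<Gamma> (fst (r ! i)) H"
      "finite (carrier (fst (r ! i)))" "card (carrier (fst (r ! i))) \<le> b" if "i < length r" for i
    proof -
      have "r ! i \<in> U" using r that by (auto simp: R_def)
      then show "is_gamma_group \<Gamma> (fst (r ! i))" "snd (r ! i) \<in> gamma_epi \<Gamma> (fst (r ! i)) H"
        "finite (carrier (fst (r ! i)))" "card (carrier (fst (r ! i))) \<le> b"
        by (auto simp: U_def models_def)
    qed
    have lr: "length r = m" using r by (simp add: R_def)
    have fp: "finite (\<Pi>\<^sub>E i\<in>{..<m}. carrier (fst (r ! i)))"
      using ri(3) lr by (intro finite_PiE) auto
    have sub: "carrier (fibre_product H r) \<subseteq> (\<Pi>\<^sub>E i\<in>{..<m}. carrier (fst (r ! i)))"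
      unfolding carrier_fibre_product lr by blast
    have F: "is_gamma_group \<Gamma> (fibre_product H r)" "finite (carrier (fibre_product H r))"
      using is_gamma_group_fibre_product[OF Hd(1) ri(1,2)] finite_subset[OF sub fp] by auto
    have "card (carrier (fibre_product H r)) \<le> card (\<Pi>\<^sub>E i\<in>{..<m}. carrier (fst (r ! i)))"
      by (rule card_mono[OF fp sub])
    also have "\<dots> = (\<Prod>i\<in>{..<m}. card (carrier (fst (r ! i))))" by (rule card_PiE) simp
    also have "\<dots> \<le> (\<Prod>i\<in>{..<m}. b)" using ri(4) lr by (intro prod_mono) auto
    finally have cF: "card (carrier (fibre_product H r)) \<le> b ^ m" by simp
    obtain L where L: "L \<in> models \<Gamma> (card (carrier (fibre_product H r)))"
      "\<And>G :: (nat, 'g) gamma_group. is_gamma_group \<Gamma> G \<Longrightarrow> finite (carrier G) \<Longrightarrow>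
        card (gamma_epi \<Gamma> G (fibre_product H r)) \<le> card (gamma_epi \<Gamma> G L)"
      using card_gamma_epi_model[OF F] by blast
    have "(\<integral>\<^sup>+S. of_nat (card (gamma_epi \<Gamma> (rep S) (fibre_product H r))) \<partial>\<mu>) \<le>
      (\<integral>\<^sup>+S. of_nat (card (gamma_epi \<Gamma> (rep S) L)) \<partial>\<mu>)"
      using L(2)[OF rd(1,2)] by (intro nn_integral_mono of_nat_mono) (auto simp: space)
    also have "\<dots> \<le> ennreal (A * D ^ m)"
    proof (cases "L \<in> level_groups \<Gamma> \<C>")
      case True
      have "real (Coset.order L) \<le> real b ^ m" "1 \<le> real (Coset.order L)"
        using L(1) cF level_groupsD(4)[OF True] by (auto simp: Coset.order_def models_def simp flip: of_nat_power)
      then have "real (Coset.order L) powr B0 \<le> (real b ^ m) powr B"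
        by (intro order.trans[OF powr_mono powr_mono2, of B0 B]) (auto simp: B_def)
      also have "(real b ^ m) powr B = D ^ m" unfolding D_def by (induction m) (auto simp: powr_mult)
      finally have "A0 * real (Coset.order L) powr B0 \<le> A * D ^ m"
        unfolding A_def by (intro mult_mono) auto
      then show ?thesis using moments[OF True] unfolding Sur by (meson ennreal_leI order.trans)
    next
      case False
      then have "gamma_epi \<Gamma> (rep S) L = {}" if "S \<in> \<Omega>" for S using model_level[OF L(1) that] by blast
      then have "(\<integral>\<^sup>+S. of_nat (card (gamma_epi \<Gamma> (rep S) L)) \<partial>\<mu>) = (\<integral>\<^sup>+S. 0 \<partial>\<mu>)"
        by (intro nn_integral_cong) (simp add: space)
      then show ?thesis by simp
    qed
    finally show ?thesis .
  qed
  \<comment> \<open>There are \<open>card U ^ m\<close> fibre products with \<open>m\<close>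
    factors, each of moment at most \<open>A * D ^ m\<close>; the factorial stems from
    \<open>mob_le_sum_indeps\<close>.\<close>
  define a where "a m = A * (real (card U) * D) ^ m / fact m" for m
  have D0: "0 \<le> D" and A0: "0 \<le> A" by (auto simp: D_def A_def)
  have a0: "0 \<le> a m" for m using D0 A0 by (simp add: a_def)
  have "summable (\<lambda>m. A * (inverse (fact m) * (real (card U) * D) ^ m))"
    by (intro summable_mult summable_exp)
  then have suma: "summable a" by (simp add: a_def[abs_def] field_simps)
  define J where "J M = {k. k \<le> card (carrier H) * s ^ M \<and> card (carrier H) * s ^ M < k * s}" for M
  have finJ: "finite (J M)" for M
    by (rule finite_subset[of _ "{..card (carrier H) * s ^ M}"]) (auto simp: J_def)
  \<comment> \<open>Positivity of \<open>M\<close> excludes the empty list, whose fibre product does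
    not determine the surjection onto \<open>H\<close>.\<close>
  have T_le: "ennreal (T S abs (J M)) \<le> suminf (\<lambda>i. ennreal (1 / fact (i + M)) *
      (\<Sum>r\<in>R (i + M). of_nat (card (gamma_epi \<Gamma> (rep S) (fibre_product H r)))))"
    if S: "S \<in> \<Omega>" and M: "0 < M" for S M
  proof -
    define I where "I p = indeps (gmaximal \<Gamma> (rep S) (kernel (rep S) H p)) (kernel (rep S) H p)" for p
    define P where "P = (SIGMA p:gamma_epi \<Gamma> (rep S) H. {l \<in> I p. M \<le> length l})"
    have finI: "finite (I p)" for p
      unfolding I_def by (intro finite_indeps finite_gmaximal rd[OF S])
    have finE: "finite (gamma_epi \<Gamma> (rep S) H)" by (intro finite_gamma_epi rd[OF S] Hd)
    have finP: "finite P" unfolding P_def using finI finE by auto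
    have "T S abs (J M) \<le> (\<Sum>p\<in>gamma_epi \<Gamma> (rep S) H. \<Sum>l | l \<in> I p \<and> M \<le> length l. 1 / fact (length l))"
      unfolding T_def J_def I_def by (rule level_groups_truncation(2)[OF fin C rep[OF S] H s])
    also have "\<dots> = (\<Sum>x\<in>P. 1 / fact (length (snd x)))"
      unfolding P_def using finI finE by (subst sum.Sigma) (auto simp: case_prod_beta)
    finally have "ennreal (T S abs (J M)) \<le> ennreal (\<Sum>x\<in>P. 1 / fact (length (snd x)))"
      by (rule ennreal_leI)
    also have "\<dots> \<le> suminf (\<lambda>i. ennreal (1 / fact (i + M)) * of_nat (card {x \<in> P. length (snd x) = i + M}))"
      by (rule sum_fact_le_suminf[OF finP]) (auto simp: P_def)
    also have "\<dots> \<le> suminf (\<lambda>i. ennreal (1 / fact (i + M)) *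
      (\<Sum>r\<in>R (i + M). of_nat (card (gamma_epi \<Gamma> (rep S) (fibre_product H r)))))"
    proof (intro suminf_le mult_left_mono)
      fix i
      have "{x \<in> P. length (snd x) = i + M} = (SIGMA p:gamma_epi \<Gamma> (rep S) H. {l \<in> I p. length l = i + M})"
        by (auto simp: P_def)
      then have "card {x \<in> P. length (snd x) = i + M} =
        (\<Sum>p\<in>gamma_epi \<Gamma> (rep S) H. card {l \<in> I p. length l = i + M})"
        using finI finE by (simp add: card_SigmaI)
      also have "\<dots> \<le> (\<Sum>r\<in>R (i + M). card (gamma_epi \<Gamma> (rep S) (fibre_product H r)))"
        unfolding I_def R_def U_def
      proof (rule sum_indeps_le[OF rd(1,2)[OF S] Hd(1,2) fin(1)])
        fix p a assume pa: "p \<in> gamma_epi \<Gamma> (rep S) H" "a \<in> gmaximal \<Gamma> (rep S) (kernel (rep S) H p)"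
        have "card (carrier (rep S)) div card a \<le> card (carrier H) * chief_bound \<Gamma> \<C> (card (carrier H))"
          by (rule gmaximal_chief_bound(1)[OF rd(1-3)[OF S] fin(2) C fin(1) Hd(1) pa])
        then show "card (carrier (rep S)) div card a \<le> b"
          unfolding b_def using s(2) by (meson le_trans mult_le_mono2)
      qed (use M in simp)
      finally have "of_nat (card {x \<in> P. length (snd x) = i + M}) \<le>
        (of_nat (\<Sum>r\<in>R (i + M). card (gamma_epi \<Gamma> (rep S) (fibre_product H r))) :: ennreal)"
        by (rule of_nat_mono)
      then show "of_nat (card {x \<in> P. length (snd x) = i + M}) \<le>
        (\<Sum>r\<in>R (i + M). of_nat (card (gamma_epi \<Gamma> (rep S) (fibre_product H r))) :: ennreal)"
        by simp
    qed auto
    finally show ?thesis .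
  qed
  have T0: "0 \<le> T S abs (J M)" for S M
    unfolding T_def weight_def by (intro sum_nonneg) simp
  have small: "\<exists>M. integral\<^sup>L \<mu> (\<lambda>S. T S abs (J M)) < e" if e: "0 < e" for e
  proof -
    obtain M0 where M0: "\<And>n. M0 \<le> n \<Longrightarrow> norm (suminf (\<lambda>i. a (i + n))) < e"
      using suminf_exist_split[OF e suma] by blast
    \<comment> \<open>The successor provides the positivity that \<open>T_le\<close> asks
      for.\<close>
    define M where "M = Suc M0"
    have "(\<integral>\<^sup>+S. ennreal (T S abs (J M)) \<partial>\<mu>) \<le> (\<integral>\<^sup>+S. suminf (\<lambda>i. ennreal (1 / fact (i + M)) *
      (\<Sum>r\<in>R (i + M). of_nat (card (gamma_epi \<Gamma> (rep S) (fibre_product H r))))) \<partial>\<mu>)"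
      using T_le[of _ M] by (intro nn_integral_mono) (auto simp: space M_def)
    also have "\<dots> = suminf (\<lambda>i. \<integral>\<^sup>+S. ennreal (1 / fact (i + M)) *
      (\<Sum>r\<in>R (i + M). of_nat (card (gamma_epi \<Gamma> (rep S) (fibre_product H r)))) \<partial>\<mu>)"
      by (rule nn_integral_suminf) (simp add: meas)
    also have "\<dots> \<le> suminf (\<lambda>i. ennreal (a (i + M)))"
    proof (intro suminf_le)
      fix i
      have "(\<integral>\<^sup>+S. ennreal (1 / fact (i + M)) *
          (\<Sum>r\<in>R (i + M). of_nat (card (gamma_epi \<Gamma> (rep S) (fibre_product H r)))) \<partial>\<mu>) =
        ennreal (1 / fact (i + M)) *
          (\<Sum>r\<in>R (i + M). \<integral>\<^sup>+S. of_nat (card (gamma_epi \<Gamma> (rep S) (fibre_product H r))) \<partial>\<mu>)"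
        by (simp add: nn_integral_cmult nn_integral_sum meas)
      also have "\<dots> \<le> ennreal (1 / fact (i + M)) * (\<Sum>r\<in>R (i + M). ennreal (A * D ^ (i + M)))"
        by (intro mult_left_mono sum_mono moment_FP) auto
      also have "\<dots> = ennreal (1 / fact (i + M)) * ennreal (card U ^ (i + M) * (A * D ^ (i + M)))"
        using A0 D0 by (subst sum_ennreal) (auto simp: cardR)
      also have "\<dots> = ennreal (a (i + M))"
        using A0 D0 by (subst ennreal_mult[symmetric]) (auto simp: a_def power_mult_distrib)
      finally show "(\<integral>\<^sup>+S. ennreal (1 / fact (i + M)) *
          (\<Sum>r\<in>R (i + M). of_nat (card (gamma_epi \<Gamma> (rep S) (fibre_product H r)))) \<partial>\<mu>) \<le> ennreal (a (i + M))" .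
    qed auto
    also have "\<dots> = ennreal (suminf (\<lambda>i. a (i + M)))"
      using suma a0 by (intro suminf_ennreal2) (auto simp: summable_iff_shift)
    finally have "integral\<^sup>L \<mu> (\<lambda>S. T S abs (J M)) \<le> suminf (\<lambda>i. a (i + M))"
      using T0 a0 suma
      by (subst integral_eq_nn_integral)
        (auto simp: meas intro!: enn2real_leI suminf_nonneg simp: summable_iff_shift)
    also have "\<dots> < e" using M0[of M] by (simp add: M_def abs_less_iff)
    finally show ?thesis by blast
  qed
  \<comment> \<open>As \<open>H\<close> is finite, this is the order of its automorphism group; it
    is positive and is divided out at the end.\<close>
  define c where "c = card (gamma_epi \<Gamma> H H)"
  have conv_c: "converges \<mu>t \<mu> (\<lambda>S. real c * indicator {iso_class \<Gamma> \<C> H} S)"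
  proof (rule converges_sandwich)
    fix e :: real assume "0 < e"
    then obtain M where M: "integral\<^sup>L \<mu> (\<lambda>S. T S abs (J M)) < e" using small by blast
    show "\<exists>u v. converges \<mu>t \<mu> u \<and> converges \<mu>t \<mu> v \<and>
      (\<forall>S\<in>space \<mu>. \<bar>real c * indicator {iso_class \<Gamma> \<C> H} S - u S\<bar> \<le> v S) \<and> integral\<^sup>L \<mu> v < e"
    proof (intro exI conjI ballI)
      show "converges \<mu>t \<mu> (\<lambda>S. T S (\<lambda>x. x) {..card (carrier H) * s ^ M})" by (rule conv_T) simp
      show "converges \<mu>t \<mu> (\<lambda>S. T S abs (J M))" by (rule conv_T) (rule finJ)
      fix S assume "S \<in> space \<mu>"
      then have S: "S \<in> \<Omega>" by (simp add: space)
      have "S \<in> level_classes \<Gamma> \<C>" using S by (simp add: \<Omega>_def)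
      from sum_kernel_trivial[OF this H]
      show "\<bar>real c * indicator {iso_class \<Gamma> \<C> H} S - T S (\<lambda>x. x) {..card (carrier H) * s ^ M}\<bar> \<le> T S abs (J M)"
        using level_groups_truncation(1)[OF fin C rep[OF S] H s, of M]
        by (simp add: c_def T_def J_def rep_def)
    qed (rule M)
  qed (auto simp: space meas)
  have "0 < c"
  proof -
    have "(\<lambda>x\<in>carrier H. x) \<in> gamma_epi \<Gamma> H H"
      using iso_gamma_epi[of "\<lambda>x. x" H H \<Gamma>] Hd(1)
      by (simp add: iso_def hom_def equivariant_def bij_betw_def)
    then show ?thesis unfolding c_def using finite_gamma_epi[OF Hd(2,2)] by (auto simp: card_gt_0_iff)
  qed
  then have "(\<lambda>S. 1 / real c * (real c * indicator {iso_class \<Gamma> \<C> H} S)) =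
      (indicator {iso_class \<Gamma> \<C> H} :: _ \<Rightarrow> real)"
    by (simp add: fun_eq_iff)
  with converges_mult[OF conv_c, of "1 / real c"]
  have conv: "converges \<mu>t \<mu> (indicator {iso_class \<Gamma> \<C> H} :: _ \<Rightarrow> real)"
    by simp
  define E where "E = {iso_class \<Gamma> \<C> H}"
  have "iso_class \<Gamma> \<C> H \<in> \<Omega>"
    unfolding \<Omega>_def level_classes_def iso_class_def by (rule quotientI[OF H])
  then have E: "E \<in> sets \<mu>" "\<And>t. E \<in> sets (\<mu>t t)"
    using assms(6,7) by (auto simp: E_def \<Omega>_def)
  have em: "emeasure M E = ennreal (integral\<^sup>L M (indicator E))"
    if "integrable M (indicator E :: _ \<Rightarrow> real)" "E \<in> sets M" for M
    using that by (simp add: integrable_indicator_iff emeasure_eq_ennreal_measure less_top sets.Int_space_eq2)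
  have "(\<lambda>t. ennreal (integral\<^sup>L (\<mu>t t) (indicator E))) \<longlonglongrightarrow> ennreal (integral\<^sup>L \<mu> (indicator E))"
    using conv by (intro tendsto_ennrealI) (simp add: converges_def E_def)
  \<comment> \<open>For small \<open>t\<close> the class may have infinite measure while the Bochner
    integral of its indicator is 0; the two agree as soon as the indicator is integrable.\<close>
  moreover have "\<forall>\<^sub>F t in sequentially. ennreal (integral\<^sup>L (\<mu>t t) (indicator E)) = emeasure (\<mu>t t) E"
    using conv em[OF _ E(2)] by (auto simp: converges_def E_def elim: eventually_mono)
  ultimately have "(\<lambda>t. emeasure (\<mu>t t) E) \<longlonglongrightarrow> ennreal (integral\<^sup>L \<mu> (indicator E))"
    by (rule Lim_transform_eventually)
  then show "(\<lambda>t. emeasure (\<mu>t t) {iso_class \<Gamma> \<C> H}) \<longlonglongrightarrow> emeasure \<mu> {iso_class \<Gamma> \<C> H}"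
    using conv em[OF _ E(1)] by (simp add: converges_def E_def)
qed


end
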